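(* Let $X$ be a non-degenerate self-decomposable random vector in $\mathbb{R}^d$ ($d\ge 1$) without Gaussian component, with law $\mu_X$, with Lévy measure $\nu$ and such that $\mathbb{E}\|X\|<\infty$. Let $\lambda$ and $(k_x)_{x\in S^{d-1}}$ be the elements of the polar decomposition of $\nu$ (see context), and assume moreover that $\sup_{x\in S^{d-1}}\sup_{r\in(a,b)}k_x(r)<+\infty$ for all $0<a<b<+\infty$. Let $h\in\mathcal{H}_2\cap\mathcal{C}_c^\infty(\mathbb{R}^d)$ and let $f_h$ be the function $$f_h(x)=-\int_0^{+\infty}\big(P_t^\nu(h)(x)-\mathbb{E}h(X)\big)\,dt,\qquad x\in\mathbb{R}^d.$$ Then, for all $x\in\mathbb{R}^d$, $$\langle \mathbb{E}X-x;\nabla(f_h)(x)\rangle+\int_{\mathbb{R}^d}\langle\nabla(f_h)(x+u)-\nabla(f_h)(x);u\rangle\,\nu(du)=h(x)-\mathbb{E}h(X).$$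
   Context: $\|\cdot\|$ and $\langle\cdot;\cdot\rangle$ are the Euclidean norm and inner product on $\mathbb{R}^d$; $S^{d-1}$ is the Euclidean unit sphere and $D$ the closed Euclidean unit ball. A Lévy measure is a positive Borel measure $\nu$ on $\mathbb{R}^d$ with $\nu(\{0\})=0$ and $\int(1\wedge\|u\|^2)\nu(du)<\infty$. $X\sim ID(b,A,\nu)$ (infinitely divisible) means its characteristic function is $\exp\big(i\langle b;\xi\rangle-\frac12\langle\xi;A\xi\rangle+\int(e^{i\langle\xi;u\rangle}-1-i\langle\xi;u\rangle\mathbf{1}_D(u))\nu(du)\big)$; "without Gaussian component" means $A=0$. Non-degenerate means that the support of the law is not contained in a $(d-1)$-dimensional subspace of $\mathbb{R}^d$. A random vector $X$ with characteristic function $\varphi$ is self-decomposable if for every $\gamma\in(0,1)$ there is a probability measure $\mu_\gamma$ on $\mathbb{R}^d$ with characteristic function $\xi\mapsto\varphi(\xi)/\varphi(\gamma\xi)$ ($\varphi$ never vanishes). Self-decomposable laws are infinitely divisible. Polar decomposition: the Lévy measure of a self-decomposable law satisfies, for Borel $B\subset\mathbb{R}^d\setminus\{0\}$, $\nu(B)=\int_{S^{d-1}}\lambda(dx)\int_0^{+\infty}\mathbf{1}_B(rx)k_x(r)\frac{dr}{r}$, with $\lambda$ a finite positive measure on $S^{d-1}$ and $k_x(r)\ge0$ measurable in $x$ and non-increasing in $r>0$. One takes $\nu\neq0$ and the normalization $\lambda(S^{d-1})=1$, $\int_0^\infty(r^2\wedge1)k_x(r)dr/r$ finite and independent of $x$,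 and $k_x(\cdot)$ right-continuous. The supremum over $x\in S^{d-1}$ is understood as a $\lambda$-essential supremum. For $t\ge0$, let $\mu_t$ be the probability measure with characteristic function $\varphi_t(\xi)=\varphi(\xi)/\varphi(e^{-t}\xi)$, and for bounded continuous $h$ set $P_t^\nu(h)(x)=\int_{\mathbb{R}^d}h(u+e^{-t}x)\mu_t(du)$. For $h:\mathbb{R}^d\to\mathbb{R}$, $M_0(h)=\sup_x|h(x)|$ and, for $\ell\ge1$, $M_\ell(h)=\sup_x\|\mathbf{D}^\ell(h)(x)\|_{op}$, where $\mathbf{D}^\ell(h)(x)$ is the $\ell$-th derivative viewed as an $\ell$-multilinear form and $\|F\|_{op}=\sup\{|F(v_1,\dots,v_\ell)|:\|v_j\|=1\}$. $\mathcal{H}_r$ is the set of bounded continuous functions on $\mathbb{R}^d$, $r$ times continuously differentiable, with $\max_{0\le\ell\le r}M_\ell(h)\le1$. $\mathcal{C}_c^\infty(\mathbb{R}^d)$ is the set of infinitely differentiable compactly supported functions. For $h \in \mathcal{H}_2$ the function $f_h$ is well defined and twice continuously differentiable. *)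

theory Defs
  imports "HOL-Probability.Probability"
begin

text \<open>
  Euclidean space is an arbitrary type of class \<^class>\<open>euclidean_space\<close>, of dimension
  \<open>d = DIM('a) \<ge> 1\<close>; laws on it are probability measures on its Borel sets.
\<close>

subsection \<open>Laws on Euclidean space\<close>

definition char_fun :: "'a::euclidean_space measure \<Rightarrow> 'a \<Rightarrow> complex" where
  "char_fun \<mu> \<xi> = (CLINT u|\<mu>. iexp (\<xi> \<bullet> u))"

definition measure_support :: "'a::topological_space measure \<Rightarrow> 'a set" where
  "measure_support \<mu> = {x. \<forall>U. open U \<and> x \<in> U \<longrightarrow> emeasure \<mu> U > 0}"

text \<open>
  ``Subspace'' is a linear subspace.  Replacing it by affine subspaces would make
  non-degeneracy a more restrictive hypothesis.
\<close>

definition nondegenerate :: "'a::euclidean_space measure \<Rightarrow> bool" where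
  "nondegenerate \<mu> \<longleftrightarrow>
     \<not> (\<exists>V. subspace V \<and> dim V = DIM('a) - 1 \<and> measure_support \<mu> \<subseteq> V)"

definition levy_measure :: "'a::euclidean_space measure \<Rightarrow> bool" where
  "levy_measure \<nu> \<longleftrightarrow> sets \<nu> = sets borel \<and> emeasure \<nu> {0} = 0 \<and>
     (\<integral>\<^sup>+u. ennreal (min 1 ((norm u)\<^sup>2)) \<partial>\<nu>) < \<infinity>"

definition levy_exponent ::
    "'a::euclidean_space \<Rightarrow> ('a \<Rightarrow> 'a) \<Rightarrow> 'a measure \<Rightarrow> 'a \<Rightarrow> complex" where
  "levy_exponent b A \<nu> \<xi> =
     \<i> * complex_of_real (b \<bullet> \<xi>) - complex_of_real (\<xi> \<bullet> A \<xi>) / 2 +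
     (CLINT u|\<nu>. iexp (\<xi> \<bullet> u) - 1
        - \<i> * complex_of_real ((\<xi> \<bullet> u) * indicator (cball 0 1) u))"

definition ID_law ::
    "'a::euclidean_space measure \<Rightarrow> 'a \<Rightarrow> ('a \<Rightarrow> 'a) \<Rightarrow> 'a measure \<Rightarrow> bool" where
  "ID_law \<mu> b A \<nu> \<longleftrightarrow>
     linear A \<and> (\<forall>x y. A x \<bullet> y = x \<bullet> A y) \<and> (\<forall>x. x \<bullet> A x \<ge> 0) \<and>
     levy_measure \<nu> \<and> (\<forall>\<xi>. char_fun \<mu> \<xi> = exp (levy_exponent b A \<nu> \<xi>))"

definition quotient_law :: "'a::euclidean_space measure \<Rightarrow> real \<Rightarrow> 'a measure \<Rightarrow> bool" where
  "quotient_law \<mu> \<gamma> \<rho> \<longleftrightarrow> prob_space \<rho> \<and> sets \<rho> = sets borel \<and>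
     (\<forall>\<xi>. char_fun \<rho> \<xi> = char_fun \<mu> \<xi> / char_fun \<mu> (\<gamma> *\<^sub>R \<xi>))"

text \<open>
  The characteristic function of a self-decomposable law has no zeros; this is made explicit
  because division by zero is total here.
\<close>

definition self_decomposable :: "'a::euclidean_space measure \<Rightarrow> bool" where
  "self_decomposable \<mu> \<longleftrightarrow> (\<forall>\<xi>. char_fun \<mu> \<xi> \<noteq> 0) \<and>
     (\<forall>\<gamma>. 0 < \<gamma> \<and> \<gamma> < 1 \<longrightarrow> (\<exists>\<rho>. quotient_law \<mu> \<gamma> \<rho>))"

text \<open>
  Normalized polar decomposition.  \<open>lam\<close> lives on the sphere with its relative Borel sets;
  only the values \<open>k x r\<close> with \<open>norm x = 1\<close> and \<open>r > 0\<close> matter.  The last conjunct says that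
  \<open>\<integral> (min 1 r\<^sup>2) k x r dr/r\<close> is finite and independent of \<open>x\<close>.
\<close>

definition polar_decomposition ::
    "'a::euclidean_space measure \<Rightarrow> 'a measure \<Rightarrow> ('a \<Rightarrow> real \<Rightarrow> real) \<Rightarrow> bool" where
  "polar_decomposition \<nu> lam k \<longleftrightarrow>
     sets lam = sets (restrict_space borel (sphere 0 1)) \<and> prob_space lam \<and>
     (\<forall>r>0. (\<lambda>x. k x r) \<in> borel_measurable lam) \<and>
     (\<forall>x\<in>sphere 0 1.
        (\<forall>r>0. k x r \<ge> 0) \<and> antimono_on {0<..} (k x) \<and>
        (\<forall>r>0. continuous (at_right r) (k x))) \<and>
     (\<forall>B\<in>sets borel. 0 \<notin> B \<longrightarrow>
        emeasure \<nu> B =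
          (\<integral>\<^sup>+x. (\<integral>\<^sup>+r\<in>{0<..}. (indicator B (r *\<^sub>R x) * ennreal (k x r / r)) \<partial>lborel) \<partial>lam)) \<and>
     (\<exists>c::real. \<forall>x\<in>sphere 0 1.
        (\<integral>\<^sup>+r\<in>{0<..}. ennreal (min 1 (r\<^sup>2) * k x r / r) \<partial>lborel) = ennreal c)"

subsection \<open>Higher derivatives and function classes\<close>

text \<open>
  \<open>higher_deriv f [v1, ..., vl] x\<close> is the \<open>l\<close>-th derivative of \<open>f\<close> at \<open>x\<close>, an \<open>l\<close>-linear form,
  evaluated at \<open>v1, ..., vl\<close>.  It is meaningful where the iterated Fr\'echet derivatives exist.
\<close>

primrec higher_deriv ::
    "('a::euclidean_space \<Rightarrow> real) \<Rightarrow> 'a list \<Rightarrow> 'a \<Rightarrow> real" where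
  "higher_deriv f [] = f"
| "higher_deriv f (v # vs) = (\<lambda>x. frechet_derivative (higher_deriv f vs) (at x) v)"

text \<open>
  In finite dimension a map into multilinear forms is differentiable (continuous) iff all its
  evaluations are.
\<close>

definition times_cont_diff :: "nat \<Rightarrow> ('a::euclidean_space \<Rightarrow> real) \<Rightarrow> bool" where
  "times_cont_diff r f \<longleftrightarrow>
     (\<forall>vs x. length vs < r \<longrightarrow> higher_deriv f vs differentiable (at x)) \<and>
     (\<forall>vs. length vs \<le> r \<longrightarrow> continuous_on UNIV (higher_deriv f vs))"

definition deriv_op_norm :: "nat \<Rightarrow> ('a::euclidean_space \<Rightarrow> real) \<Rightarrow> 'a \<Rightarrow> ereal" where
  "deriv_op_norm l f x =
     (SUP vs\<in>{vs. length vs = l \<and> (\<forall>v\<in>set vs. norm v = 1)}. ereal \<bar>higher_deriv f vs x\<bar>)"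

text \<open>For \<open>l = 0\<close> this is the supremum of \<open>\<bar>f\<bar>\<close>.\<close>

definition M_sup :: "nat \<Rightarrow> ('a::euclidean_space \<Rightarrow> real) \<Rightarrow> ereal" where
  "M_sup l f = (SUP x. deriv_op_norm l f x)"

definition H_class :: "nat \<Rightarrow> ('a::euclidean_space \<Rightarrow> real) set" where
  "H_class r = {h. bounded (range h) \<and> continuous_on UNIV h \<and> times_cont_diff r h \<and>
                   (\<forall>l\<le>r. M_sup l h \<le> 1)}"

definition Cc_infinity :: "('a::euclidean_space \<Rightarrow> real) set" where
  "Cc_infinity = {h. (\<forall>r. times_cont_diff r h) \<and> compact (closure {x. h x \<noteq> 0})}"

definition gradient :: "('a::euclidean_space \<Rightarrow> real) \<Rightarrow> 'a \<Rightarrow> 'a" where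
  "gradient f x = (THE D. GDERIV f x :> D)"

subsection \<open>The semigroup and the Stein solution\<close>

text \<open>
  Here \<open>\<mu> t\<close> stands for the law with characteristic function \<open>\<phi>(\<xi>) / \<phi>(exp (-t) \<xi>)\<close>.
\<close>

definition P_semigroup ::
    "(real \<Rightarrow> 'a::euclidean_space measure) \<Rightarrow> real \<Rightarrow> ('a \<Rightarrow> real) \<Rightarrow> 'a \<Rightarrow> real" where
  "P_semigroup \<mu> t h x = (LINT u|\<mu> t. h (u + exp (-t) *\<^sub>R x))"

definition stein_solution ::
    "'w measure \<Rightarrow> ('w \<Rightarrow> 'a::euclidean_space) \<Rightarrow> (real \<Rightarrow> 'a measure) \<Rightarrow> ('a \<Rightarrow> real)
      \<Rightarrow> 'a \<Rightarrow> real" where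
  "stein_solution M X \<mu> h x =
     - (LBINT t:{0..}. P_semigroup \<mu> t h x - (LINT \<omega>|M. h (X \<omega>)))"

end

theory Submission
  imports Defs
begin

text \<open>
  On a character \<open>e\<^sub>\<xi>(x) = exp (i \<langle>\<xi>, x\<rangle>)\<close> the semigroup is explicit,
  \<open>P\<^sub>t e\<^sub>\<xi>(x) = exp (i e\<^sup>-\<^sup>t \<langle>\<xi>, x\<rangle>) \<phi>(\<xi>) / \<phi>(e\<^sup>-\<^sup>t \<xi>)\<close>, and \<open>\<phi> = exp \<psi>\<close> is differentiable along rays
  because a finite first moment of \<open>X\<close> passes to the large jumps of \<open>\<nu>\<close>.  Integrating
  \<open>d/dt P\<^sub>t e\<^sub>\<xi>\<close> over \<open>t \<ge> 0\<close> gives the identity for characters.  Convolving \<open>h\<close> with a small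
  Gaussian turns it into a superposition of characters against a finite measure, to which the
  identity extends by Fubini.  Since \<open>h\<close> is bounded with bounded Lipschitz gradient, uniformly
  under convolution, and \<open>\<integral> min \<bar>u\<bar> \<bar>u\<bar>\<^sup>2 d\<nu>\<close> is finite, dominated convergence removes the Gaussian.
  The gradient of \<open>f\<close> is \<open>- \<integral> e\<^sup>-\<^sup>t P\<^sub>t (\<nabla>h) dt\<close>, where \<open>e\<^sup>-\<^sup>t dt\<close> is the exponential law.
\<close>

text \<open>The noise laws are given only through their characteristic functions, with no regularity
  in t, so even the measurability of t -> P_t h(x) has to be proved. On characters the dependence on
  t is explicit; statements that need more than bounds are therefore proved for superpositions of
  characters and passed to a limit. The Fourier data of the smoothed functions are not uniform along
  that limit, whereas sup, Lipschitz and second-order constants are, which is why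
  \<open>C11_pair\<close> carries exactly these. Time: a displacement v of x reaches the test
  function as exp (-t) v, so differences of the flow gain a factor exp (-t). It offsets the weight
  exp t that arises when dt is rewritten against the exponential law, and the time integrals become
  integrals of bounded functions against a probability measure. The integral defining f converges
  for the same reason: the law of X is invariant, so E h(X) is the average of P_t h over it, and |x
  - X| has finite mean. Jumps: boundedness handles large u, Lipschitz continuity handles small
  u.\<close>

section \<open>Bounds for the kernel (1 - cos (r y)) / r^2, and exchange of integrals\<close>

text \<open>Two integrations of cos \<ge> 1/2, which holds on [0, 1] because 1 < pi / 3.\<close>

lemma one_minus_cos_lower:
  fixes v :: real
  assumes "\<bar>v\<bar> \<le> 1"
  shows "v\<^sup>2 / 4 \<le> 1 - cos v"
proof -
  have pi: "1 < pi / 3" using pi_gt3 by simp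
  have half: "u / 2 \<le> sin u" if "0 \<le> u" "u \<le> 1" for u :: real
  proof -
    have "sin 0 - 0 / 2 \<le> sin u - u / 2"
    proof (rule DERIV_nonneg_imp_nondecreasing[OF \<open>0 \<le> u\<close>])
      fix x :: real assume "0 \<le> x" "x \<le> u"
      then have "cos (pi / 3) \<le> cos x"
        using pi that by (intro cos_monotone_0_pi_le) auto
      then show "\<exists>d. ((\<lambda>x. sin x - x / 2) has_real_derivative d) (at x) \<and> 0 \<le> d"
        by (intro exI[of _ "cos x - 1 / 2"] conjI)
           (auto intro!: derivative_eq_intros simp: cos_60)
    qed
    then show ?thesis by simp
  qed
  have "1 - cos 0 - 0\<^sup>2 / 4 \<le> 1 - cos \<bar>v\<bar> - \<bar>v\<bar>\<^sup>2 / 4"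
  proof (rule DERIV_nonneg_imp_nondecreasing[where f = "\<lambda>x. 1 - cos x - x\<^sup>2 / 4"])
    fix x :: real assume "0 \<le> x" "x \<le> \<bar>v\<bar>"
    then show "\<exists>d. ((\<lambda>x. 1 - cos x - x\<^sup>2 / 4) has_real_derivative d) (at x) \<and> 0 \<le> d"
      using half[of x] assms
      by (intro exI[of _ "sin x - x / 2"] conjI) (auto intro!: derivative_eq_intros)
  qed simp
  then show ?thesis by simp
qed

lemma one_minus_cos_upper: "1 - cos v \<le> v\<^sup>2 / 2" for v :: real
proof -
  have "cos v = 1 - 2 * (sin (v / 2))\<^sup>2"
    using cos_double_sin[of "v / 2"] by simp
  moreover have "(sin (v / 2))\<^sup>2 \<le> (v / 2)\<^sup>2"
    by (metis abs_le_square_iff abs_sin_x_le_abs_x)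
  ultimately show ?thesis by (simp add: power_divide)
qed

text \<open>Split at \<open>a = 1 / \<bar>y\<bar>\<close>: below it the quadratic bound contributes
  \<bar>y\<bar> / 2, above it the trivial bound 1 - cos \<le> 2 contributes 2 \<bar>y\<bar>. The
  resulting factor 5/2 is rounded up to 3.\<close>

lemma cos_kernel_upper:
  fixes y :: real
  shows "(\<integral>\<^sup>+r. ennreal ((1 - cos (r * y)) / r\<^sup>2) * indicator {0<..} r \<partial>lborel) \<le> ennreal (3 * \<bar>y\<bar>)"
proof (cases "y = 0")
  case False
  define a where "a = 1 / \<bar>y\<bar>"
  have a: "a > 0" using False by (simp add: a_def)
  have "(\<integral>\<^sup>+r. ennreal ((1 - cos (r * y)) / r\<^sup>2) * indicator {0<..} r \<partial>lborel)
     \<le> (\<integral>\<^sup>+r. ennreal (y\<^sup>2 / 2) * indicator {0..a} r + ennreal (2 / r\<^sup>2) * indicator {a..} r \<partial>lborel)"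
  proof (intro nn_integral_mono)
    fix r :: real
    have 1: "(1 - cos (r * y)) / r\<^sup>2 \<le> y\<^sup>2 / 2" if "r > 0"
      using one_minus_cos_upper[of "r * y"] that by (simp add: field_simps power_mult_distrib)
    have 2: "(1 - cos (r * y)) / r\<^sup>2 \<le> 2 / r\<^sup>2" if "r > 0"
      using cos_ge_minus_one[of "r * y"] that by (intro divide_right_mono) auto
    have "ennreal ((1 - cos (r * y)) / r\<^sup>2) \<le> ennreal (y\<^sup>2 / 2)" if "r > 0"
      using 1 that by (intro ennreal_leI) auto
    moreover have "ennreal ((1 - cos (r * y)) / r\<^sup>2) \<le> ennreal (2 / r\<^sup>2)" if "r > 0"
      using 2 that by (intro ennreal_leI) auto
    ultimately show "ennreal ((1 - cos (r * y)) / r\<^sup>2) * indicator {0<..} r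
       \<le> ennreal (y\<^sup>2 / 2) * indicator {0..a} r + ennreal (2 / r\<^sup>2) * indicator {a..} r"
      by (cases "r \<le> a"; cases "r \<ge> a")
         (simp_all add: indicator_def add_increasing2)
  qed
  also have "\<dots> = (\<integral>\<^sup>+r. ennreal (y\<^sup>2 / 2) * indicator {0..a} r \<partial>lborel)
      + (\<integral>\<^sup>+r. ennreal (2 / r\<^sup>2) * indicator {a..} r \<partial>lborel)"
    by (intro nn_integral_add) auto
  also have "(\<integral>\<^sup>+r. ennreal (2 / r\<^sup>2) * indicator {a..} r \<partial>lborel) = ennreal (0 - (- 2 / a))"
  proof (rule nn_integral_FTC_atLeast)
    fix x assume "a \<le> x"
    then have "x > 0" using a by simp
    then show "((\<lambda>r. - 2 / r) has_real_derivative 2 / x\<^sup>2) (at x)"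
      by (auto intro!: derivative_eq_intros simp: power2_eq_square)
  next
    show "((\<lambda>r::real. - 2 / r) \<longlongrightarrow> 0) at_top"
      by (intro tendsto_divide_0[OF tendsto_const] filterlim_at_top_imp_at_infinity filterlim_ident)
  qed auto
  also have "(\<integral>\<^sup>+r. ennreal (y\<^sup>2 / 2) * indicator {0..a} r \<partial>lborel) = ennreal (y\<^sup>2 / 2 * a)"
    using a by (simp add: nn_integral_cmult_indicator flip: ennreal_mult)
  also have "ennreal (y\<^sup>2 / 2 * a) + ennreal (0 - (- 2 / a)) = ennreal (y\<^sup>2 / 2 * a + 2 / a)"
    using a by (subst ennreal_plus) auto
  also have "y\<^sup>2 / 2 * a + 2 / a = 5 / 2 * \<bar>y\<bar>"
    using False unfolding a_def by (simp add: field_simps power2_eq_square)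
  also have "ennreal \<dots> \<le> ennreal (3 * \<bar>y\<bar>)"
    by (intro ennreal_leI) auto
  finally show ?thesis .
qed auto

text \<open>Only r < 1 / \<bar>y\<bar> is kept, where the quadratic lower bound applies; the
  condition on d y places this interval inside (0, d). The truncation at d anticipates the
  application, where the exponent is compared with the characteristic function only for small
  r.\<close>

lemma cos_kernel_lower:
  fixes y d :: real
  assumes "d > 0" "1 \<le> d * \<bar>y\<bar>"
  shows "ennreal (\<bar>y\<bar> / 4)
    \<le> (\<integral>\<^sup>+r. ennreal ((1 - cos (r * y)) / r\<^sup>2) * indicator {0<..<d} r \<partial>lborel)"
proof -
  define a where "a = 1 / \<bar>y\<bar>"
  have y: "y \<noteq> 0" using assms by auto
  have a: "a > 0" "a \<le> d" using y assms by (auto simp: a_def field_simps)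
  have "ennreal (\<bar>y\<bar> / 4) = (\<integral>\<^sup>+r. ennreal (y\<^sup>2 / 4) * indicator {0<..<a} r \<partial>lborel)"
    using a y by (cases "y > 0")
      (simp_all add: nn_integral_cmult_indicator a_def power2_eq_square flip: ennreal_mult)
  also have "\<dots> \<le> (\<integral>\<^sup>+r. ennreal ((1 - cos (r * y)) / r\<^sup>2) * indicator {0<..<d} r \<partial>lborel)"
  proof (intro nn_integral_mono)
    fix r :: real
    have "y\<^sup>2 / 4 \<le> (1 - cos (r * y)) / r\<^sup>2" if "r > 0" "r < a"
    proof -
      have "\<bar>r * y\<bar> \<le> 1" using that y by (auto simp: a_def field_simps abs_mult)
      from one_minus_cos_lower[OF this] show ?thesis
        using that by (simp add: field_simps power_mult_distrib)
    qed
    then have "ennreal (y\<^sup>2 / 4) \<le> ennreal ((1 - cos (r * y)) / r\<^sup>2)" if "r > 0" "r < a"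
      using that by (intro ennreal_leI) auto
    then show "ennreal (y\<^sup>2 / 4) * indicator {0<..<a} r
       \<le> ennreal ((1 - cos (r * y)) / r\<^sup>2) * indicator {0<..<d} r"
      using a by (auto simp: indicator_def)
  qed
  finally show ?thesis .
qed

text \<open>Domination by a product \<open>a x * b y\<close> is the form in which the exchanges of
  Bochner integrals below are justified. The bound is only almost everywhere in y because y may be
  time under the exponential law, where the estimates hold for t \<ge> 0.\<close>

lemma integrable_pair_bound:
  fixes f :: "'b \<Rightarrow> 'c \<Rightarrow> 'd::{banach, second_countable_topology}" and a :: "'b \<Rightarrow> real"
  assumes "sigma_finite_measure M" "sigma_finite_measure N"
    and f[measurable]: "case_prod f \<in> borel_measurable (M \<Otimes>\<^sub>M N)"
    and a: "integrable M a" and b: "integrable N b"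
    and le: "AE y in N. \<forall>x\<in>space M. norm (f x y) \<le> a x * b y"
  shows "integrable (M \<Otimes>\<^sub>M N) (case_prod f)"
proof -
  interpret M: sigma_finite_measure M by fact
  interpret N: sigma_finite_measure N by fact
  interpret pair_sigma_finite M N ..
  have x: "integrable N (f x)" "norm (LINT y|N. norm (f x y)) \<le> norm (a x * (LINT y|N. b y))"
    if "x \<in> space M" for x
  proof -
    have [measurable]: "f x \<in> borel_measurable N"
      using measurable_Pair2[OF f that] by simp
    have le': "AE y in N. norm (f x y) \<le> a x * b y" using le that by auto
    have "integrable N (\<lambda>y. a x * b y)" using b by simp
    then show i: "integrable N (f x)"
      by (rule Bochner_Integration.integrable_bound)
        (use le' in \<open>auto elim!: eventually_mono\<close>)
    have "(LINT y|N. norm (f x y)) \<le> (LINT y|N. a x * b y)"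
      using le' b i by (intro integral_mono_AE) auto
    moreover have "0 \<le> (LINT y|N. norm (f x y))" by simp
    ultimately show "norm (LINT y|N. norm (f x y)) \<le> norm (a x * (LINT y|N. b y))"
      by simp
  qed
  show ?thesis
  proof (rule Fubini_integrable)
    show "integrable M (\<lambda>x. LINT y|N. norm (case_prod f (x, y)))"
    proof (rule Bochner_Integration.integrable_bound)
      show "integrable M (\<lambda>x. a x * (LINT y|N. b y))" using a by simp
      show "AE x in M. norm (LINT y|N. norm (case_prod f (x, y))) \<le> norm (a x * (LINT y|N. b y))"
        using x by (intro AE_I2) simp
    qed simp
    show "AE x in M. integrable N (\<lambda>y. case_prod f (x, y))"
      using x by (intro AE_I2) simp
  qed simp
qed

lemma integral_swap_bound:
  fixes f :: "'b \<Rightarrow> 'c \<Rightarrow> 'd::{banach, second_countable_topology}" and a :: "'b \<Rightarrow> real"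
  assumes "sigma_finite_measure M" "sigma_finite_measure N"
    and "case_prod f \<in> borel_measurable (M \<Otimes>\<^sub>M N)"
    and "integrable M a" and "integrable N b"
    and "AE y in N. \<forall>x\<in>space M. norm (f x y) \<le> a x * b y"
  shows "(LINT x|M. LINT y|N. f x y) = (LINT y|N. LINT x|M. f x y)"
proof -
  interpret M: sigma_finite_measure M by fact
  interpret N: sigma_finite_measure N by fact
  interpret pair_sigma_finite M N ..
  show ?thesis
    using integrable_pair_bound[OF assms] by (rule Fubini_integral[symmetric])
qed

subsection \<open>The first moment of the jump measure\<close>

lemma levy_measure_sets: "levy_measure \<nu> \<Longrightarrow> sets \<nu> = sets borel"
  by (simp add: levy_measure_def)

lemma levy_measure_integrable_min:
  assumes "levy_measure \<nu>"
  shows "integrable \<nu> (\<lambda>u. min 1 ((norm u)\<^sup>2))"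
proof (rule integrableI_bounded)
  note [measurable_cong] = levy_measure_sets[OF assms]
  show "(\<lambda>u. min 1 ((norm u)\<^sup>2)) \<in> borel_measurable \<nu>" by measurable
  show "(\<integral>\<^sup>+u. ennreal (norm (min 1 ((norm u)\<^sup>2))) \<partial>\<nu>) < \<infinity>"
    using assms by (simp add: levy_measure_def)
qed

text \<open>The sets \<open>B n\<close>, where min 1 |u|^2 is at least 1 / (n + 1), have finite mass
  by Markov's inequality. They exhaust everything except the origin, which is a null set by
  definition.\<close>

lemma levy_measure_sigma_finite:
  assumes "levy_measure (\<nu> :: 'a::euclidean_space measure)"
  shows "sigma_finite_measure \<nu>"
proof
  note [measurable_cong] = levy_measure_sets[OF assms]
  have sp: "space \<nu> = UNIV" using sets_eq_imp_space_eq[OF levy_measure_sets[OF assms]] by simp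
  define B where "B n = {u::'a. 1 \<le> real (Suc n) * min 1 ((norm u)\<^sup>2)}" for n
  have Bm[measurable]: "B n \<in> sets \<nu>" for n
    unfolding B_def levy_measure_sets[OF assms] by measurable
  have fin: "emeasure \<nu> (B n) \<noteq> \<infinity>" for n
  proof -
    have "emeasure \<nu> (B n) = (\<integral>\<^sup>+u. indicator (B n) u \<partial>\<nu>)" by simp
    also have "\<dots> \<le> (\<integral>\<^sup>+u. ennreal (real (Suc n)) * ennreal (min 1 ((norm u)\<^sup>2)) \<partial>\<nu>)"
      by (intro nn_integral_mono)
        (auto simp: indicator_def B_def simp del: of_nat_Suc simp flip: ennreal_mult)
    also have "\<dots> = ennreal (real (Suc n)) * (\<integral>\<^sup>+u. ennreal (min 1 ((norm u)\<^sup>2)) \<partial>\<nu>)"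
      by (rule nn_integral_cmult) measurable
    also have "\<dots> < \<infinity>"
      using assms by (simp add: levy_measure_def ennreal_mult_less_top del: of_nat_Suc)
    finally show ?thesis by simp
  qed
  have cover: "insert {0} (range B) \<subseteq> sets \<nu>" "\<Union> (insert {0} (range B)) = space \<nu>"
  proof -
    show "insert {0} (range B) \<subseteq> sets \<nu>" using Bm by (auto simp: levy_measure_sets[OF assms])
    have "\<exists>n. u \<in> B n" if "u \<noteq> 0" for u
    proof -
      let ?m = "min 1 ((norm u)\<^sup>2)"
      have "0 < ?m" using that by simp
      then obtain n where "1 / ?m \<le> real n" using real_arch_simple by blast
      then have "1 \<le> real (Suc n) * ?m" using \<open>0 < ?m\<close>
        by (simp add: field_simps del: min_less_iff_conj)
      then show ?thesis by (auto simp: B_def)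
    qed
    then show "\<Union> (insert {0} (range B)) = space \<nu>" unfolding sp by blast
  qed
  show "\<exists>A. countable A \<and> A \<subseteq> sets \<nu> \<and> \<Union> A = space \<nu> \<and> (\<forall>a\<in>A. emeasure \<nu> a \<noteq> \<infinity>)"
    using cover fin assms
    by (intro exI[of _ "insert {0} (range B)"]) (auto simp: levy_measure_def)
qed

text \<open>Inside the unit ball this is Taylor's formula to second order; outside, the compensator
  vanishes and the rest is at most 2. The constant adds up the two regimes.\<close>

lemma levy_integrand_bound:
  "cmod (iexp (\<xi> \<bullet> u) - 1 - \<i> * complex_of_real ((\<xi> \<bullet> u) * indicator (cball 0 1) u))
     \<le> (2 + (norm \<xi>)\<^sup>2) * min 1 ((norm u)\<^sup>2)"
proof (cases "norm u \<le> 1")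
  case True
  have "cmod (iexp (\<xi> \<bullet> u) - 1 - \<i> * complex_of_real (\<xi> \<bullet> u)) \<le> \<bar>\<xi> \<bullet> u\<bar>\<^sup>2 / 2"
    using iexp_approx1[of "\<xi> \<bullet> u" 1] by (simp add: numeral_2_eq_2 diff_diff_eq)
  also have "\<dots> \<le> (norm \<xi> * norm u)\<^sup>2 / 2"
    by (intro divide_right_mono power_mono Cauchy_Schwarz_ineq2) auto
  also have "\<dots> \<le> (2 + (norm \<xi>)\<^sup>2) * (norm u)\<^sup>2"
    by (simp add: power_mult_distrib algebra_simps)
  finally show ?thesis using True by (simp add: power_le_one)
next
  case False
  have "cmod (iexp (\<xi> \<bullet> u) - 1) \<le> 2"
    using norm_triangle_ineq4[of "iexp (\<xi> \<bullet> u)" 1] by simp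
  moreover have "1 \<le> (norm u)\<^sup>2" using False by (simp add: one_le_power)
  ultimately show ?thesis using False by (simp add: add_increasing2)
qed

lemma levy_integrand_integrable:
  assumes "levy_measure (\<nu> :: 'a::euclidean_space measure)"
  shows "integrable \<nu> (\<lambda>u. iexp (\<xi> \<bullet> u) - 1
    - \<i> * complex_of_real ((\<xi> \<bullet> u) * indicator (cball 0 1) u))"
proof (rule Bochner_Integration.integrable_bound)
  note [measurable_cong] = levy_measure_sets[OF assms]
  have [measurable]: "cball (0::'a) 1 \<in> sets borel" by simp
  show "integrable \<nu> (\<lambda>u. (2 + (norm \<xi>)\<^sup>2) * min 1 ((norm u)\<^sup>2))"
    using levy_measure_integrable_min[OF assms] by simp
  show "(\<lambda>u. iexp (\<xi> \<bullet> u) - 1 - \<i> * complex_of_real ((\<xi> \<bullet> u) * indicator (cball 0 1) u))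
      \<in> borel_measurable \<nu>"
    by measurable
  show "AE u in \<nu>. cmod (iexp (\<xi> \<bullet> u) - 1 - \<i> * complex_of_real ((\<xi> \<bullet> u) * indicator (cball 0 1) u))
      \<le> norm ((2 + (norm \<xi>)\<^sup>2) * min 1 ((norm u)\<^sup>2))"
    using levy_integrand_bound[of \<xi>]
    by (intro AE_I2) (metis abs_ge_self order_trans real_norm_def)
qed

lemma levy_integrable_one_minus_cos:
  assumes "levy_measure \<nu>"
  shows "integrable \<nu> (\<lambda>u. 1 - cos (\<xi> \<bullet> u))"
proof -
  have "integrable \<nu> (\<lambda>u. - Re (iexp (\<xi> \<bullet> u) - 1
    - \<i> * complex_of_real ((\<xi> \<bullet> u) * indicator (cball 0 1) u)))"
    using levy_integrand_integrable[OF assms] by (intro integrable_minus integrable_Re)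
  then show ?thesis by (simp add: Re_exp)
qed

text \<open>The modulus sees only the real part of the exponent; the drift and the compensator are
  purely imaginary and the quadratic form is zero.\<close>

lemma ID_law_norm_char_fun:
  assumes "ID_law L b (\<lambda>_. 0) \<nu>"
  shows "cmod (char_fun L \<xi>) = exp (- (LINT u|\<nu>. 1 - cos (\<xi> \<bullet> u)))"
proof -
  have lm: "levy_measure \<nu>" using assms by (simp add: ID_law_def)
  have "Re (levy_exponent b (\<lambda>_. 0) \<nu> \<xi>) = (LINT u|\<nu>. cos (\<xi> \<bullet> u) - 1)"
    unfolding levy_exponent_def
    using integral_Re[OF levy_integrand_integrable[OF lm, of \<xi>], symmetric] by (simp add: Re_exp)
  also have "\<dots> = (LINT u|\<nu>. - (1 - cos (\<xi> \<bullet> u)))" by simp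
  also have "\<dots> = - (LINT u|\<nu>. 1 - cos (\<xi> \<bullet> u))" by (rule Bochner_Integration.integral_minus)
  finally show ?thesis using assms by (simp add: ID_law_def norm_exp_eq_Re)
qed

lemma one_minus_cos_le_abs: "1 - cos v \<le> \<bar>v\<bar>" for v :: real
proof (cases "\<bar>v\<bar> \<le> 2")
  case True
  have "v\<^sup>2 / 2 \<le> \<bar>v\<bar>"
    using mult_left_mono[OF True, of "\<bar>v\<bar>"] by (simp add: power2_eq_square abs_mult_self_eq)
  then show ?thesis using one_minus_cos_upper[of v] by linarith
next
  case False
  then show ?thesis using cos_ge_minus_one[of v] by linarith
qed

text \<open>
  A finite first moment of the law forces \<open>\<integral> (1 - cos (r \<langle>\<theta>, u\<rangle>)) d\<nu> = - ln \<bar>\<phi>(r \<theta>)\<bar>\<close>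
  to be integrable against \<open>dr / r\<^sup>2\<close> near \<open>0\<close>, since \<open>1 - \<bar>\<phi>\<bar> \<le> E (1 - cos (r \<langle>\<theta>, X\<rangle>))\<close> and
  \<open>\<integral> (1 - cos (r y)) dr / r\<^sup>2\<close> is comparable to \<open>\<bar>y\<bar>\<close>.
\<close>
lemma levy_directional_moment:
  fixes \<theta> :: "'a::euclidean_space"
  assumes L: "prob_space L" "sets L = sets borel" "integrable L norm"
    and ID: "ID_law L b (\<lambda>_. 0) \<nu>"
  shows "\<exists>d>0. integrable \<nu> (\<lambda>u. \<bar>\<theta> \<bullet> u\<bar> * indicator {u. 1 \<le> d * \<bar>\<theta> \<bullet> u\<bar>} u)"
proof -
  interpret L: prob_space L by fact
  have lm: "levy_measure \<nu>" using ID by (simp add: ID_law_def)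
  note [measurable_cong] = L(2) levy_measure_sets[OF lm]
  interpret N: sigma_finite_measure \<nu> by (rule levy_measure_sigma_finite[OF lm])
  define S where "S r = (LINT u|\<nu>. 1 - cos (r * (\<theta> \<bullet> u)))" for r
  define q where "q r = (LINT x|L. 1 - cos (r * (\<theta> \<bullet> x)))" for r
  have int_th: "integrable L (\<lambda>x. \<bar>\<theta> \<bullet> x\<bar>)"
  proof (rule Bochner_Integration.integrable_bound)
    show "integrable L (\<lambda>x. norm \<theta> * norm x)" using L(3) by simp
    show "AE x in L. norm \<bar>\<theta> \<bullet> x\<bar> \<le> norm (norm \<theta> * norm x)"
      using Cauchy_Schwarz_ineq2[of \<theta>] by (intro AE_I2) simp
  qed measurable
  have int_q: "integrable L (\<lambda>x. 1 - cos (r * (\<theta> \<bullet> x)))" for r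
    by (rule L.integrable_const_bound[of _ 2])
       (auto intro!: AE_I2 simp: abs_le_iff intro: order_trans[OF cos_ge_minus_one])
  have int_S: "integrable \<nu> (\<lambda>u. 1 - cos (r * (\<theta> \<bullet> u)))" for r
    using levy_integrable_one_minus_cos[OF lm, of "r *\<^sub>R \<theta>"] by simp
  define E where "E = (LINT x|L. \<bar>\<theta> \<bullet> x\<bar>)"
  have E: "E \<ge> 0" unfolding E_def by simp
  \<comment> \<open>Below d the estimate q r \<le> r E gives q r \<le> 1/2, the range in which ln (1
    - q) \<ge> - q - 2 q^2 is available. The summand 1 covers E = 0.\<close>
  define d where "d = 1 / (2 * (E + 1))"
  have d: "d > 0" using E by (simp add: d_def)
  have q_le: "q r \<le> 1 / 2" if "0 < r" "r < d" for r
  proof -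
    have "q r \<le> (LINT x|L. r * \<bar>\<theta> \<bullet> x\<bar>)"
      unfolding q_def
    proof (rule integral_mono)
      show "integrable L (\<lambda>x. r * \<bar>\<theta> \<bullet> x\<bar>)" using int_th by simp
      show "1 - cos (r * (\<theta> \<bullet> x)) \<le> r * \<bar>\<theta> \<bullet> x\<bar>" for x
        using one_minus_cos_le_abs[of "r * (\<theta> \<bullet> x)"] that by (simp add: abs_mult)
    qed (rule int_q)
    also have "\<dots> = r * E" by (simp add: E_def)
    also have "\<dots> \<le> d * E" using that E by (intro mult_right_mono) auto
    also have "\<dots> \<le> 1 / 2" using E by (simp add: d_def field_simps)
    finally show ?thesis .
  qed
  have q0: "q r \<ge> 0" for r unfolding q_def by (intro Bochner_Integration.integral_nonneg) auto
  \<comment> \<open>The chain is 1 - q \<le> |phi| = exp (- S); since q^2 \<le> q / 2, the lower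
    bound for the logarithm becomes S \<le> 2 q.\<close>
  have S_le: "S r \<le> 2 * q r" if r: "0 < r" "r < d" for r
  proof -
    have int_c: "integrable L (\<lambda>x. iexp (r * (\<theta> \<bullet> x)))"
      by (rule L.integrable_const_bound[of _ 1]) auto
    have "1 - q r = (LINT x|L. cos (r * (\<theta> \<bullet> x)))"
      unfolding q_def using int_q[of r] L.prob_space
      by (subst Bochner_Integration.integral_diff)
         (auto intro!: L.integrable_const_bound[of _ 1])
    also have "\<dots> = Re (char_fun L (r *\<^sub>R \<theta>))"
      unfolding char_fun_def using integral_Re[OF int_c] by (simp add: Re_exp)
    also have "\<dots> \<le> cmod (char_fun L (r *\<^sub>R \<theta>))" by (rule complex_Re_le_cmod)
    also have "\<dots> = exp (- S r)"
      using ID_law_norm_char_fun[OF ID, of "r *\<^sub>R \<theta>"] by (simp add: S_def)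
    finally have "ln (1 - q r) \<le> - S r"
      using q_le[OF r] by (subst ln_exp[symmetric], subst ln_le_cancel_iff) auto
    moreover have "- q r - 2 * (q r)\<^sup>2 \<le> ln (1 - q r)"
      using q0 q_le[OF r] by (intro ln_one_minus_pos_lower_bound) auto
    moreover have "q r * q r \<le> q r * (1 / 2)" using q0 q_le[OF r] by (intro mult_left_mono) auto
    ultimately show ?thesis by (simp add: power2_eq_square)
  qed
  have ker_nonneg: "0 \<le> (1 - cos (r * y)) / r\<^sup>2" for r y :: real by simp
  \<comment> \<open>Tonelli is used once on each side. The lower kernel bound turns the truncated
    moment of \<open>\<nu>\<close> into an integral of S r / r^2 over (0, d), the comparison S \<le>
    2 q transfers it to the law \<open>L\<close>, and the upper kernel bound returns a multiple of
    the first moment in direction \<open>\<theta>\<close>.\<close>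
  interpret LN: pair_sigma_finite \<nu> "lborel :: real measure" ..
  interpret LL: pair_sigma_finite L "lborel :: real measure" ..
  have "(\<integral>\<^sup>+u. ennreal (\<bar>\<theta> \<bullet> u\<bar> / 4) * indicator {u. 1 \<le> d * \<bar>\<theta> \<bullet> u\<bar>} u \<partial>\<nu>)
      \<le> (\<integral>\<^sup>+u. (\<integral>\<^sup>+r. ennreal ((1 - cos (r * (\<theta> \<bullet> u))) / r\<^sup>2) * indicator {0<..<d} r \<partial>lborel) \<partial>\<nu>)"
    using cos_kernel_lower[OF d] by (intro nn_integral_mono) (auto simp: indicator_def)
  also have "\<dots> = (\<integral>\<^sup>+r. (\<integral>\<^sup>+u. ennreal ((1 - cos (r * (\<theta> \<bullet> u))) / r\<^sup>2) * indicator {0<..<d} r \<partial>\<nu>) \<partial>lborel)"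
    by (intro LN.Fubini'[symmetric]) measurable
  also have "\<dots> \<le> (\<integral>\<^sup>+r. (\<integral>\<^sup>+x. ennreal (2 * ((1 - cos (r * (\<theta> \<bullet> x))) / r\<^sup>2)) * indicator {0<..} r \<partial>L) \<partial>lborel)"
  proof (intro nn_integral_mono)
    fix r :: real
    show "(\<integral>\<^sup>+u. ennreal ((1 - cos (r * (\<theta> \<bullet> u))) / r\<^sup>2) * indicator {0<..<d} r \<partial>\<nu>)
      \<le> (\<integral>\<^sup>+x. ennreal (2 * ((1 - cos (r * (\<theta> \<bullet> x))) / r\<^sup>2)) * indicator {0<..} r \<partial>L)"
    proof (cases "0 < r \<and> r < d")
      case True
      have "(\<integral>\<^sup>+u. ennreal ((1 - cos (r * (\<theta> \<bullet> u))) / r\<^sup>2) \<partial>\<nu>) = ennreal (S r / r\<^sup>2)"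
        unfolding S_def using int_S[of r] by (subst nn_integral_eq_integral) auto
      also have "\<dots> \<le> ennreal (2 * (q r / r\<^sup>2))"
        using divide_right_mono[OF S_le[of r], of "r\<^sup>2"] True by (intro ennreal_leI) simp
      also have "2 * (q r / r\<^sup>2) = (LINT x|L. 2 * ((1 - cos (r * (\<theta> \<bullet> x))) / r\<^sup>2))"
        unfolding q_def by (simp only: integral_mult_right_zero integral_divide_zero)
      also have "ennreal \<dots> = (\<integral>\<^sup>+x. ennreal (2 * ((1 - cos (r * (\<theta> \<bullet> x))) / r\<^sup>2)) \<partial>L)"
        using int_q[of r] ker_nonneg
        by (intro nn_integral_eq_integral[symmetric] integrable_mult_right integrable_divide_zero) auto
      finally show ?thesis using True by simp
    qed auto
  qed
  also have "\<dots> = (\<integral>\<^sup>+x. (\<integral>\<^sup>+r. ennreal (2 * ((1 - cos (r * (\<theta> \<bullet> x))) / r\<^sup>2)) * indicator {0<..} r \<partial>lborel) \<partial>L)"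
    by (intro LL.Fubini') measurable
  also have "\<dots> = (\<integral>\<^sup>+x. 2 * (\<integral>\<^sup>+r. ennreal ((1 - cos (r * (\<theta> \<bullet> x))) / r\<^sup>2) * indicator {0<..} r \<partial>lborel) \<partial>L)"
    by (intro nn_integral_cong, subst nn_integral_cmult[symmetric])
      (simp_all only: ennreal_mult'[OF zero_le_numeral] ennreal_numeral mult.assoc, measurable)
  also have "\<dots> \<le> (\<integral>\<^sup>+x. 2 * ennreal (3 * \<bar>\<theta> \<bullet> x\<bar>) \<partial>L)"
    by (intro nn_integral_mono mult_left_mono cos_kernel_upper) auto
  also have "\<dots> = (\<integral>\<^sup>+x. ennreal (6 * \<bar>\<theta> \<bullet> x\<bar>) \<partial>L)"
    by (intro nn_integral_cong, subst ennreal_numeral[symmetric], subst ennreal_mult'[symmetric]) simp_all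
  also have "\<dots> < \<infinity>"
    using int_th by (subst nn_integral_eq_integral) auto
  finally have fin: "(\<integral>\<^sup>+u. ennreal (\<bar>\<theta> \<bullet> u\<bar> / 4) * indicator {u. 1 \<le> d * \<bar>\<theta> \<bullet> u\<bar>} u \<partial>\<nu>) < \<infinity>" .
  have "integrable \<nu> (\<lambda>u. \<bar>\<theta> \<bullet> u\<bar> / 4 * indicator {u. 1 \<le> d * \<bar>\<theta> \<bullet> u\<bar>} u)"
  proof (rule integrableI_bounded)
    have "(\<integral>\<^sup>+u. ennreal (norm (\<bar>\<theta> \<bullet> u\<bar> / 4 * indicator {u. 1 \<le> d * \<bar>\<theta> \<bullet> u\<bar>} u)) \<partial>\<nu>)
       = (\<integral>\<^sup>+u. ennreal (\<bar>\<theta> \<bullet> u\<bar> / 4) * indicator {u. 1 \<le> d * \<bar>\<theta> \<bullet> u\<bar>} u \<partial>\<nu>)"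
      by (intro nn_integral_cong) (auto simp: indicator_def)
    with fin show "(\<integral>\<^sup>+u. ennreal (norm (\<bar>\<theta> \<bullet> u\<bar> / 4 * indicator {u. 1 \<le> d * \<bar>\<theta> \<bullet> u\<bar>} u)) \<partial>\<nu>) < \<infinity>"
      by simp
  qed measurable
  from integrable_mult_right[OF this, of 4] d show ?thesis
    by (intro exI[of _ d]) (simp add: mult.assoc[symmetric])
qed

text \<open>For |u| > 1, |u| is at most the sum of its absolute coordinates. A coordinate with
  \<open>1 \<le> d i * \<bar>i \<bullet> u\<bar>\<close> is covered by the directional moment; any
  other is below 1 / d i, hence below 1 / d i times min 1 |u|^2, which \<open>\<nu>\<close>
  integrates.\<close>

lemma levy_first_moment:
  fixes L \<nu> :: "'a::euclidean_space measure"
  assumes L: "prob_space L" "sets L = sets borel" "integrable L norm"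
    and ID: "ID_law L b (\<lambda>_. 0) \<nu>"
  shows "integrable \<nu> (\<lambda>u. min (norm u) ((norm u)\<^sup>2))"
proof -
  have lm: "levy_measure \<nu>" using ID by (simp add: ID_law_def)
  note [measurable_cong] = levy_measure_sets[OF lm]
  obtain d where d: "\<And>i. 0 < d i"
    "\<And>i::'a. integrable \<nu> (\<lambda>u. \<bar>i \<bullet> u\<bar> * indicator {u. 1 \<le> d i * \<bar>i \<bullet> u\<bar>} u)"
    using levy_directional_moment[OF assms] by metis
  define g where "g u = min 1 ((norm u)\<^sup>2) +
      (\<Sum>i\<in>Basis. \<bar>i \<bullet> u\<bar> * indicator {u. 1 \<le> d i * \<bar>i \<bullet> u\<bar>} u + 1 / d i * min 1 ((norm u)\<^sup>2))" for u :: 'a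
  have g0: "0 \<le> \<bar>i \<bullet> u\<bar> * indicator {u. 1 \<le> d i * \<bar>i \<bullet> u\<bar>} u + 1 / d i * min 1 ((norm u)\<^sup>2)" for i u :: 'a
    using d(1)[of i] by simp
  have le: "min (norm u) ((norm u)\<^sup>2) \<le> g u" for u
  proof (cases "norm u \<le> 1")
    case True
    then have "min (norm u) ((norm u)\<^sup>2) \<le> min 1 ((norm u)\<^sup>2)" by (auto simp: min_def)
    also have "\<dots> \<le> g u" unfolding g_def using g0 by (simp add: sum_nonneg)
    finally show ?thesis .
  next
    case False
    have one: "1 \<le> (norm u)\<^sup>2" using False by (simp add: one_le_power)
    have "norm u \<le> (\<Sum>i\<in>Basis. \<bar>i \<bullet> u\<bar>)" using norm_le_l1[of u] by (simp add: inner_commute)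
    also have "\<dots> \<le> (\<Sum>i\<in>Basis. \<bar>i \<bullet> u\<bar> * indicator {u. 1 \<le> d i * \<bar>i \<bullet> u\<bar>} u + 1 / d i * min 1 ((norm u)\<^sup>2))"
    proof (intro sum_mono)
      fix i :: 'a
      show "\<bar>i \<bullet> u\<bar> \<le> \<bar>i \<bullet> u\<bar> * indicator {u. 1 \<le> d i * \<bar>i \<bullet> u\<bar>} u + 1 / d i * min 1 ((norm u)\<^sup>2)"
        using one d(1)[of i] by (cases "1 \<le> d i * \<bar>i \<bullet> u\<bar>") (auto simp: field_simps)
    qed
    also have "\<dots> \<le> g u" by (simp add: g_def)
    finally show ?thesis by simp
  qed
  show ?thesis
  proof (rule Bochner_Integration.integrable_bound)
    show "integrable \<nu> g"
      unfolding g_def using d(2) levy_measure_integrable_min[OF lm] by auto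
    show "AE u in \<nu>. norm (min (norm u) ((norm u)\<^sup>2)) \<le> norm (g u)"
      using le by (intro AE_I2) (auto intro: order_trans[OF le])
  qed measurable
qed

subsection \<open>Gaussian smoothing as a superposition of characters\<close>

lemma
  fixes f :: "'a::euclidean_space \<Rightarrow> real \<Rightarrow> 'b::{real_normed_field, banach, second_countable_topology}"
  assumes f: "\<And>b. b \<in> Basis \<Longrightarrow> integrable lborel (f b)"
  shows integrable_lborel_prod_Basis: "integrable lborel (\<lambda>x::'a. \<Prod>b\<in>Basis. f b (x \<bullet> b))" (is ?I)
    and integral_lborel_prod_Basis:
      "(LINT x|lborel. (\<Prod>b\<in>Basis. f b (x \<bullet> b))) = (\<Prod>b\<in>Basis. integral\<^sup>L lborel (f b))" (is ?E)
proof -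
  interpret product_sigma_finite "\<lambda>_::'a. lborel :: real measure" ..
  let ?T = "\<lambda>g::'a \<Rightarrow> real. \<Sum>b\<in>Basis. g b *\<^sub>R b"
  have [measurable]: "?T \<in> (\<Pi>\<^sub>M b\<in>Basis. lborel) \<rightarrow>\<^sub>M borel" by measurable
  have fm[measurable]: "f b \<in> borel_measurable borel" if "b \<in> Basis" for b
    using f[OF that] by (simp add: integrable_iff_bounded)
  have m[measurable]: "(\<lambda>x::'a. \<Prod>b\<in>Basis. f b (x \<bullet> b)) \<in> borel_measurable borel"
    by (intro borel_measurable_prod measurable_compose[OF _ fm]) auto
  have T: "(\<Prod>b\<in>Basis. f b (?T g \<bullet> b)) = (\<Prod>b\<in>Basis. f b (g b))" for g
    by (intro prod.cong) auto
  show ?I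
    by (subst lborel_eq[where 'a='a], subst integrable_distr_eq) (use product_integrable_prod[of Basis f] f in \<open>simp_all add: T\<close>)
  show ?E
    by (subst lborel_eq[where 'a='a], subst integral_distr) (use product_integral_prod[of Basis f] f in \<open>simp_all add: T\<close>)
qed

text \<open>Left unnormalised, so that up to the factor \<open>gauss_const\<close> it is its own
  Fourier transform.\<close>

definition gauss :: "'a::euclidean_space \<Rightarrow> real" where
  "gauss y = exp (- (norm y)\<^sup>2 / 2)"

definition gauss_const :: "'a::euclidean_space itself \<Rightarrow> real" where
  "gauss_const _ = sqrt (2 * pi) ^ DIM('a)"

lemma gauss_const_pos: "gauss_const TYPE('a::euclidean_space) > 0"
  by (simp add: gauss_const_def)

lemma gauss_pos: "gauss y > 0"
  by (simp add: gauss_def)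

lemma abs_gauss [simp]: "\<bar>gauss y\<bar> = gauss y"
  by (simp add: gauss_def)

lemma borel_measurable_gauss[measurable]: "gauss \<in> borel_measurable borel"
  unfolding gauss_def[abs_def] by measurable

lemma gauss_eq_prod: "gauss y = (\<Prod>b\<in>Basis. exp (- (y \<bullet> b)\<^sup>2 / 2))"
  unfolding gauss_def power2_norm_eq_inner euclidean_inner[of y y]
  by (simp add: exp_sum sum_negf sum_divide_distrib power2_eq_square flip: exp_sum)

lemma integrable_gauss_real: "integrable lborel (\<lambda>x::real. exp (- x\<^sup>2 / 2))"
  using integrable_mult_right[OF integrable_std_normal_moment[of 0], of "sqrt (2 * pi)"]
  by (simp add: std_normal_density_def)

lemma fourier_gauss_real:
  "(CLINT x|lborel. iexp (t * x) * complex_of_real (exp (- x\<^sup>2 / 2))) = sqrt (2 * pi) * exp (- t\<^sup>2 / 2)"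
proof -
  have "char std_normal_distribution t
      = (CLINT x|lborel. std_normal_density x *\<^sub>R iexp (t * x))"
    unfolding char_def by (subst integral_density) (auto simp: normal_density_nonneg)
  also have "\<dots> = (CLINT x|lborel. complex_of_real (1 / sqrt (2 * pi)) *
      (iexp (t * x) * complex_of_real (exp (- x\<^sup>2 / 2))))"
    by (simp add: std_normal_density_def scaleR_conv_of_real mult_ac)
  also have "\<dots> = complex_of_real (1 / sqrt (2 * pi)) *
      (CLINT x|lborel. iexp (t * x) * complex_of_real (exp (- x\<^sup>2 / 2)))"
    by (rule integral_mult_right_zero)
  finally show ?thesis
    by (simp add: char_std_normal_distribution field_simps)
qed

lemma
  fixes y :: "'a::euclidean_space"
  shows integrable_fourier_gauss: "integrable lborel (\<lambda>x. iexp (x \<bullet> y) * complex_of_real (gauss x))" (is ?I)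
    and fourier_gauss: "(CLINT x|lborel. iexp (x \<bullet> y) * complex_of_real (gauss x))
        = complex_of_real (gauss_const TYPE('a) * gauss y)" (is ?E)
proof -
  define f where "f b x = iexp ((y \<bullet> b) * x) * complex_of_real (exp (- x\<^sup>2 / 2))" for b :: 'a and x :: real
  have f: "integrable lborel (f b)" for b
  proof (rule Bochner_Integration.integrable_bound[OF integrable_gauss_real])
    show "f b \<in> borel_measurable lborel" unfolding f_def[abs_def] by measurable
  qed (simp add: f_def norm_mult)
  have eq: "iexp (x \<bullet> y) * complex_of_real (gauss x) = (\<Prod>b\<in>Basis. f b (x \<bullet> b))" for x
    unfolding f_def prod.distrib gauss_eq_prod euclidean_inner[of x y] of_real_prod
    by (simp add: sum_distrib_left exp_sum mult.commute)
  show ?I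
    unfolding eq by (rule integrable_lborel_prod_Basis[OF f])
  have "(CLINT x|lborel. iexp (x \<bullet> y) * complex_of_real (gauss x)) = (\<Prod>b\<in>Basis. integral\<^sup>L lborel (f b))"
    unfolding eq by (rule integral_lborel_prod_Basis[OF f])
  also have "\<dots> = (\<Prod>b\<in>Basis. complex_of_real (sqrt (2 * pi) * exp (- (y \<bullet> b)\<^sup>2 / 2)))"
    unfolding f_def fourier_gauss_real by simp
  also have "\<dots> = complex_of_real (gauss_const TYPE('a) * gauss y)"
    unfolding of_real_mult prod.distrib gauss_eq_prod gauss_const_def of_real_prod by simp
  finally show ?E .
qed

lemma integrable_gauss: "integrable lborel (gauss :: 'a::euclidean_space \<Rightarrow> real)"
  using integrable_fourier_gauss[of 0] by (simp add: complex_of_real_integrable_eq)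

lemma integral_gauss: "(LINT x::'a|lborel. gauss x) = gauss_const TYPE('a::euclidean_space)"
proof -
  have "complex_of_real (LINT x|lborel. gauss (x::'a)) = complex_of_real (gauss_const TYPE('a))"
    using fourier_gauss[of "0::'a"] by (simp add: gauss_def)
  then show ?thesis by simp
qed

lemma integrable_norm_sq_gauss: "integrable lborel (\<lambda>x::'a::euclidean_space. (norm x)\<^sup>2 * gauss x)"
proof -
  \<comment> \<open>The squared norm is a sum over coordinates c, and each summand times the
    Gaussian is again a product over coordinates, with x^2 inserted in the factor c only.\<close>
  define f where "f c b x = (if b = c then x\<^sup>2 else 1) * exp (- x\<^sup>2 / 2)" for c b :: 'a and x :: real
  have f: "integrable lborel (f c b)" for c b
    using integrable_gauss_real integrable_mult_right[OF integrable_std_normal_moment[of 2], of "sqrt (2 * pi)"]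
    by (cases "b = c") (simp_all add: f_def[abs_def] std_normal_density_def mult.commute)
  have "integrable lborel (\<lambda>x::'a. \<Sum>c\<in>Basis. \<Prod>b\<in>Basis. f c b (x \<bullet> b))"
    by (intro Bochner_Integration.integrable_sum integrable_lborel_prod_Basis f)
  also have "(\<lambda>x::'a. \<Sum>c\<in>Basis. \<Prod>b\<in>Basis. f c b (x \<bullet> b)) = (\<lambda>x. (norm x)\<^sup>2 * gauss x)"
    unfolding f_def prod.distrib gauss_eq_prod power2_norm_eq_inner
    by (subst euclidean_inner) (auto simp: fun_eq_iff sum_distrib_right prod.delta power2_eq_square)
  finally show ?thesis .
qed

lemma lborel_integral_affine:
  fixes f :: "'a::euclidean_space \<Rightarrow> 'b::{banach, second_countable_topology}"
  assumes c: "c \<noteq> 0" and [measurable]: "f \<in> borel_measurable borel"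
  shows "(LINT x|lborel. f x) = \<bar>c\<bar> ^ DIM('a) *\<^sub>R (LINT x|lborel. f (t + c *\<^sub>R x))"
  by (subst lborel_affine[OF c, of t])
     (simp add: integral_density integral_distr)

section \<open>Convolution with a Gaussian: stability of bounds, convergence, Fourier form\<close>

text \<open>For nonzero e this is convolution with the centred Gaussian density of covariance e^2
  times the identity. It is written as an average of translates of g, so that pointwise bounds are
  inherited with the same constant.\<close>

definition gauss_conv :: "real \<Rightarrow> ('a::euclidean_space \<Rightarrow> 'b::euclidean_space) \<Rightarrow> 'a \<Rightarrow> 'b" where
  "gauss_conv e g x = (1 / gauss_const TYPE('a)) *\<^sub>R (LINT y|lborel. gauss y *\<^sub>R g (x - e *\<^sub>R y))"

lemma gauss_conv_integrable:
  fixes g :: "'a::euclidean_space \<Rightarrow> 'b::euclidean_space"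
  assumes [measurable]: "g \<in> borel_measurable borel" and "\<And>x. norm (g x) \<le> K"
  shows "integrable lborel (\<lambda>y. gauss y *\<^sub>R g (x - e *\<^sub>R y))"
proof (rule Bochner_Integration.integrable_bound)
  show "integrable lborel (\<lambda>y::'a. K * gauss y)" using integrable_gauss[where 'a='a] by simp
  show "AE y in lborel. norm (gauss y *\<^sub>R g (x - e *\<^sub>R y)) \<le> norm (K * gauss y)"
  proof (intro AE_I2)
    fix y
    have "norm (gauss y *\<^sub>R g (x - e *\<^sub>R y)) \<le> K * gauss y"
      using mult_left_mono[OF assms(2)[of "x - e *\<^sub>R y"], of "gauss y"] gauss_pos[of y]
      by (simp add: mult.commute)
    then show "norm (gauss y *\<^sub>R g (x - e *\<^sub>R y)) \<le> norm (K * gauss y)" by simp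
  qed
qed measurable

lemma norm_gauss_conv_le:
  fixes g :: "'a::euclidean_space \<Rightarrow> 'b::euclidean_space"
  assumes [measurable]: "g \<in> borel_measurable borel" and le: "\<And>x. norm (g x) \<le> K"
  shows "norm (gauss_conv e g x) \<le> K"
proof -
  have "norm (LINT y|lborel. gauss y *\<^sub>R g (x - e *\<^sub>R y)) \<le> (LINT y|lborel. norm (gauss y *\<^sub>R g (x - e *\<^sub>R y)))"
    by (rule integral_norm_bound)
  also have "\<dots> \<le> (LINT y::'a|lborel. K * gauss y)"
    using integrable_gauss[where 'a='a] mult_left_mono[OF le less_imp_le[OF gauss_pos]]
    by (intro integral_mono integrable_norm[OF gauss_conv_integrable[OF assms]])
       (auto simp: mult.commute)
  also have "\<dots> = K * gauss_const TYPE('a)" by (simp add: integral_gauss)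
  finally show ?thesis
    using gauss_const_pos[where 'a='a] by (simp add: gauss_conv_def field_simps)
qed

text \<open>Merging two smoothings into a single one, evaluated at 0, reduces Lipschitz and Taylor
  bounds to the sup bound \<open>norm_gauss_conv_le\<close>.\<close>

lemma gauss_conv_diff:
  fixes f g :: "'a::euclidean_space \<Rightarrow> 'b::euclidean_space"
  assumes "f \<in> borel_measurable borel" "\<And>x. norm (f x) \<le> K"
    and "g \<in> borel_measurable borel" "\<And>x. norm (g x) \<le> K'"
  shows "gauss_conv e f x - gauss_conv e g y = gauss_conv e (\<lambda>z. f (x + z) - g (y + z)) 0"
proof -
  have "gauss_conv e (\<lambda>z. f (x + z) - g (y + z)) 0 = (1 / gauss_const TYPE('a)) *\<^sub>R
     ((LINT z|lborel. gauss z *\<^sub>R f (x - e *\<^sub>R z)) - (LINT z|lborel. gauss z *\<^sub>R g (y - e *\<^sub>R z)))"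
    unfolding gauss_conv_def
    using gauss_conv_integrable[OF assms(1,2), where e=e and x=x] gauss_conv_integrable[OF assms(3,4), where e=e and x=y]
    by (simp add: scaleR_diff_right)
  then show ?thesis by (simp add: gauss_conv_def scaleR_diff_right)
qed

lemma gauss_conv_inner:
  fixes g :: "'a::euclidean_space \<Rightarrow> 'b::euclidean_space"
  assumes "g \<in> borel_measurable borel" "\<And>x. norm (g x) \<le> K"
  shows "gauss_conv e g x \<bullet> v = gauss_conv e (\<lambda>z. g z \<bullet> v) x"
  unfolding gauss_conv_def
  using gauss_conv_integrable[OF assms, where e=e and x=x]
  by (simp add: integral_inner_left[symmetric])

lemma gauss_conv_lipschitz:
  fixes g :: "'a::euclidean_space \<Rightarrow> 'b::euclidean_space"
  assumes m[measurable]: "g \<in> borel_measurable borel" and le: "\<And>x. norm (g x) \<le> K"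
    and lip: "\<And>x y. norm (g x - g y) \<le> C * norm (x - y)"
  shows "norm (gauss_conv e g x - gauss_conv e g y) \<le> C * norm (x - y)"
  unfolding gauss_conv_diff[OF m le m le]
  by (rule norm_gauss_conv_le) (use lip[of "x + z" "y + z" for z] in auto)

lemma gauss_conv_quadratic:
  fixes g :: "'a::euclidean_space \<Rightarrow> real"
  assumes m[measurable]: "g \<in> borel_measurable borel" and le: "\<And>x. norm (g x) \<le> K"
    and [measurable]: "H \<in> borel_measurable borel" and leH: "\<And>x. norm (H x) \<le> K'"
    and quad: "\<And>x v. \<bar>g (x + v) - g x - H x \<bullet> v\<bar> \<le> C * (norm v)\<^sup>2"
  shows "\<bar>gauss_conv e g (x + v) - gauss_conv e g x - gauss_conv e H x \<bullet> v\<bar> \<le> C * (norm v)\<^sup>2"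
proof -
  have le2: "norm (g (x + v + z) - g (x + z)) \<le> K + K" for z
    using norm_triangle_ineq4[of "g (x + v + z)" "g (x + z)"] le[of "x + v + z"] le[of "x + z"] by linarith
  have leH2: "norm (H z \<bullet> v) \<le> K' * norm v" for z
    using Cauchy_Schwarz_ineq2[of "H z" v] mult_right_mono[OF leH[of z], of "norm v"] by simp
  have "gauss_conv e g (x + v) - gauss_conv e g x - gauss_conv e H x \<bullet> v
    = gauss_conv e (\<lambda>z. g (x + v + z) - g (x + z)) 0 - gauss_conv e (\<lambda>z. H z \<bullet> v) x"
    by (simp add: gauss_conv_diff[OF m le m le] gauss_conv_inner[OF _ leH])
  \<comment> \<open>The sums \<open>0 + z\<close> appear because the first smoothing is evaluated at
    0 when \<open>gauss_conv_diff\<close> merges it with the second one.\<close>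
  also have "\<dots> = gauss_conv e (\<lambda>z. (g (x + v + (0 + z)) - g (x + (0 + z))) - H (x + z) \<bullet> v) 0"
    by (rule gauss_conv_diff[OF _ le2 _ leH2]) measurable
  finally show ?thesis
    using norm_gauss_conv_le[of "\<lambda>z. (g (x + v + (0 + z)) - g (x + (0 + z))) - H (x + z) \<bullet> v" "C * (norm v)\<^sup>2" e 0]
      quad[of "x + z" v for z] by (simp add: add_ac)
qed

lemma gauss_conv_tendsto:
  fixes g :: "'a::euclidean_space \<Rightarrow> 'b::euclidean_space"
  assumes cont: "continuous_on UNIV g" and le: "\<And>x. norm (g x) \<le> K"
    and e: "e \<longlonglongrightarrow> 0"
  shows "(\<lambda>n. gauss_conv (e n) g x) \<longlonglongrightarrow> g x"
proof -
  have [measurable]: "g \<in> borel_measurable borel"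
    using cont by (rule borel_measurable_continuous_onI)
  have "(\<lambda>n. LINT y|lborel. gauss y *\<^sub>R g (x - e n *\<^sub>R y)) \<longlonglongrightarrow> (LINT y::'a|lborel. gauss y *\<^sub>R g x)"
  proof (rule integral_dominated_convergence[where w = "\<lambda>y. K * gauss y"])
    show "AE y in lborel. (\<lambda>n. gauss y *\<^sub>R g (x - e n *\<^sub>R y)) \<longlonglongrightarrow> gauss y *\<^sub>R g x"
    proof (intro AE_I2 tendsto_intros)
      fix y
      have "(\<lambda>n. x - e n *\<^sub>R y) \<longlonglongrightarrow> x - 0 *\<^sub>R y" by (intro tendsto_intros e)
      moreover have "isCont g x" using cont by (simp add: continuous_on_eq_continuous_at)
      ultimately show "(\<lambda>n. g (x - e n *\<^sub>R y)) \<longlonglongrightarrow> g x"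
        using isCont_tendsto_compose[of x g] by simp
    qed
    show "AE y in lborel. norm (gauss y *\<^sub>R g (x - e n *\<^sub>R y)) \<le> K * gauss y" for n
      using mult_left_mono[OF le less_imp_le[OF gauss_pos]]
      by (intro AE_I2) (auto simp: mult.commute)
    show "integrable lborel (\<lambda>y::'a. K * gauss y)" using integrable_gauss[where 'a='a] by simp
  qed measurable
  also have "(LINT y::'a|lborel. gauss y *\<^sub>R g x) = gauss_const TYPE('a) *\<^sub>R g x"
    using integrable_gauss[where 'a='a] by (simp add: integral_gauss)
  finally have "(\<lambda>n. gauss_conv (e n) g x) \<longlonglongrightarrow> (1 / gauss_const TYPE('a)) *\<^sub>R gauss_const TYPE('a) *\<^sub>R g x"
    unfolding gauss_conv_def by (intro tendsto_intros)
  then show ?thesis using gauss_const_pos[where 'a='a] by simp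
qed

text \<open>The kernel at (x - z) / e is, up to a constant, the Fourier transform of a Gaussian.
  Exchanging the integrals leaves the Fourier transform of g, up to a constant, as the weight W,
  which is bounded because g is integrable. Q is the Gaussian measure rescaled by 1 / e; keeping the
  complex weight W apart leaves Q a positive finite measure with a second moment.\<close>

lemma gauss_conv_fourier:
  fixes g :: "'a::euclidean_space \<Rightarrow> real"
  assumes g: "integrable lborel g" and e: "e > 0"
  obtains Q :: "'a measure" and W :: "'a \<Rightarrow> complex" and K :: real
  where "finite_measure Q" "sets Q = sets borel" "integrable Q (\<lambda>\<xi>. (norm \<xi>)\<^sup>2)"
    "W \<in> borel_measurable borel" "\<And>\<xi>. cmod (W \<xi>) \<le> K"
    "\<And>x. complex_of_real (gauss_conv e g x) = (CLINT \<xi>|Q. W \<xi> * iexp (\<xi> \<bullet> x))"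
proof
  have gm[measurable]: "g \<in> borel_measurable borel" using g by (simp add: integrable_iff_bounded)
  define c where "c = gauss_const TYPE('a)"
  have c: "c > 0" unfolding c_def by (rule gauss_const_pos)
  \<comment> \<open>One factor c comes from the normalisation of \<open>gauss_conv\<close>, the
    other from writing the kernel as a Fourier transform; e to the power of the dimension is the
    Jacobian of z = x - e y.\<close>
  define C where "C = 1 / (c\<^sup>2 * e ^ DIM('a))"
  have C0: "0 \<le> C" using c e by (simp add: C_def)
  define T where "T \<xi> = (1 / e) *\<^sub>R \<xi>" for \<xi> :: 'a
  have [measurable]: "T \<in> borel_measurable borel" unfolding T_def[abs_def] by measurable
  define Q where "Q = distr (density lborel gauss) borel T"
  define W where "W \<xi> = complex_of_real C * (CLINT z|lborel. g z *\<^sub>R iexp (- (\<xi> \<bullet> z)))" for \<xi> :: 'a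
  have fin: "finite_measure (density lborel (gauss :: 'a \<Rightarrow> real))"
    using integrable_gauss[where 'a='a]
    by (intro finite_measureI) (simp add: emeasure_density integrable_iff_bounded)
  show "finite_measure Q"
    unfolding Q_def by (rule finite_measure.finite_measure_distr[OF fin]) measurable
  show "sets Q = sets borel" by (simp add: Q_def)
  show "integrable Q (\<lambda>\<xi>. (norm \<xi>)\<^sup>2)"
  proof -
    have "integrable (density lborel gauss) (\<lambda>\<xi>::'a. (norm \<xi>)\<^sup>2)"
      using integrable_norm_sq_gauss[where 'a='a] gauss_pos[THEN less_imp_le]
      by (subst integrable_density) (auto simp: mult.commute)
    then show ?thesis
      unfolding Q_def by (simp add: integrable_distr_eq T_def power_divide)
  qed
  have Wm: "(\<lambda>\<xi>. CLINT z|lborel. g z *\<^sub>R iexp (- (\<xi> \<bullet> z))) \<in> borel_measurable (borel :: 'a measure)"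
    by (rule lborel.borel_measurable_lebesgue_integral) measurable
  then show [measurable]: "W \<in> borel_measurable borel"
    unfolding W_def[abs_def] by measurable
  show "cmod (W \<xi>) \<le> C * (LINT z|lborel. \<bar>g z\<bar>)" for \<xi>
  proof -
    have "cmod (CLINT z|lborel. g z *\<^sub>R iexp (- (\<xi> \<bullet> z))) \<le> (LINT z|lborel. cmod (g z *\<^sub>R iexp (- (\<xi> \<bullet> z))))"
      by (rule integral_norm_bound)
    also have "\<dots> = (LINT z|lborel. \<bar>g z\<bar>)" by simp
    finally show ?thesis
      using mult_left_mono[OF _ C0] C0 by (simp add: W_def norm_mult)
  qed
  show "complex_of_real (gauss_conv e g x) = (CLINT \<xi>|Q. W \<xi> * iexp (\<xi> \<bullet> x))" for x
  proof -
    \<comment> \<open>The substitution is y = (x - z) / e, an affine map with factor - 1 /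
      e.\<close>
    have "(LINT y|lborel. gauss y *\<^sub>R g (x - e *\<^sub>R y))
        = \<bar>- 1 / e\<bar> ^ DIM('a) *\<^sub>R (LINT z|lborel. gauss ((1 / e) *\<^sub>R x + (- 1 / e) *\<^sub>R z) *\<^sub>R
             g (x - e *\<^sub>R ((1 / e) *\<^sub>R x + (- 1 / e) *\<^sub>R z)))"
      using e by (intro lborel_integral_affine) auto
    also have "\<dots> = (1 / e ^ DIM('a)) * (LINT z|lborel. gauss (T (x - z)) * g z)"
      using e by (simp add: power_divide T_def scaleR_diff_right algebra_simps)
    finally have "gauss_conv e g x = C * c * (LINT z|lborel. gauss (T (x - z)) * g z)"
      unfolding gauss_conv_def c_def[symmetric] C_def using c by (simp add: power2_eq_square)
    then have "complex_of_real (gauss_conv e g x)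
        = C * (CLINT z|lborel. complex_of_real (c * gauss (T (x - z))) * g z)"
      by (simp add: mult.assoc integral_complex_of_real[symmetric] del: integral_complex_of_real)
    also have "(CLINT z|lborel. complex_of_real (c * gauss (T (x - z))) * g z) =
        (CLINT z|lborel. CLINT \<xi>|lborel. iexp (\<xi> \<bullet> T (x - z)) * complex_of_real (gauss \<xi>) * g z)"
      unfolding c_def fourier_gauss[symmetric] by simp
    also have "\<dots> = (CLINT \<xi>|lborel. CLINT z|lborel. iexp (\<xi> \<bullet> T (x - z)) * complex_of_real (gauss \<xi>) * g z)"
      by (rule integral_swap_bound[where a = "\<lambda>z. \<bar>g z\<bar>" and b = gauss])
         (use g integrable_gauss[where 'a='a] gauss_pos[THEN less_imp_le] in
          \<open>auto simp: norm_mult mult.commute intro!: AE_I2 sigma_finite_lborel\<close>)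
    also have "\<dots> = (CLINT \<xi>|lborel. gauss \<xi> *\<^sub>R ((CLINT z|lborel. g z *\<^sub>R iexp (- (T \<xi> \<bullet> z))) * iexp (T \<xi> \<bullet> x)))"
    proof (intro Bochner_Integration.integral_cong refl)
      fix \<xi> :: 'a
      have "(CLINT z|lborel. iexp (\<xi> \<bullet> T (x - z)) * complex_of_real (gauss \<xi>) * g z)
        = (CLINT z|lborel. (complex_of_real (gauss \<xi>) * iexp (T \<xi> \<bullet> x)) * (g z *\<^sub>R iexp (- (T \<xi> \<bullet> z))))"
        by (intro Bochner_Integration.integral_cong refl)
           (simp add: T_def inner_diff_right diff_divide_distrib right_diff_distrib exp_diff exp_minus
             scaleR_conv_of_real field_simps)
      also have "\<dots> = (complex_of_real (gauss \<xi>) * iexp (T \<xi> \<bullet> x)) * (CLINT z|lborel. g z *\<^sub>R iexp (- (T \<xi> \<bullet> z)))"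
        by (rule integral_mult_right_zero)
      finally show "(CLINT z|lborel. iexp (\<xi> \<bullet> T (x - z)) * complex_of_real (gauss \<xi>) * g z) =
         gauss \<xi> *\<^sub>R ((CLINT z|lborel. g z *\<^sub>R iexp (- (T \<xi> \<bullet> z))) * iexp (T \<xi> \<bullet> x))"
        by (simp add: scaleR_conv_of_real mult_ac)
    qed
    also have "complex_of_real C * \<dots> = (CLINT \<xi>|lborel. gauss \<xi> *\<^sub>R (W (T \<xi>) * iexp (T \<xi> \<bullet> x)))"
      unfolding W_def by (subst integral_mult_right_zero[symmetric]) (simp add: mult_ac)
    also have "\<dots> = (CLINT \<xi>|density lborel gauss. W (T \<xi>) * iexp (T \<xi> \<bullet> x))"
    proof (rule integral_density[symmetric])
      show "AE y in lborel. 0 \<le> gauss (y::'a)" by (intro AE_I2 less_imp_le[OF gauss_pos])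
    qed measurable
    also have "\<dots> = (CLINT \<xi>|Q. W \<xi> * iexp (\<xi> \<bullet> x))"
      unfolding Q_def by (rule integral_distr[symmetric]) measurable
    finally show ?thesis .
  qed
qed

subsection \<open>Derivatives of the characteristic exponent\<close>

text \<open>The integrands below depend on u through p = |<xi, u>| \<le> |xi| |u| and are bounded
  both by 2 p and by a multiple of p^2. This converts the two bounds into domination by min |u|
  |u|^2, the function that \<open>\<nu>\<close> integrates.\<close>

lemma le_min_linear_quadratic:
  fixes n p x a z :: real
  assumes "0 \<le> n" "0 \<le> x" "0 \<le> a" "0 \<le> p" "p \<le> x * n" "z \<le> 2 * p" "z \<le> a * p\<^sup>2"
  shows "z \<le> (2 * x + a * x\<^sup>2) * min n (n\<^sup>2)"
proof (cases "n \<le> n\<^sup>2")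
  case True
  have "z \<le> 2 * (x * n)" using assms by linarith
  also have "\<dots> \<le> (2 * x + a * x\<^sup>2) * n"
    using assms by (simp add: distrib_right)
  finally show ?thesis using True by (simp add: min_def)
next
  case False
  have "z \<le> a * (x * n)\<^sup>2"
    using assms power_mono[of p "x * n" 2] mult_left_mono[of "p\<^sup>2" "(x * n)\<^sup>2" a] by linarith
  also have "\<dots> \<le> (2 * x + a * x\<^sup>2) * n\<^sup>2"
    using assms by (simp add: distrib_right power_mult_distrib)
  finally show ?thesis using False by (simp add: min_def)
qed

lemma cmod_iexp_minus_one_le: "cmod (iexp y - 1) \<le> 2" "cmod (iexp y - 1) \<le> \<bar>y\<bar>"
  using norm_triangle_ineq4[of "iexp y" 1] iexp_approx1[of y 0] by simp_all

lemma cmod_iexp_compensated_le: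
  "cmod (iexp y - 1 - \<i> * complex_of_real y) \<le> 2 * \<bar>y\<bar>"
  "cmod (iexp y - 1 - \<i> * complex_of_real y) \<le> \<bar>y\<bar>\<^sup>2 / 2"
  using iexp_approx2[of y 1] iexp_approx1[of y 1] by (simp_all add: numeral_2_eq_2 diff_diff_eq)

text \<open>Difference quotients, unlike the Frechet form, can be tested along sequences and so are
  accessible to dominated convergence.\<close>

lemma has_vector_derivative_iff_LIM:
  fixes f :: "real \<Rightarrow> 'b::real_normed_vector"
  shows "(f has_vector_derivative D) (at r) \<longleftrightarrow> (\<lambda>s. (f (r + s) - f r) /\<^sub>R s) \<midarrow>0\<rightarrow> D"
proof -
  have "norm (f (r + s) - f r - s *\<^sub>R D) / norm s = norm ((f (r + s) - f r) /\<^sub>R s - D)" if "s \<noteq> 0" for s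
  proof -
    have "(f (r + s) - f r) /\<^sub>R s - D = (f (r + s) - f r - s *\<^sub>R D) /\<^sub>R s"
      using that by (simp add: scaleR_diff_right)
    then show ?thesis by (simp add: divide_inverse mult.commute)
  qed
  then have "(\<lambda>s. norm (f (r + s) - f r - s *\<^sub>R D) / norm s) \<midarrow>0\<rightarrow> 0 \<longleftrightarrow>
      (\<lambda>s. norm ((f (r + s) - f r) /\<^sub>R s - D)) \<midarrow>0\<rightarrow> 0"
    by (intro LIM_cong) auto
  then show ?thesis
    unfolding has_vector_derivative_def has_derivative_at tendsto_norm_zero_iff LIM_zero_iff
    by (simp add: bounded_linear_scaleR_left)
qed

lemma has_vector_derivative_i_times:
  "((\<lambda>r. \<i> * complex_of_real (r * y)) has_vector_derivative \<i> * complex_of_real y) (at r)"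
  by (auto intro!: derivative_eq_intros simp: scaleR_conv_of_real)

lemma has_vector_derivative_iexp_times:
  "((\<lambda>r. iexp (r * y)) has_vector_derivative \<i> * complex_of_real y * iexp (r * y)) (at r)"
  using field_vector_diff_chain_at[OF has_vector_derivative_i_times DERIV_exp] by (simp only: o_def)

text \<open>All jumps are compensated, not only those in the unit ball. With a finite first moment
  of the large jumps this converges, and the drift left over is the mean of the law.\<close>

definition compensated_exponent :: "'a::euclidean_space measure \<Rightarrow> 'a \<Rightarrow> complex" where
  "compensated_exponent \<nu> \<xi> = (CLINT u|\<nu>. iexp (\<xi> \<bullet> u) - 1 - \<i> * complex_of_real (\<xi> \<bullet> u))"

text \<open>The derivative of \<open>compensated_exponent\<close> along the ray r xi. At r = exp
  (-t) it is also the factor by which the jump part of the Stein operator acts on the flow of a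
  character.\<close>

definition compensated_slope :: "'a::euclidean_space measure \<Rightarrow> 'a \<Rightarrow> real \<Rightarrow> complex" where
  "compensated_slope \<nu> \<xi> r = (CLINT u|\<nu>. \<i> * complex_of_real (\<xi> \<bullet> u) * (iexp (r * (\<xi> \<bullet> u)) - 1))"

locale levy_first_moment_measure =
  fixes \<nu> :: "'a::euclidean_space measure"
  assumes levy: "levy_measure \<nu>"
    and first_moment: "integrable \<nu> (\<lambda>u. min (norm u) ((norm u)\<^sup>2))"
begin

sublocale sigma_finite_measure \<nu>
  by (rule levy_measure_sigma_finite[OF levy])

lemma sets_nu[measurable_cong, simp]: "sets \<nu> = sets borel"
  by (rule levy_measure_sets[OF levy])

lemma compensated_bound:
  "cmod (iexp (\<xi> \<bullet> u) - 1 - \<i> * complex_of_real (\<xi> \<bullet> u))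
     \<le> (2 * norm \<xi> + 1 / 2 * (norm \<xi>)\<^sup>2) * min (norm u) ((norm u)\<^sup>2)"
  using cmod_iexp_compensated_le[of "\<xi> \<bullet> u"] Cauchy_Schwarz_ineq2[of \<xi> u]
  by (intro le_min_linear_quadratic[where p = "\<bar>\<xi> \<bullet> u\<bar>"]) auto

lemma slope_bound:
  "cmod (\<i> * complex_of_real (\<xi> \<bullet> u) * (iexp (r * (\<xi> \<bullet> u)) - 1))
     \<le> (2 * norm \<xi> + \<bar>r\<bar> * (norm \<xi>)\<^sup>2) * min (norm u) ((norm u)\<^sup>2)"
proof (rule le_min_linear_quadratic[where p = "\<bar>\<xi> \<bullet> u\<bar>"])
  show "cmod (\<i> * complex_of_real (\<xi> \<bullet> u) * (iexp (r * (\<xi> \<bullet> u)) - 1)) \<le> 2 * \<bar>\<xi> \<bullet> u\<bar>"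
    using mult_left_mono[OF cmod_iexp_minus_one_le(1), of "\<bar>\<xi> \<bullet> u\<bar>" "r * (\<xi> \<bullet> u)"] by (simp add: norm_mult mult.commute)
  show "cmod (\<i> * complex_of_real (\<xi> \<bullet> u) * (iexp (r * (\<xi> \<bullet> u)) - 1)) \<le> \<bar>r\<bar> * \<bar>\<xi> \<bullet> u\<bar>\<^sup>2"
    using mult_left_mono[OF cmod_iexp_minus_one_le(2), of "\<bar>\<xi> \<bullet> u\<bar>" "r * (\<xi> \<bullet> u)"]
    by (simp add: norm_mult abs_mult power2_eq_square mult_ac)
qed (use Cauchy_Schwarz_ineq2[of \<xi> u] in auto)

lemma integrable_bound_first_moment:
  fixes f :: "'a \<Rightarrow> 'b::{banach, second_countable_topology}"
  assumes "f \<in> borel_measurable borel" and "\<And>u. norm (f u) \<le> C * min (norm u) ((norm u)\<^sup>2)"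
  shows "integrable \<nu> f"
proof (rule Bochner_Integration.integrable_bound)
  show "integrable \<nu> (\<lambda>u. C * min (norm u) ((norm u)\<^sup>2))" using first_moment by simp
  show "AE u in \<nu>. norm (f u) \<le> norm (C * min (norm u) ((norm u)\<^sup>2))"
    using assms(2) by (intro AE_I2) (metis abs_ge_self order_trans real_norm_def)
qed (use assms(1) in measurable)

lemma compensated_integrable:
  "integrable \<nu> (\<lambda>u. iexp (\<xi> \<bullet> u) - 1 - \<i> * complex_of_real (\<xi> \<bullet> u))"
  by (rule integrable_bound_first_moment[OF _ compensated_bound]) measurable

lemma slope_integrable:
  "integrable \<nu> (\<lambda>u. \<i> * complex_of_real (\<xi> \<bullet> u) * (iexp (r * (\<xi> \<bullet> u)) - 1))"
  by (rule integrable_bound_first_moment[OF _ slope_bound]) measurable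

lemma compensated_slope_bound:
  assumes "0 \<le> r" "r \<le> 1"
  shows "cmod (compensated_slope \<nu> \<xi> r)
    \<le> (2 * norm \<xi> + (norm \<xi>)\<^sup>2) * (LINT u|\<nu>. min (norm u) ((norm u)\<^sup>2))"
proof -
  have "cmod (compensated_slope \<nu> \<xi> r)
      \<le> (LINT u|\<nu>. cmod (\<i> * complex_of_real (\<xi> \<bullet> u) * (iexp (r * (\<xi> \<bullet> u)) - 1)))"
    unfolding compensated_slope_def by (rule integral_norm_bound)
  also have "\<dots> \<le> (LINT u|\<nu>. (2 * norm \<xi> + (norm \<xi>)\<^sup>2) * min (norm u) ((norm u)\<^sup>2))"
  proof (rule integral_mono)
    fix u :: 'a
    have "(2 * norm \<xi> + \<bar>r\<bar> * (norm \<xi>)\<^sup>2) * min (norm u) ((norm u)\<^sup>2)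
        \<le> (2 * norm \<xi> + 1 * (norm \<xi>)\<^sup>2) * min (norm u) ((norm u)\<^sup>2)"
      using assms by (intro mult_right_mono add_left_mono) auto
    then show "cmod (\<i> * complex_of_real (\<xi> \<bullet> u) * (iexp (r * (\<xi> \<bullet> u)) - 1))
        \<le> (2 * norm \<xi> + (norm \<xi>)\<^sup>2) * min (norm u) ((norm u)\<^sup>2)"
      using slope_bound[of \<xi> u r] by simp
    show "integrable \<nu> (\<lambda>u. cmod (\<i> * complex_of_real (\<xi> \<bullet> u) * (iexp (r * (\<xi> \<bullet> u)) - 1)))"
      by (intro integrable_norm slope_integrable)
  qed (use first_moment in simp)
  finally show ?thesis by simp
qed

lemma compensated_slope_isCont: "isCont (compensated_slope \<nu> \<xi>) r"
  unfolding isCont_def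
proof (subst LIMSEQ_SEQ_conv[symmetric], intro allI impI)
  fix S :: "nat \<Rightarrow> real"
  assume "(\<forall>n. S n \<noteq> r) \<and> S \<longlonglongrightarrow> r"
  then have S: "S \<longlonglongrightarrow> r" by simp
  then obtain B where B: "\<And>n. \<bar>S n\<bar> \<le> B"
    by (metis Bseq_def convergentI convergent_imp_Bseq real_norm_def)
  show "(\<lambda>n. compensated_slope \<nu> \<xi> (S n)) \<longlonglongrightarrow> compensated_slope \<nu> \<xi> r"
    unfolding compensated_slope_def
  proof (rule integral_dominated_convergence)
    show "integrable \<nu> (\<lambda>u. (2 * norm \<xi> + B * (norm \<xi>)\<^sup>2) * min (norm u) ((norm u)\<^sup>2))"
      using first_moment by simp
    show "AE u in \<nu>. cmod (\<i> * complex_of_real (\<xi> \<bullet> u) * (iexp (S n * (\<xi> \<bullet> u)) - 1))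
      \<le> (2 * norm \<xi> + B * (norm \<xi>)\<^sup>2) * min (norm u) ((norm u)\<^sup>2)" for n
      using B[of n] by (intro AE_I2 order_trans[OF slope_bound] mult_right_mono add_left_mono) auto
    show "AE u in \<nu>. (\<lambda>n. \<i> * complex_of_real (\<xi> \<bullet> u) * (iexp (S n * (\<xi> \<bullet> u)) - 1))
        \<longlonglongrightarrow> \<i> * complex_of_real (\<xi> \<bullet> u) * (iexp (r * (\<xi> \<bullet> u)) - 1)"
      by (intro AE_I2 tendsto_intros S)
  qed measurable
qed

text \<open>Differentiation under the integral, by dominated convergence of difference quotients
  along an arbitrary null sequence; such a sequence is bounded by some B, which makes the majorant
  independent of n.\<close>

lemma compensated_exponent_derivative:
  "((\<lambda>r. compensated_exponent \<nu> (r *\<^sub>R \<xi>)) has_vector_derivative compensated_slope \<nu> \<xi> r) (at r)"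
proof -
  let ?K = "\<lambda>r u. iexp (r * (\<xi> \<bullet> u)) - 1 - \<i> * complex_of_real (r * (\<xi> \<bullet> u))"
  let ?k = "\<lambda>r u. \<i> * complex_of_real (\<xi> \<bullet> u) * (iexp (r * (\<xi> \<bullet> u)) - 1)"
  have K: "integrable \<nu> (?K r)" for r
    using compensated_integrable[of "r *\<^sub>R \<xi>"] by simp
  have lim: "(\<lambda>s. (compensated_exponent \<nu> ((r + s) *\<^sub>R \<xi>) - compensated_exponent \<nu> (r *\<^sub>R \<xi>)) /\<^sub>R s)
      \<midarrow>0\<rightarrow> compensated_slope \<nu> \<xi> r"
  proof (subst LIMSEQ_SEQ_conv[symmetric], intro allI impI)
    fix S :: "nat \<Rightarrow> real"
    assume asm: "(\<forall>n. S n \<noteq> 0) \<and> S \<longlonglongrightarrow> 0"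
    then have S: "S \<longlonglongrightarrow> 0" and S0: "\<And>n. S n \<noteq> 0" by auto
    from S obtain B where B: "\<And>n. \<bar>S n\<bar> \<le> B"
      by (metis Bseq_def convergentI convergent_imp_Bseq real_norm_def)
    have eq: "(compensated_exponent \<nu> ((r + s) *\<^sub>R \<xi>) - compensated_exponent \<nu> (r *\<^sub>R \<xi>)) /\<^sub>R s
       = (CLINT u|\<nu>. (?K (r + s) u - ?K r u) /\<^sub>R s)" for s
      unfolding compensated_exponent_def inner_scaleR_left
      by (simp only: integral_scaleR_right Bochner_Integration.integral_diff[OF K K])
    let ?C = "2 * norm \<xi> + \<bar>r\<bar> * (norm \<xi>)\<^sup>2 + (2 * norm \<xi> + B * (norm \<xi>)\<^sup>2)"
    have bd: "cmod ((?K (r + s) u - ?K r u) /\<^sub>R s) \<le> ?C * min (norm u) ((norm u)\<^sup>2)"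
      if s: "s \<noteq> 0" "\<bar>s\<bar> \<le> B" for s u
    proof -
      define y where "y = \<xi> \<bullet> u"
      have y: "\<bar>y\<bar> \<le> norm \<xi> * norm u" unfolding y_def by (rule Cauchy_Schwarz_ineq2)
      \<comment> \<open>Each summand is of first order in s and, after division by s, is bounded
        both linearly and quadratically in y. Estimating the exponentials without this splitting
        would lose the quadratic bound needed for small jumps.\<close>
      have "?K (r + s) u - ?K r u = (iexp (r * y) - 1) * (iexp (s * y) - 1)
          + (iexp (s * y) - 1 - \<i> * complex_of_real (s * y))"
        by (simp add: y_def distrib_right distrib_left exp_add algebra_simps)
      then have "cmod (?K (r + s) u - ?K r u) \<le> cmod (iexp (r * y) - 1) * cmod (iexp (s * y) - 1)
          + cmod (iexp (s * y) - 1 - \<i> * complex_of_real (s * y))"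
        by (metis norm_mult norm_triangle_ineq)
      also have "\<dots> \<le> cmod (iexp (r * y) - 1) * \<bar>s * y\<bar> + cmod (iexp (s * y) - 1 - \<i> * complex_of_real (s * y))"
        by (intro add_right_mono mult_left_mono cmod_iexp_minus_one_le) simp
      finally have "cmod (?K (r + s) u - ?K r u) / \<bar>s\<bar>
          \<le> (cmod (iexp (r * y) - 1) * \<bar>s * y\<bar> + cmod (iexp (s * y) - 1 - \<i> * complex_of_real (s * y))) / \<bar>s\<bar>"
        by (rule divide_right_mono) simp
      also have "\<dots> = cmod (iexp (r * y) - 1) * \<bar>y\<bar>
          + cmod (iexp (s * y) - 1 - \<i> * complex_of_real (s * y)) / \<bar>s\<bar>"
        using s by (simp only: add_divide_distrib abs_mult) simp
      also have "cmod (?K (r + s) u - ?K r u) / \<bar>s\<bar> = cmod ((?K (r + s) u - ?K r u) /\<^sub>R s)"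
        by (simp only: norm_scaleR abs_inverse divide_inverse mult.commute)
      finally have 1: "cmod ((?K (r + s) u - ?K r u) /\<^sub>R s) \<le> cmod (iexp (r * y) - 1) * \<bar>y\<bar>
          + cmod (iexp (s * y) - 1 - \<i> * complex_of_real (s * y)) / \<bar>s\<bar>" .
      have 2: "cmod (iexp (r * y) - 1) * \<bar>y\<bar> \<le> (2 * norm \<xi> + \<bar>r\<bar> * (norm \<xi>)\<^sup>2) * min (norm u) ((norm u)\<^sup>2)"
        using slope_bound[of \<xi> u r] by (simp add: y_def norm_mult mult.commute)
      have 3: "cmod (iexp (s * y) - 1 - \<i> * complex_of_real (s * y)) / \<bar>s\<bar>
          \<le> (2 * norm \<xi> + B * (norm \<xi>)\<^sup>2) * min (norm u) ((norm u)\<^sup>2)"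
      proof (rule le_min_linear_quadratic[where p = "\<bar>y\<bar>"])
        show "cmod (iexp (s * y) - 1 - \<i> * complex_of_real (s * y)) / \<bar>s\<bar> \<le> 2 * \<bar>y\<bar>"
          using cmod_iexp_compensated_le(1)[of "s * y"] s by (simp add: field_simps abs_mult)
        have "cmod (iexp (s * y) - 1 - \<i> * complex_of_real (s * y)) / \<bar>s\<bar> \<le> \<bar>s\<bar> * \<bar>y\<bar>\<^sup>2"
        proof -
          have "cmod (iexp (s * y) - 1 - \<i> * complex_of_real (s * y)) \<le> \<bar>s * y\<bar>\<^sup>2"
            by (rule order_trans[OF cmod_iexp_compensated_le(2)]) simp
          then show ?thesis
            using s by (simp add: field_simps abs_mult power2_eq_square)
        qed
        also have "\<dots> \<le> B * \<bar>y\<bar>\<^sup>2" using s by (intro mult_right_mono) auto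
        finally show "cmod (iexp (s * y) - 1 - \<i> * complex_of_real (s * y)) / \<bar>s\<bar> \<le> B * \<bar>y\<bar>\<^sup>2" .
      qed (use y s in auto)
      from 1 2 3 show ?thesis by (simp only: distrib_right)
    qed
    show "(\<lambda>n. (compensated_exponent \<nu> ((r + S n) *\<^sub>R \<xi>) - compensated_exponent \<nu> (r *\<^sub>R \<xi>)) /\<^sub>R S n)
        \<longlonglongrightarrow> compensated_slope \<nu> \<xi> r"
      unfolding eq compensated_slope_def
    proof (rule integral_dominated_convergence)
      show "integrable \<nu> (\<lambda>u. ?C * min (norm u) ((norm u)\<^sup>2))" using first_moment by simp
      show "AE u in \<nu>. cmod ((?K (r + S n) u - ?K r u) /\<^sub>R S n) \<le> ?C * min (norm u) ((norm u)\<^sup>2)" for n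
        using bd[OF S0 B] by (intro AE_I2) simp
      show "AE u in \<nu>. (\<lambda>n. (?K (r + S n) u - ?K r u) /\<^sub>R S n) \<longlonglongrightarrow> ?k r u"
      proof (intro AE_I2)
        fix u
        have "((\<lambda>r. ?K r u) has_vector_derivative ?k r u) (at r)"
          using has_vector_derivative_diff[OF has_vector_derivative_diff[OF
              has_vector_derivative_iexp_times has_vector_derivative_const[of 1]]
              has_vector_derivative_i_times, of "\<xi> \<bullet> u" "\<xi> \<bullet> u" r]
          by (simp add: right_diff_distrib)
        then have "(\<lambda>s. (?K (r + s) u - ?K r u) /\<^sub>R s) \<midarrow>0\<rightarrow> ?k r u"
          by (simp only: has_vector_derivative_iff_LIM)
        then show "(\<lambda>n. (?K (r + S n) u - ?K r u) /\<^sub>R S n) \<longlonglongrightarrow> ?k r u"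
          using asm by (subst (asm) LIMSEQ_SEQ_conv[symmetric]) blast
      qed
    qed measurable
  qed
  then show ?thesis by (simp only: has_vector_derivative_iff_LIM)
qed

end

text \<open>The first moment of the jumps outside the unit ball is finite, so their compensator can
  be added under the integral and its value \<open>v\<close> moved into the drift.\<close>

lemma ID_law_compensated:
  fixes L \<nu> :: "'a::euclidean_space measure"
  assumes ID: "ID_law L b (\<lambda>_. 0) \<nu>"
    and mom: "integrable \<nu> (\<lambda>u. min (norm u) ((norm u)\<^sup>2))"
  obtains m where "\<And>\<xi>. char_fun L \<xi> = exp (\<i> * complex_of_real (m \<bullet> \<xi>) + compensated_exponent \<nu> \<xi>)"
proof
  have lm: "levy_measure \<nu>" using ID by (simp add: ID_law_def)
  interpret levy_first_moment_measure \<nu> using lm mom by unfold_locales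
  have [measurable]: "cball (0::'a) 1 \<in> sets borel" by simp
  have big: "integrable \<nu> (\<lambda>u::'a. indicator (- cball 0 1) u *\<^sub>R u)"
  proof (rule integrable_bound_first_moment[where C = 1])
    fix u :: 'a
    have "norm u \<le> (norm u)\<^sup>2" if "\<not> norm u \<le> 1"
      using that mult_right_mono[of 1 "norm u" "norm u"] by (simp add: power2_eq_square)
    then show "norm (indicator (- cball 0 1) u *\<^sub>R u) \<le> 1 * min (norm u) ((norm u)\<^sup>2)"
      by (auto simp: indicator_def)
  qed measurable
  define v where "v = (LINT u|\<nu>. indicator (- cball 0 1) u *\<^sub>R u)"
  have "levy_exponent b (\<lambda>_. 0) \<nu> \<xi> = \<i> * complex_of_real ((b + v) \<bullet> \<xi>) + compensated_exponent \<nu> \<xi>" for \<xi>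
  proof -
    have i2: "integrable \<nu> (\<lambda>u. \<i> * complex_of_real ((indicator (- cball 0 1) u *\<^sub>R u) \<bullet> \<xi>))"
      by (intro integrable_mult_right integrable_of_real integrable_inner_left big)
    have "(CLINT u|\<nu>. iexp (\<xi> \<bullet> u) - 1 - \<i> * complex_of_real ((\<xi> \<bullet> u) * indicator (cball 0 1) u))
      = (CLINT u|\<nu>. (iexp (\<xi> \<bullet> u) - 1 - \<i> * complex_of_real (\<xi> \<bullet> u))
            + \<i> * complex_of_real ((indicator (- cball 0 1) u *\<^sub>R u) \<bullet> \<xi>))"
      by (intro Bochner_Integration.integral_cong refl) (auto simp: indicator_def inner_commute)
    also have "\<dots> = compensated_exponent \<nu> \<xi> + (CLINT u|\<nu>. \<i> * complex_of_real ((indicator (- cball 0 1) u *\<^sub>R u) \<bullet> \<xi>))"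
      unfolding compensated_exponent_def by (rule Bochner_Integration.integral_add[OF compensated_integrable i2])
    also have "(CLINT u|\<nu>. \<i> * complex_of_real ((indicator (- cball 0 1) u *\<^sub>R u) \<bullet> \<xi>)) = \<i> * complex_of_real (v \<bullet> \<xi>)"
      unfolding v_def
      by (simp only: integral_mult_right_zero integral_complex_of_real integral_inner_left[OF big])
    finally show ?thesis by (simp add: levy_exponent_def inner_add_left algebra_simps)
  qed
  then show "char_fun L \<xi> = exp (\<i> * complex_of_real ((b + v) \<bullet> \<xi>) + compensated_exponent \<nu> \<xi>)" for \<xi>
    using ID by (simp add: ID_law_def)
qed

text \<open>The difference quotients of the characters are dominated by |xi| |x|. The purpose is to
  identify the drift of the compensated exponent with the mean.\<close>

lemma char_fun_derivative_at_0:
  fixes L :: "'a::euclidean_space measure"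
  assumes "prob_space L" "sets L = sets borel" "integrable L (\<lambda>x. x)"
  shows "((\<lambda>r. char_fun L (r *\<^sub>R \<xi>)) has_vector_derivative \<i> * complex_of_real ((LINT x|L. x) \<bullet> \<xi>)) (at 0)"
  unfolding has_vector_derivative_iff_LIM
proof (subst LIMSEQ_SEQ_conv[symmetric], intro allI impI)
  interpret prob_space L by fact
  note [measurable_cong] = assms(2)
  fix S :: "nat \<Rightarrow> real"
  assume S: "(\<forall>n. S n \<noteq> 0) \<and> S \<longlonglongrightarrow> 0"
  have int: "integrable L (\<lambda>x. iexp (r * (\<xi> \<bullet> x)))" for r
    by (rule integrable_const_bound[of _ 1]) auto
  have "(\<lambda>n. CLINT x|L. (iexp (S n * (\<xi> \<bullet> x)) - 1) /\<^sub>R S n)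
      \<longlonglongrightarrow> (CLINT x|L. \<i> * complex_of_real (x \<bullet> \<xi>))"
  proof (rule integral_dominated_convergence[where w = "\<lambda>x. norm \<xi> * norm x"])
    show "AE x in L. (\<lambda>n. (iexp (S n * (\<xi> \<bullet> x)) - 1) /\<^sub>R S n) \<longlonglongrightarrow> \<i> * complex_of_real (x \<bullet> \<xi>)"
    proof (intro AE_I2)
      fix x
      have "((\<lambda>r. iexp (r * (\<xi> \<bullet> x))) has_vector_derivative \<i> * complex_of_real (x \<bullet> \<xi>)) (at 0)"
        using has_vector_derivative_iexp_times[of "\<xi> \<bullet> x" 0] by (simp add: inner_commute)
      then show "(\<lambda>n. (iexp (S n * (\<xi> \<bullet> x)) - 1) /\<^sub>R S n) \<longlonglongrightarrow> \<i> * complex_of_real (x \<bullet> \<xi>)"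
        using S unfolding has_vector_derivative_iff_LIM
        by (subst (asm) LIMSEQ_SEQ_conv[symmetric]) simp
    qed
    show "AE x in L. cmod ((iexp (S n * (\<xi> \<bullet> x)) - 1) /\<^sub>R S n) \<le> norm \<xi> * norm x" for n
    proof (intro AE_I2)
      fix x
      have "cmod (iexp (S n * (\<xi> \<bullet> x)) - 1) / \<bar>S n\<bar> \<le> \<bar>S n * (\<xi> \<bullet> x)\<bar> / \<bar>S n\<bar>"
        by (intro divide_right_mono cmod_iexp_minus_one_le) simp
      also have "\<dots> = \<bar>\<xi> \<bullet> x\<bar>" using S by (simp add: abs_mult)
      also have "\<dots> \<le> norm \<xi> * norm x" by (rule Cauchy_Schwarz_ineq2)
      finally show "cmod ((iexp (S n * (\<xi> \<bullet> x)) - 1) /\<^sub>R S n) \<le> norm \<xi> * norm x"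
        by (simp only: norm_scaleR abs_inverse divide_inverse mult.commute)
    qed
    show "integrable L (\<lambda>x. norm \<xi> * norm x)" using integrable_norm[OF assms(3)] by simp
  qed measurable
  also have "(CLINT x|L. \<i> * complex_of_real (x \<bullet> \<xi>)) = \<i> * complex_of_real ((LINT x|L. x) \<bullet> \<xi>)"
    by (simp only: integral_mult_right_zero integral_complex_of_real integral_inner_left[OF assms(3)])
  also have "(\<lambda>n. CLINT x|L. (iexp (S n * (\<xi> \<bullet> x)) - 1) /\<^sub>R S n)
     = (\<lambda>n. (char_fun L ((0 + S n) *\<^sub>R \<xi>) - char_fun L (0 *\<^sub>R \<xi>)) /\<^sub>R S n)"
  proof
    fix n
    show "(CLINT x|L. (iexp (S n * (\<xi> \<bullet> x)) - 1) /\<^sub>R S n)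
     = (char_fun L ((0 + S n) *\<^sub>R \<xi>) - char_fun L (0 *\<^sub>R \<xi>)) /\<^sub>R S n"
      unfolding integral_scaleR_right
      by (subst Bochner_Integration.integral_diff[OF int])
         (simp_all add: char_fun_def prob_space)
  qed
  finally show "(\<lambda>n. (char_fun L ((0 + S n) *\<^sub>R \<xi>) - char_fun L (0 *\<^sub>R \<xi>)) /\<^sub>R S n)
     \<longlonglongrightarrow> \<i> * complex_of_real ((LINT x|L. x) \<bullet> \<xi>)" .
qed

section \<open>The exponential law on the time axis\<close>

definition exp_law :: "real measure" where
  "exp_law = density lborel (exponential_density 1)"

lemma prob_space_exp_law: "prob_space exp_law"
  unfolding exp_law_def by (rule prob_space_exponential_density) simp

lemma sets_exp_law[measurable_cong, simp]: "sets exp_law = sets borel"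
  by (simp add: exp_law_def)

lemma space_exp_law[simp]: "space exp_law = UNIV"
  by (simp add: exp_law_def)

lemma AE_exp_law: "AE t in exp_law. 0 \<le> t"
  unfolding exp_law_def
  by (subst AE_density) (auto simp: exponential_density_def)

lemma integral_exp_law:
  fixes f :: "real \<Rightarrow> 'b::{banach, second_countable_topology}"
  assumes "f \<in> borel_measurable borel"
  shows "(LINT t|exp_law. f t) = (LINT t:{0..}|lborel. exp (- t) *\<^sub>R f t)"
  unfolding exp_law_def set_lebesgue_integral_def
  using assms by (subst integral_density)
    (auto intro!: Bochner_Integration.integral_cong simp: exponential_density_def indicator_def)

lemma integrable_exp_law_iff:
  fixes f :: "real \<Rightarrow> 'b::{banach, second_countable_topology}"
  assumes "f \<in> borel_measurable borel"
  shows "integrable exp_law f \<longleftrightarrow> set_integrable lborel {0..} (\<lambda>t. exp (- t) *\<^sub>R f t)"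
  unfolding exp_law_def set_integrable_def
  using assms by (subst integrable_density)
    (auto intro!: Bochner_Integration.integrable_cong simp: exponential_density_def indicator_def)

lemma integrable_exp_law_bounded:
  fixes f :: "real \<Rightarrow> 'b::{banach, second_countable_topology}"
  assumes "f \<in> borel_measurable borel" "\<And>t. 0 \<le> t \<Longrightarrow> norm (f t) \<le> B"
  shows "integrable exp_law f"
proof -
  interpret prob_space exp_law by (rule prob_space_exp_law)
  show ?thesis
    by (rule integrable_const_bound[of _ B]) (use assms AE_exp_law in auto)
qed

lemma norm_integral_exp_law_le:
  fixes f :: "real \<Rightarrow> 'b::{banach, second_countable_topology}"
  assumes "f \<in> borel_measurable borel" "\<And>t. 0 \<le> t \<Longrightarrow> norm (f t) \<le> B"
  shows "norm (LINT t|exp_law. f t) \<le> B"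
proof -
  interpret prob_space exp_law by (rule prob_space_exp_law)
  have "norm (LINT t|exp_law. f t) \<le> (LINT t|exp_law. norm (f t))" by (rule integral_norm_bound)
  also have "\<dots> \<le> (LINT t|exp_law. B)"
    using integrable_exp_law_bounded[OF assms] assms(2) AE_exp_law
    by (intro integral_mono_AE) auto
  finally show ?thesis using prob_space by simp
qed

text \<open>For negative t the measure \<open>R t\<close> is unconstrained, whence the recurring
  condition t \<ge> 0.\<close>

locale OU_setting =
  fixes L \<nu> :: "'a::euclidean_space measure" and b :: 'a and R :: "real \<Rightarrow> 'a measure"
  assumes prob_L: "prob_space L" and sets_L[measurable_cong, simp]: "sets L = sets borel"
    and moment_L: "integrable L norm"
    and ID_L: "ID_law L b (\<lambda>_. 0) \<nu>"
    and quotient_R: "\<And>t. 0 \<le> t \<Longrightarrow> quotient_law L (exp (- t)) (R t)"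
begin

sublocale L: prob_space L by (rule prob_L)

sublocale levy_first_moment_measure \<nu>
  using ID_L levy_first_moment[OF prob_L sets_L moment_L ID_L]
  by unfold_locales (simp add: ID_law_def)

lemma R: "prob_space (R t)" "sets (R t) = sets borel"
    "char_fun (R t) \<xi> = char_fun L \<xi> / char_fun L (exp (- t) *\<^sub>R \<xi>)" if "0 \<le> t"
  using quotient_R[OF that] by (auto simp: quotient_law_def)

lemma integrable_id: "integrable L (\<lambda>x. x)"
  using moment_L by (subst integrable_norm_iff[symmetric]) auto

definition mean :: 'a where "mean = (LINT x|L. x)"

text \<open>Since \<open>compensated_slope\<close> vanishes at r = 0, the derivative at 0 along xi
  of the compensated representation is i <m, xi>, while the first moment gives i times the inner
  product of the mean with xi. Uniqueness of derivatives equates the two.\<close>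

lemma char_fun_exponent:
  "char_fun L \<xi> = exp (\<i> * complex_of_real (mean \<bullet> \<xi>) + compensated_exponent \<nu> \<xi>)"
proof -
  obtain m where m: "\<And>\<xi>. char_fun L \<xi> = exp (\<i> * complex_of_real (m \<bullet> \<xi>) + compensated_exponent \<nu> \<xi>)"
    using ID_law_compensated[OF ID_L first_moment] by blast
  have "m \<bullet> \<xi> = mean \<bullet> \<xi>" for \<xi>
  proof -
    have "((\<lambda>r. \<i> * complex_of_real (m \<bullet> (r *\<^sub>R \<xi>)) + compensated_exponent \<nu> (r *\<^sub>R \<xi>))
       has_vector_derivative \<i> * complex_of_real (m \<bullet> \<xi>) + compensated_slope \<nu> \<xi> 0) (at 0)"
      unfolding inner_scaleR_right
      by (auto intro!: derivative_eq_intros compensated_exponent_derivative simp: scaleR_conv_of_real)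
    from field_vector_diff_chain_at[OF this, of exp]
    have "((\<lambda>r. char_fun L (r *\<^sub>R \<xi>)) has_vector_derivative
        (\<i> * complex_of_real (m \<bullet> \<xi>) + compensated_slope \<nu> \<xi> 0) * exp (0 + compensated_exponent \<nu> 0)) (at 0)"
      unfolding o_def m by (auto intro!: DERIV_exp)
    moreover have "compensated_exponent \<nu> 0 = 0" "compensated_slope \<nu> \<xi> 0 = 0"
      by (simp_all add: compensated_exponent_def compensated_slope_def)
    ultimately have "((\<lambda>r. char_fun L (r *\<^sub>R \<xi>)) has_vector_derivative
        \<i> * complex_of_real (m \<bullet> \<xi>)) (at 0)" by simp
    from vector_derivative_unique_at[OF this char_fun_derivative_at_0[OF prob_L sets_L integrable_id]]
    show ?thesis by (simp add: mean_def)
  qed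
  then show ?thesis by (simp add: m)
qed

end

subsection \<open>The Stein identity for characters\<close>

context OU_setting
begin

lemma borel_measurable_char_fun[measurable]: "char_fun L \<in> borel_measurable borel"
  unfolding char_fun_def[abs_def] by (rule L.borel_measurable_lebesgue_integral) measurable

text \<open>\<open>char_flow \<xi> x t\<close> is the value at \<open>x\<close> of the semigroup at time \<open>t\<close> on the character \<open>iexp (\<xi> \<bullet> -)\<close>.\<close>

definition char_flow :: "'a \<Rightarrow> 'a \<Rightarrow> real \<Rightarrow> complex" where
  "char_flow \<xi> x t = iexp (exp (- t) * (\<xi> \<bullet> x)) * (char_fun L \<xi> / char_fun L (exp (- t) *\<^sub>R \<xi>))"

text \<open>The resolvent of the semigroup at parameter 1, applied to a character. Multiplied by - i
  xi it is the gradient of the Stein solution for that character.\<close>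

definition char_resolvent :: "'a \<Rightarrow> 'a \<Rightarrow> complex" where
  "char_resolvent \<xi> x = (CLINT t|exp_law. char_flow \<xi> x t)"

lemma measurable_char_flow[measurable (raw)]:
  assumes [measurable]: "f \<in> borel_measurable M" "g \<in> borel_measurable M" "h \<in> borel_measurable M"
  shows "(\<lambda>z. char_flow (f z) (g z) (h z)) \<in> borel_measurable M"
  unfolding char_flow_def by measurable

lemma char_flow_eq_integral:
  assumes "0 \<le> t"
  shows "(CLINT u|R t. iexp (\<xi> \<bullet> (u + exp (- t) *\<^sub>R x))) = char_flow \<xi> x t"
proof -
  have "(CLINT u|R t. iexp (\<xi> \<bullet> (u + exp (- t) *\<^sub>R x))) = (CLINT u|R t. iexp (exp (- t) * (\<xi> \<bullet> x)) * iexp (\<xi> \<bullet> u))"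
    by (intro Bochner_Integration.integral_cong refl) (simp add: inner_add_right distrib_left exp_add mult_ac)
  also have "\<dots> = iexp (exp (- t) * (\<xi> \<bullet> x)) * char_fun (R t) \<xi>"
    unfolding char_fun_def by (rule integral_mult_right_zero)
  finally show ?thesis by (simp add: R(3)[OF assms] char_flow_def)
qed

text \<open>The quotient of characteristic functions does not show this bound; it holds because the
  quotient is itself the characteristic function of a probability measure.\<close>

lemma norm_char_flow_le:
  assumes "0 \<le> t"
  shows "cmod (char_flow \<xi> x t) \<le> 1"
proof -
  interpret Rt: prob_space "R t" by (rule R(1)[OF assms])
  have "cmod (char_flow \<xi> x t) \<le> (LINT u|R t. cmod (iexp (\<xi> \<bullet> (u + exp (- t) *\<^sub>R x))))"
    unfolding char_flow_eq_integral[OF assms, symmetric] by (rule integral_norm_bound)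
  also have "\<dots> = 1" using Rt.prob_space by simp
  finally show ?thesis .
qed

lemma char_flow_shift:
  "char_flow \<xi> (x + u) t - char_flow \<xi> x t = char_flow \<xi> x t * (iexp (exp (- t) * (\<xi> \<bullet> u)) - 1)"
  by (simp add: char_flow_def inner_add_right distrib_left exp_add right_diff_distrib diff_divide_distrib mult_ac)

lemma char_flow_lipschitz:
  assumes "0 \<le> t"
  shows "cmod (char_flow \<xi> (x + u) t - char_flow \<xi> x t) \<le> \<bar>\<xi> \<bullet> u\<bar>"
proof -
  have "cmod (char_flow \<xi> (x + u) t - char_flow \<xi> x t) \<le> 1 * \<bar>exp (- t) * (\<xi> \<bullet> u)\<bar>"
    unfolding char_flow_shift norm_mult
    by (intro mult_mono norm_char_flow_le assms cmod_iexp_minus_one_le) auto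
  also have "\<dots> \<le> \<bar>\<xi> \<bullet> u\<bar>"
    using assms by (simp add: abs_mult mult_left_le_one_le)
  finally show ?thesis .
qed

lemma norm_char_resolvent_le: "cmod (char_resolvent \<xi> x) \<le> 1"
  unfolding char_resolvent_def using norm_char_flow_le by (intro norm_integral_exp_law_le) measurable

lemma integrable_char_flow: "integrable exp_law (char_flow \<xi> x)"
  using norm_char_flow_le by (intro integrable_exp_law_bounded) measurable

lemma char_resolvent_lipschitz: "cmod (char_resolvent \<xi> (x + u) - char_resolvent \<xi> x) \<le> \<bar>\<xi> \<bullet> u\<bar>"
  unfolding char_resolvent_def
  by (subst Bochner_Integration.integral_diff[symmetric, OF integrable_char_flow integrable_char_flow])
     (use char_flow_lipschitz in \<open>intro norm_integral_exp_law_le; measurable\<close>)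

lemma measurable_char_resolvent[measurable (raw)]:
  assumes [measurable]: "f \<in> borel_measurable M" "g \<in> borel_measurable M"
  shows "(\<lambda>z. char_resolvent (f z) (g z)) \<in> borel_measurable M"
proof -
  interpret prob_space exp_law by (rule prob_space_exp_law)
  show ?thesis
    unfolding char_resolvent_def by (rule borel_measurable_lebesgue_integral) measurable
qed

text \<open>With the quotient absorbed into one exponential, time enters only through r = exp (-t)
  in a function differentiable in r.\<close>

lemma char_flow_eq_exp:
  "char_flow \<xi> x t = exp (\<i> * complex_of_real (exp (- t) * (\<xi> \<bullet> x))
     + (\<i> * complex_of_real (mean \<bullet> \<xi>) + compensated_exponent \<nu> \<xi>)
     - (\<i> * complex_of_real (exp (- t) * (mean \<bullet> \<xi>)) + compensated_exponent \<nu> (exp (- t) *\<^sub>R \<xi>)))"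
  unfolding char_flow_def char_fun_exponent inner_scaleR_right by (simp add: exp_add exp_diff)

text \<open>Chain rule in r = exp (-t). The inner derivative - exp (-t) reverses the sign of x -
  mean and of the slope; exp (-t) is kept in front because it is the density of
  \<open>exp_law\<close>.\<close>

lemma char_flow_derivative:
  "(char_flow \<xi> x has_vector_derivative
      exp (- t) *\<^sub>R (char_flow \<xi> x t * (\<i> * complex_of_real ((mean - x) \<bullet> \<xi>) + compensated_slope \<nu> \<xi> (exp (- t))))) (at t)"
proof -
  let ?A = "\<lambda>r. \<i> * complex_of_real (r * (\<xi> \<bullet> x))
     + (\<i> * complex_of_real (mean \<bullet> \<xi>) + compensated_exponent \<nu> \<xi>)
     - (\<i> * complex_of_real (r * (mean \<bullet> \<xi>)) + compensated_exponent \<nu> (r *\<^sub>R \<xi>))"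
  have A: "(?A has_vector_derivative (\<i> * complex_of_real (\<xi> \<bullet> x) + 0 -
      (\<i> * complex_of_real (mean \<bullet> \<xi>) + compensated_slope \<nu> \<xi> r))) (at r)" for r
    by (intro has_vector_derivative_diff has_vector_derivative_add has_vector_derivative_const
        has_vector_derivative_i_times compensated_exponent_derivative)
  have e: "((\<lambda>t. exp (- t)) has_vector_derivative - exp (- t)) (at t)" for t :: real
    unfolding has_real_derivative_iff_has_vector_derivative[symmetric]
    by (auto intro!: derivative_eq_intros)
  from field_vector_diff_chain_at[OF vector_diff_chain_at[OF e A] DERIV_exp]
  show ?thesis
    unfolding char_flow_eq_exp[abs_def] o_def
    by (simp add: inner_diff_left inner_commute scaleR_conv_of_real algebra_simps)
qed

lemma borel_measurable_compensated_slope[measurable]: "compensated_slope \<nu> \<xi> \<in> borel_measurable borel"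
  using compensated_slope_isCont
  by (intro borel_measurable_continuous_onI continuous_at_imp_continuous_on) auto

text \<open>The fundamental theorem of calculus on the half-line: the integrand is the time
  derivative of \<open>char_flow\<close>, which runs from the character at t = 0 to
  \<open>char_fun L \<xi>\<close> at infinity. Integrability comes from the bound on
  \<open>compensated_slope\<close> for r in [0, 1].\<close>

lemma
  shows integrable_char_flow_generator: "integrable exp_law (\<lambda>t. char_flow \<xi> x t *
      (\<i> * complex_of_real ((mean - x) \<bullet> \<xi>) + compensated_slope \<nu> \<xi> (exp (- t))))" (is "integrable _ ?G")
    and integral_char_flow_generator: "(CLINT t|exp_law. char_flow \<xi> x t *
      (\<i> * complex_of_real ((mean - x) \<bullet> \<xi>) + compensated_slope \<nu> \<xi> (exp (- t))))
      = char_fun L \<xi> - iexp (\<xi> \<bullet> x)"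
proof -
  let ?B = "cmod (\<i> * complex_of_real ((mean - x) \<bullet> \<xi>)) + (2 * norm \<xi> + (norm \<xi>)\<^sup>2) * (LINT u|\<nu>. min (norm u) ((norm u)\<^sup>2))"
  have G[measurable]: "?G \<in> borel_measurable borel" by measurable
  show int: "integrable exp_law ?G"
  proof (rule integrable_exp_law_bounded[OF G])
    fix t :: real assume t: "0 \<le> t"
    have "cmod (?G t) \<le> 1 * ?B"
      unfolding norm_mult[of "char_flow \<xi> x t"]
      by (intro mult_mono norm_char_flow_le t order_trans[OF norm_triangle_ineq] add_mono order_refl
          compensated_slope_bound) (use t in auto)
    then show "cmod (?G t) \<le> ?B" by simp
  qed
  have cont: "isCont (char_flow \<xi> x) t" for t
    using char_flow_derivative[of \<xi> x t] by (rule has_vector_derivative_continuous)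
  have slope: "isCont (\<lambda>t. compensated_slope \<nu> \<xi> (exp (- t))) t" for t
    by (rule isCont_o2[OF _ compensated_slope_isCont]) (intro continuous_intros)
  have "(LBINT t=ereal 0..\<infinity>. exp (- t) *\<^sub>R ?G t) = char_fun L \<xi> - iexp (\<xi> \<bullet> x)"
  proof (rule interval_integral_FTC_integrable)
    show "(char_flow \<xi> x has_vector_derivative exp (- t) *\<^sub>R ?G t) (at t)" for t
      by (rule char_flow_derivative)
    show "isCont (\<lambda>t. exp (- t) *\<^sub>R ?G t) t" for t
      by (intro continuous_intros cont slope)
    have "set_integrable lborel {0..} (\<lambda>t. exp (- t) *\<^sub>R ?G t)"
      using int integrable_exp_law_iff[OF G] by blast
    then show "set_integrable lborel (einterval (ereal 0) \<infinity>) (\<lambda>t. exp (- t) *\<^sub>R ?G t)"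
      by (rule set_integrable_subset) (auto simp: einterval_def)
    show "((char_flow \<xi> x \<circ> real_of_ereal) \<longlongrightarrow> iexp (\<xi> \<bullet> x)) (at_right (ereal 0))"
    proof -
      have "char_flow \<xi> x 0 = iexp (\<xi> \<bullet> x)"
        by (simp add: char_flow_eq_exp)
      then have "(char_flow \<xi> x \<longlongrightarrow> iexp (\<xi> \<bullet> x)) (at 0)"
        using cont[of 0] by (simp add: isCont_def)
      then show ?thesis
        unfolding ereal_tendsto_simps by (rule tendsto_within_subset) simp
    qed
    \<comment> \<open>As t grows, exp (-t) xi tends to 0, where the compensated exponent is
      continuous along the ray with value 0.\<close>
    show "((char_flow \<xi> x \<circ> real_of_ereal) \<longlongrightarrow> char_fun L \<xi>) (at_left \<infinity>)"
    proof -
      have e: "((\<lambda>t::real. exp (- t)) \<longlongrightarrow> 0) at_top"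
        by (rule filterlim_compose[OF exp_at_bot filterlim_uminus_at_bot_at_top])
      have "isCont (\<lambda>r. compensated_exponent \<nu> (r *\<^sub>R \<xi>)) 0"
        using compensated_exponent_derivative by (rule has_vector_derivative_continuous)
      from isCont_tendsto_compose[OF this e]
      have "((\<lambda>t. compensated_exponent \<nu> (exp (- t) *\<^sub>R \<xi>)) \<longlongrightarrow> 0) at_top"
        by (simp add: compensated_exponent_def)
      then have "(char_flow \<xi> x \<longlongrightarrow> exp (\<i> * complex_of_real (0 * (\<xi> \<bullet> x))
         + (\<i> * complex_of_real (mean \<bullet> \<xi>) + compensated_exponent \<nu> \<xi>)
         - (\<i> * complex_of_real (0 * (mean \<bullet> \<xi>)) + 0))) at_top"
        unfolding char_flow_eq_exp[abs_def] by (intro tendsto_intros e)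
      then show ?thesis
        unfolding ereal_tendsto_simps by (simp add: char_fun_exponent)
    qed
  qed simp
  also have "(LBINT t=ereal 0..\<infinity>. exp (- t) *\<^sub>R ?G t) = (LINT t:{0<..}|lborel. exp (- t) *\<^sub>R ?G t)"
    by (rule interval_integral_to_infinity_eq)
  also have "\<dots> = (LINT t:{0..}|lborel. exp (- t) *\<^sub>R ?G t)"
    unfolding set_lebesgue_integral_def
    by (rule integral_cong_AE)
       (use AE_lborel_singleton[of 0] in \<open>auto simp: indicator_def elim!: eventually_mono\<close>)
  also have "\<dots> = (CLINT t|exp_law. ?G t)"
    by (rule integral_exp_law[symmetric, OF G])
  finally show "(CLINT t|exp_law. ?G t) = char_fun L \<xi> - iexp (\<xi> \<bullet> x)" .
qed

lemma nonlocal_bound: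
  "cmod (\<i> * complex_of_real (\<xi> \<bullet> u) * (char_resolvent \<xi> (x + u) - char_resolvent \<xi> x))
     \<le> (2 * norm \<xi> + (norm \<xi>)\<^sup>2) * min (norm u) ((norm u)\<^sup>2)"
proof (rule le_min_linear_quadratic[where p = "\<bar>\<xi> \<bullet> u\<bar>" and a = 1, simplified])
  let ?D = "char_resolvent \<xi> (x + u) - char_resolvent \<xi> x"
  have "cmod ?D \<le> 2"
    using norm_triangle_ineq4[of "char_resolvent \<xi> (x + u)" "char_resolvent \<xi> x"]
      norm_char_resolvent_le[of \<xi> "x + u"] norm_char_resolvent_le[of \<xi> x] by linarith
  from mult_left_mono[OF this, of "\<bar>\<xi> \<bullet> u\<bar>"]
  show "cmod (\<i> * complex_of_real (\<xi> \<bullet> u) * ?D) \<le> 2 * \<bar>\<xi> \<bullet> u\<bar>" by (simp add: norm_mult)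
  show "cmod (\<i> * complex_of_real (\<xi> \<bullet> u) * ?D) \<le> (\<xi> \<bullet> u)\<^sup>2"
    using mult_left_mono[OF char_resolvent_lipschitz, of "\<bar>\<xi> \<bullet> u\<bar>" \<xi> x u]
    by (simp add: norm_mult power2_eq_square abs_mult_self_eq)
qed (use Cauchy_Schwarz_ineq2[of \<xi> u] in auto)

text \<open>A shift of x multiplies \<open>char_flow\<close> by a factor free of x, so exchanging
  the integrals over jumps and time turns the nonlocal term into the time integral of
  \<open>char_flow\<close> times \<open>compensated_slope\<close>. Together with the drift term this
  is the integrated time derivative.\<close>

lemma stein_identity_char:
  "\<i> * complex_of_real ((mean - x) \<bullet> \<xi>) * char_resolvent \<xi> x
     + (CLINT u|\<nu>. \<i> * complex_of_real (\<xi> \<bullet> u) * (char_resolvent \<xi> (x + u) - char_resolvent \<xi> x))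
   = char_fun L \<xi> - iexp (\<xi> \<bullet> x)"
proof -
  interpret T: prob_space exp_law by (rule prob_space_exp_law)
  let ?k = "\<lambda>t u. \<i> * complex_of_real (\<xi> \<bullet> u) * (iexp (exp (- t) * (\<xi> \<bullet> u)) - 1)"
  have "(CLINT u|\<nu>. \<i> * complex_of_real (\<xi> \<bullet> u) * (char_resolvent \<xi> (x + u) - char_resolvent \<xi> x))
      = (CLINT u|\<nu>. CLINT t|exp_law. char_flow \<xi> x t * ?k t u)"
  proof (intro Bochner_Integration.integral_cong refl)
    fix u
    show "\<i> * complex_of_real (\<xi> \<bullet> u) * (char_resolvent \<xi> (x + u) - char_resolvent \<xi> x)
        = (CLINT t|exp_law. char_flow \<xi> x t * ?k t u)"
      unfolding char_resolvent_def
        Bochner_Integration.integral_diff[symmetric, OF integrable_char_flow integrable_char_flow]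
        integral_mult_right_zero[symmetric] char_flow_shift
      by (intro Bochner_Integration.integral_cong refl) (simp add: mult_ac)
  qed
  also have "\<dots> = (CLINT t|exp_law. CLINT u|\<nu>. char_flow \<xi> x t * ?k t u)"
  proof (rule integral_swap_bound[where b = "\<lambda>_. 1"
        and a = "\<lambda>u. (2 * norm \<xi> + (norm \<xi>)\<^sup>2) * min (norm u) ((norm u)\<^sup>2)"])
    show "sigma_finite_measure \<nu>" "sigma_finite_measure exp_law" by unfold_locales
    show "integrable \<nu> (\<lambda>u. (2 * norm \<xi> + (norm \<xi>)\<^sup>2) * min (norm u) ((norm u)\<^sup>2))"
      using first_moment by simp
    show "AE t in exp_law. \<forall>u\<in>space \<nu>. cmod (char_flow \<xi> x t * ?k t u)
        \<le> (2 * norm \<xi> + (norm \<xi>)\<^sup>2) * min (norm u) ((norm u)\<^sup>2) * 1"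
      using AE_exp_law
    proof (rule eventually_mono, intro ballI)
      fix t :: real and u assume t: "0 \<le> t"
      have "cmod (char_flow \<xi> x t * ?k t u) \<le> 1 * ((2 * norm \<xi> + \<bar>exp (- t)\<bar> * (norm \<xi>)\<^sup>2) * min (norm u) ((norm u)\<^sup>2))"
        unfolding norm_mult[of "char_flow \<xi> x t"]
        by (intro mult_mono norm_char_flow_le t slope_bound) auto
      also have "\<dots> \<le> 1 * ((2 * norm \<xi> + 1 * (norm \<xi>)\<^sup>2) * min (norm u) ((norm u)\<^sup>2))"
        using t by (intro mult_left_mono mult_right_mono add_left_mono) auto
      finally show "cmod (char_flow \<xi> x t * ?k t u)
        \<le> (2 * norm \<xi> + (norm \<xi>)\<^sup>2) * min (norm u) ((norm u)\<^sup>2) * 1" by simp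
    qed
    show "integrable exp_law (\<lambda>_. 1::real)" by simp
  qed measurable
  also have "\<dots> = (CLINT t|exp_law. char_flow \<xi> x t * compensated_slope \<nu> \<xi> (exp (- t)))"
    unfolding compensated_slope_def integral_mult_right_zero ..
  also have "\<i> * complex_of_real ((mean - x) \<bullet> \<xi>) * char_resolvent \<xi> x + \<dots>
      = (CLINT t|exp_law. char_flow \<xi> x t *
          (\<i> * complex_of_real ((mean - x) \<bullet> \<xi>) + compensated_slope \<nu> \<xi> (exp (- t))))"
  proof -
    have 1: "integrable exp_law (\<lambda>t. \<i> * complex_of_real ((mean - x) \<bullet> \<xi>) * char_flow \<xi> x t)"
      by (intro integrable_mult_right integrable_char_flow)
    have 2: "integrable exp_law (\<lambda>t. char_flow \<xi> x t * compensated_slope \<nu> \<xi> (exp (- t)))"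
      using Bochner_Integration.integrable_diff[OF integrable_char_flow_generator[of \<xi> x] 1]
      by (simp add: distrib_left mult_ac)
    show ?thesis
      unfolding char_resolvent_def integral_mult_right_zero[symmetric]
        Bochner_Integration.integral_add[OF 1 2, symmetric]
      by (intro Bochner_Integration.integral_cong refl) (simp add: distrib_left mult_ac)
  qed
  finally show ?thesis by (simp add: integral_char_flow_generator)
qed

end

subsection \<open>Superpositions of characters\<close>

text \<open>The gradient G is carried as data and tied to g only through the Taylor remainder. All
  five bounds survive averaging over translates with the same constant, so no derivative is ever
  taken under a convolution or flow integral.\<close>

definition C11_pair :: "('a::euclidean_space \<Rightarrow> real) \<Rightarrow> ('a \<Rightarrow> 'a) \<Rightarrow> real \<Rightarrow> bool" where
  "C11_pair g G C \<longleftrightarrow> (\<forall>x. \<bar>g x\<bar> \<le> C) \<and> (\<forall>x. norm (G x) \<le> C) \<and>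
     (\<forall>x y. \<bar>g x - g y\<bar> \<le> C * norm (x - y)) \<and> (\<forall>x y. norm (G x - G y) \<le> C * norm (x - y)) \<and>
     (\<forall>x v. \<bar>g (x + v) - g x - G x \<bullet> v\<bar> \<le> C * (norm v)\<^sup>2)"

lemma C11_pairD:
  assumes "C11_pair g G C"
  shows "\<bar>g x\<bar> \<le> C" "norm (G x) \<le> C" "\<bar>g x - g y\<bar> \<le> C * norm (x - y)"
    "norm (G x - G y) \<le> C * norm (x - y)" "\<bar>g (x + v) - g x - G x \<bullet> v\<bar> \<le> C * (norm v)\<^sup>2"
    "0 \<le> C"
  using assms abs_ge_zero[of "g x"] by (auto simp: C11_pair_def intro: order_trans)

lemma continuous_on_lipschitz_bound:
  fixes f :: "'a::real_normed_vector \<Rightarrow> 'b::real_normed_vector"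
  assumes "\<And>x y. norm (f x - f y) \<le> C * norm (x - y)"
  shows "continuous_on UNIV f"
proof -
  have "\<bar>C\<bar>-lipschitz_on UNIV f"
    using assms by (intro lipschitz_onI) (auto simp: dist_norm intro: order_trans[OF _ mult_right_mono[OF abs_ge_self]])
  then show ?thesis by (rule lipschitz_on_continuous_on)
qed

lemma C11_pair_continuous:
  assumes "C11_pair g G C"
  shows "continuous_on UNIV g" "continuous_on UNIV G"
  using C11_pairD(3,4)[OF assms]
  by (auto intro!: continuous_on_lipschitz_bound[of g C] continuous_on_lipschitz_bound[of G C])

lemma C11_pair_measurable:
  assumes "C11_pair g G C"
  shows "g \<in> borel_measurable borel" "G \<in> borel_measurable borel"
  using C11_pair_continuous[OF assms] by (auto intro: borel_measurable_continuous_onI)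

lemma C11_pair_gauss_conv:
  assumes "C11_pair g G C"
  shows "C11_pair (gauss_conv e g) (gauss_conv e G) C"
  unfolding C11_pair_def
proof (intro conjI allI)
  note m = C11_pair_measurable[OF assms] and D = C11_pairD[OF assms]
  show "\<bar>gauss_conv e g x\<bar> \<le> C" for x using norm_gauss_conv_le[OF m(1)] D(1) by simp
  show "norm (gauss_conv e G x) \<le> C" for x using norm_gauss_conv_le[OF m(2)] D(2) by simp
  show "\<bar>gauss_conv e g x - gauss_conv e g y\<bar> \<le> C * norm (x - y)" for x y
    using gauss_conv_lipschitz[OF m(1), of C C] D(1,3) by simp
  show "norm (gauss_conv e G x - gauss_conv e G y) \<le> C * norm (x - y)" for x y
    using gauss_conv_lipschitz[OF m(2), of C C] D(2,4) by simp
  show "\<bar>gauss_conv e g (x + v) - gauss_conv e g x - gauss_conv e G x \<bullet> v\<bar> \<le> C * (norm v)\<^sup>2" for x v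
    using gauss_conv_quadratic[OF m(1) _ m(2), of C C C] D(1,2,5) by simp
qed

section \<open>The semigroup on bounded Lipschitz functions\<close>

context OU_setting
begin

text \<open>\<open>P_semigroup\<close> for vector-valued functions, so that it also acts on
  gradients. The value 0 at negative times keeps the bounds and the measurability in t valid on the
  whole line, where \<open>R t\<close> is uncontrolled.\<close>

definition flow :: "('a \<Rightarrow> 'b::{banach, second_countable_topology}) \<Rightarrow> real \<Rightarrow> 'a \<Rightarrow> 'b" where
  "flow g t x = (if 0 \<le> t then LINT u|R t. g (u + exp (- t) *\<^sub>R x) else 0)"

definition flow_integral :: "('a \<Rightarrow> 'b::{banach, second_countable_topology}) \<Rightarrow> 'a \<Rightarrow> 'b" where
  "flow_integral G x = (LINT t|exp_law. flow G t x)"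

lemma integrable_R_bounded:
  fixes g :: "'a \<Rightarrow> 'b::{banach, second_countable_topology}"
  assumes "0 \<le> t" and [measurable]: "g \<in> borel_measurable borel" and "\<And>x. norm (g x) \<le> C"
  shows "integrable (R t) (\<lambda>u. g (u + y))"
proof -
  interpret Rt: prob_space "R t" by (rule R(1)[OF assms(1)])
  note [measurable_cong] = R(2)[OF assms(1)]
  show ?thesis by (rule Rt.integrable_const_bound[of _ C]) (use assms in auto)
qed

lemma norm_flow_le:
  fixes g :: "'a \<Rightarrow> 'b::{banach, second_countable_topology}"
  assumes [measurable]: "g \<in> borel_measurable borel" and C: "\<And>x. norm (g x) \<le> C"
  shows "norm (flow g t x) \<le> C"
proof (cases "0 \<le> t")
  case True
  interpret Rt: prob_space "R t" by (rule R(1)[OF True])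
  note [measurable_cong] = R(2)[OF True]
  have "norm (flow g t x) \<le> (LINT u|R t. norm (g (u + exp (- t) *\<^sub>R x)))"
    using True by (simp add: flow_def integral_norm_bound)
  also have "\<dots> \<le> (LINT u|R t. C)"
    by (intro integral_mono integrable_norm integrable_R_bounded[OF True assms] C) simp
  finally show ?thesis using Rt.prob_space by simp
next
  case False
  then show ?thesis using order_trans[OF norm_ge_zero C] by (simp add: flow_def)
qed

lemma flow_diff:
  fixes g :: "'a \<Rightarrow> 'b::{banach, second_countable_topology}"
  assumes g: "g \<in> borel_measurable borel" "\<And>x. norm (g x) \<le> C" and t: "0 \<le> t"
  shows "flow g t x - flow g t y = (LINT u|R t. g (u + exp (- t) *\<^sub>R x) - g (u + exp (- t) *\<^sub>R y))"
  using t by (simp add: flow_def integrable_R_bounded[OF t g])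

text \<open>The starting point enters as exp (-t) x, so the Lipschitz constant contracts by that
  factor; this is the source of all decay in time.\<close>

lemma flow_lipschitz:
  fixes g :: "'a \<Rightarrow> 'b::{banach, second_countable_topology}"
  assumes g[measurable]: "g \<in> borel_measurable borel" and C: "\<And>x. norm (g x) \<le> C"
    and lip: "\<And>x y. norm (g x - g y) \<le> C * norm (x - y)" and t: "0 \<le> t"
  shows "norm (flow g t x - flow g t y) \<le> C * exp (- t) * norm (x - y)"
proof -
  interpret Rt: prob_space "R t" by (rule R(1)[OF t])
  have "norm (flow g t x - flow g t y)
      \<le> (LINT u|R t. norm (g (u + exp (- t) *\<^sub>R x) - g (u + exp (- t) *\<^sub>R y)))"
    unfolding flow_diff[OF g C t] by (rule integral_norm_bound)
  also have "\<dots> \<le> (LINT u|R t. C * exp (- t) * norm (x - y))"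
  proof (rule integral_mono)
    show "integrable (R t) (\<lambda>u. norm (g (u + exp (- t) *\<^sub>R x) - g (u + exp (- t) *\<^sub>R y)))"
      by (intro integrable_norm Bochner_Integration.integrable_diff integrable_R_bounded[OF t g C])
    fix u
    show "norm (g (u + exp (- t) *\<^sub>R x) - g (u + exp (- t) *\<^sub>R y)) \<le> C * exp (- t) * norm (x - y)"
      using lip[of "u + exp (- t) *\<^sub>R x" "u + exp (- t) *\<^sub>R y"]
      by (simp add: scaleR_diff_right[symmetric] mult.assoc)
  qed simp
  finally show ?thesis using Rt.prob_space by simp
qed

text \<open>The increment reaches g as exp (-t) v, so the gradient of the flow of g is exp (-t)
  times the flow of G.\<close>

lemma flow_quadratic:
  assumes p: "C11_pair g G C" and t: "0 \<le> t"
  shows "\<bar>flow g t (x + v) - flow g t x - exp (- t) * (flow G t x \<bullet> v)\<bar> \<le> C * exp (- t) * (norm v)\<^sup>2"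
proof -
  interpret Rt: prob_space "R t" by (rule R(1)[OF t])
  note D = C11_pairD[OF p] and m = C11_pair_measurable[OF p]
  let ?e = "exp (- t)"
  have iG: "integrable (R t) (\<lambda>u. G (u + ?e *\<^sub>R x))"
    by (rule integrable_R_bounded[OF t m(2) D(2)])
  have ig: "integrable (R t) (\<lambda>u. g (u + y))" for y
    by (rule integrable_R_bounded[OF t m(1), of C]) (use D(1) in simp)
  have i1: "integrable (R t) (\<lambda>u. g (u + ?e *\<^sub>R (x + v)) - g (u + ?e *\<^sub>R x))"
    by (intro Bochner_Integration.integrable_diff ig)
  have i2: "integrable (R t) (\<lambda>u. ?e * (G (u + ?e *\<^sub>R x) \<bullet> v))"
    using iG by (intro integrable_mult_right integrable_inner_left) auto
  define I where "I u = g (u + ?e *\<^sub>R (x + v)) - g (u + ?e *\<^sub>R x) - ?e * (G (u + ?e *\<^sub>R x) \<bullet> v)" for u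
  have int: "integrable (R t) I"
    unfolding I_def[abs_def] by (intro Bochner_Integration.integrable_diff[OF i1 i2])
  have eq: "flow g t (x + v) - flow g t x - ?e * (flow G t x \<bullet> v) = (LINT u|R t. I u)"
    unfolding I_def
    using t by (simp only: flow_def Bochner_Integration.integral_diff[OF i1 i2]
        Bochner_Integration.integral_diff[OF ig ig] integral_mult_right_zero integral_inner_left[OF iG] if_True)
  have le: "\<bar>I u\<bar> \<le> C * ?e * (norm v)\<^sup>2" for u
  proof -
    \<comment> \<open>The remainder is of order exp (-2t); one of the two factors is given up, since
      the other already cancels the weight exp t of the Stein integral.\<close>
    have sq: "(norm (?e *\<^sub>R v))\<^sup>2 \<le> ?e * (norm v)\<^sup>2"
    proof -
      have "?e * ?e \<le> ?e * 1" using t by (intro mult_left_mono) auto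
      from mult_right_mono[OF this, of "(norm v)\<^sup>2"] show ?thesis
        by (simp add: power_mult_distrib power2_eq_square mult_ac)
    qed
    have "\<bar>I u\<bar> \<le> C * (norm (?e *\<^sub>R v))\<^sup>2"
      using D(5)[of "u + ?e *\<^sub>R x" "?e *\<^sub>R v"] by (simp add: I_def scaleR_add_right add.assoc)
    also have "\<dots> \<le> C * (?e * (norm v)\<^sup>2)"
      using sq D(6) by (rule mult_left_mono)
    finally show ?thesis by (simp add: mult.assoc)
  qed
  have "\<bar>LINT u|R t. I u\<bar> \<le> (LINT u|R t. \<bar>I u\<bar>)"
    by (rule integral_abs_bound)
  also have "\<dots> \<le> (LINT u|R t. C * ?e * (norm v)\<^sup>2)"
    using int le by (intro integral_mono) auto
  finally show ?thesis using Rt.prob_space by (simp add: eq)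
qed

lemma flow_integrable:
  fixes G :: "'a \<Rightarrow> 'b::{banach, second_countable_topology}"
  assumes "G \<in> borel_measurable borel" "\<And>x. norm (G x) \<le> C"
    and "(\<lambda>t. flow G t x) \<in> borel_measurable borel"
  shows "integrable exp_law (\<lambda>t. flow G t x)"
  using assms(3) norm_flow_le[OF assms(1,2)] by (rule integrable_exp_law_bounded)

lemma flow_integral_lipschitz:
  fixes G :: "'a \<Rightarrow> 'b::{banach, second_countable_topology}"
  assumes G: "G \<in> borel_measurable borel" "\<And>x. norm (G x) \<le> C"
    and lip: "\<And>x y. norm (G x - G y) \<le> C * norm (x - y)"
    and m[measurable]: "\<And>x. (\<lambda>t. flow G t x) \<in> borel_measurable borel"
  shows "norm (flow_integral G x) \<le> C"
    "norm (flow_integral G x - flow_integral G y) \<le> C * norm (x - y)"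
proof -
  show "norm (flow_integral G x) \<le> C"
    unfolding flow_integral_def using norm_flow_le[OF G] by (intro norm_integral_exp_law_le m)
  have C0: "0 \<le> C" using order_trans[OF norm_ge_zero G(2)] .
  show "norm (flow_integral G x - flow_integral G y) \<le> C * norm (x - y)"
    unfolding flow_integral_def
      Bochner_Integration.integral_diff[symmetric, OF flow_integrable[OF G m] flow_integrable[OF G m]]
  proof (rule norm_integral_exp_law_le)
    fix t :: real assume t: "0 \<le> t"
    have "C * exp (- t) * norm (x - y) \<le> C * 1 * norm (x - y)"
      using t C0 by (intro mult_right_mono mult_left_mono) auto
    then show "norm (flow G t x - flow G t y) \<le> C * norm (x - y)"
      using flow_lipschitz[OF G lip t, of x y] by simp
  qed measurable
qed

text \<open>The sup bound on G gives the linear estimate and the Lipschitz bound the quadratic one,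
  so the jump integral is dominated uniformly in x.\<close>

lemma generator_bound:
  fixes G :: "'a \<Rightarrow> 'a"
  assumes "\<And>x. norm (G x) \<le> C" "\<And>x y. norm (G x - G y) \<le> C * norm (x - y)"
  shows "\<bar>(G (x + u) - G x) \<bullet> u\<bar> \<le> 2 * C * min (norm u) ((norm u)\<^sup>2)"
proof -
  have C0: "0 \<le> C" using order_trans[OF norm_ge_zero assms(1)] .
  have 1: "\<bar>(G (x + u) - G x) \<bullet> u\<bar> \<le> norm (G (x + u) - G x) * norm u" by (rule Cauchy_Schwarz_ineq2)
  have "norm (G (x + u) - G x) \<le> 2 * C"
    using norm_triangle_ineq4[of "G (x + u)" "G x"] assms(1)[of "x + u"] assms(1)[of x] by linarith
  then have "norm (G (x + u) - G x) * norm u \<le> 2 * C * norm u" by (intro mult_right_mono) auto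
  moreover have "norm (G (x + u) - G x) * norm u \<le> 2 * C * (norm u)\<^sup>2"
  proof -
    have "norm (G (x + u) - G x) * norm u \<le> C * norm u * norm u"
      using assms(2)[of "x + u" x] by (intro mult_right_mono) auto
    also have "\<dots> \<le> 2 * C * (norm u)\<^sup>2" using C0 by (simp add: power2_eq_square)
    finally show ?thesis .
  qed
  ultimately show ?thesis using 1 C0 by (auto simp: min_def)
qed

end

section \<open>The Stein identity for superpositions of characters\<close>

text \<open>The representation is required for g alone; that of its gradient is derived. The second
  moment of Q pays for the growth |xi| + |xi|^2 of the jump integrand of a character.\<close>

locale superposition = OU_setting +
  fixes g :: "'a \<Rightarrow> real" and G :: "'a \<Rightarrow> 'a" and C :: real
    and Q :: "'a measure" and W :: "'a \<Rightarrow> complex" and K :: real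
  assumes pair: "C11_pair g G C"
    and finite_Q: "finite_measure Q" and sets_Q[measurable_cong, simp]: "sets Q = sets borel"
    and moment_Q: "integrable Q (\<lambda>\<xi>. (norm \<xi>)\<^sup>2)"
    and measurable_W[measurable]: "W \<in> borel_measurable borel" and bound_W: "\<And>\<xi>. cmod (W \<xi>) \<le> K"
    and representation: "\<And>x. complex_of_real (g x) = (CLINT \<xi>|Q. W \<xi> * iexp (\<xi> \<bullet> x))"
begin

sublocale Q: finite_measure Q by (rule finite_Q)

lemmas g_measurable[measurable] = C11_pair_measurable(1)[OF pair]
  and G_measurable[measurable] = C11_pair_measurable(2)[OF pair]

lemma G_bound: "norm (G x) \<le> C"
  using C11_pairD(2)[OF pair] .

lemma K_nonneg: "0 \<le> K"
  using order_trans[OF norm_ge_zero bound_W] .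

lemma moment1_Q: "integrable Q norm"
proof (rule Bochner_Integration.integrable_bound)
  show "integrable Q (\<lambda>\<xi>. 1 + (norm \<xi>)\<^sup>2)" using moment_Q by simp
  have "n \<le> 1 + n\<^sup>2" for n :: real
  proof -
    have "2 * n \<le> 1 + n\<^sup>2"
      using zero_le_power2[of "n - 1"] by (simp add: power2_eq_square algebra_simps)
    then show ?thesis using zero_le_power2[of n] by linarith
  qed
  then show "AE \<xi> in Q. norm (norm \<xi>) \<le> norm (1 + (norm \<xi>)\<^sup>2)"
    by (intro AE_I2) auto
qed measurable

lemma integrable_Q_bound:
  fixes f :: "'a \<Rightarrow> complex"
  assumes "f \<in> borel_measurable borel" and "\<And>\<xi>. cmod (f \<xi>) \<le> A + B * norm \<xi> + D * (norm \<xi>)\<^sup>2"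
  shows "integrable Q f"
proof (rule Bochner_Integration.integrable_bound)
  show "integrable Q (\<lambda>\<xi>. A + B * norm \<xi> + D * (norm \<xi>)\<^sup>2)" using moment_Q moment1_Q by simp
  show "AE \<xi> in Q. cmod (f \<xi>) \<le> norm (A + B * norm \<xi> + D * (norm \<xi>)\<^sup>2)"
    using assms(2) by (intro AE_I2) (metis abs_ge_self order_trans real_norm_def)
qed (use assms(1) in measurable)

lemma gradient_factor_bound:
  assumes "cmod z \<le> 1"
  shows "cmod (W \<xi> * (\<i> * complex_of_real (\<xi> \<bullet> v)) * z) \<le> K * norm v * norm \<xi>"
proof -
  have "cmod (W \<xi> * (\<i> * complex_of_real (\<xi> \<bullet> v)) * z) = cmod (W \<xi>) * \<bar>\<xi> \<bullet> v\<bar> * cmod z"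
    by (simp add: norm_mult)
  also have "\<dots> \<le> K * (norm \<xi> * norm v) * 1"
    by (intro mult_mono bound_W Cauchy_Schwarz_ineq2 assms K_nonneg) (auto simp: K_nonneg)
  finally show ?thesis by (simp add: mult_ac)
qed

lemma integrable_gradient_factor:
  assumes "f \<in> borel_measurable borel" "\<And>\<xi>. cmod (f \<xi>) \<le> 1"
  shows "integrable Q (\<lambda>\<xi>. W \<xi> * (\<i> * complex_of_real (\<xi> \<bullet> v)) * f \<xi>)"
  by (rule integrable_Q_bound[where A = 0 and B = "K * norm v" and D = 0])
     (use assms gradient_factor_bound in auto)

text \<open>Both sides approximate the difference quotient of g in direction v with an error of
  order s: the left by the Taylor bound of the pair, the right by the second moment of Q. Letting s
  decrease to 0 identifies them without differentiating under the integral.\<close>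

lemma gradient_representation:
  "complex_of_real (G x \<bullet> v) = (CLINT \<xi>|Q. W \<xi> * (\<i> * complex_of_real (\<xi> \<bullet> v)) * iexp (\<xi> \<bullet> x))"
    (is "_ = ?D")
proof -
  let ?f = "\<lambda>s \<xi>. W \<xi> * iexp (\<xi> \<bullet> x) * (iexp (s * (\<xi> \<bullet> v)) - 1 - \<i> * complex_of_real (s * (\<xi> \<bullet> v)))"
  have b: "cmod (?f s \<xi>) \<le> s\<^sup>2 * (K * (norm v)\<^sup>2 * (norm \<xi>)\<^sup>2)" for s \<xi>
  proof -
    have "cmod (?f s \<xi>) \<le> K * 1 * (\<bar>s * (\<xi> \<bullet> v)\<bar>\<^sup>2 / 2)"
      unfolding norm_mult[of _ "_ - _"] norm_mult[of "W \<xi>"]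
      by (intro mult_mono bound_W cmod_iexp_compensated_le K_nonneg mult_nonneg_nonneg) auto
    also have "\<dots> \<le> K * 1 * (s\<^sup>2 * (norm \<xi> * norm v)\<^sup>2)"
    proof (intro mult_left_mono)
      have "\<bar>\<xi> \<bullet> v\<bar>\<^sup>2 \<le> (norm \<xi> * norm v)\<^sup>2" by (intro power_mono Cauchy_Schwarz_ineq2) simp
      then have "s\<^sup>2 * \<bar>\<xi> \<bullet> v\<bar>\<^sup>2 \<le> s\<^sup>2 * (norm \<xi> * norm v)\<^sup>2" by (intro mult_left_mono) auto
      moreover have "0 \<le> s\<^sup>2 * \<bar>\<xi> \<bullet> v\<bar>\<^sup>2" by simp
      ultimately show "\<bar>s * (\<xi> \<bullet> v)\<bar>\<^sup>2 / 2 \<le> s\<^sup>2 * (norm \<xi> * norm v)\<^sup>2"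
        unfolding abs_mult power_mult_distrib[of "\<bar>s\<bar>"] power2_abs by linarith
    qed (use K_nonneg in simp)
    finally show ?thesis by (simp add: power_mult_distrib mult_ac)
  qed
  have eq: "complex_of_real (g (x + s *\<^sub>R v) - g x) - s *\<^sub>R ?D = (CLINT \<xi>|Q. ?f s \<xi>)" for s
  proof -
    have 1: "integrable Q (\<lambda>\<xi>. W \<xi> * iexp (\<xi> \<bullet> y))" for y
      by (rule integrable_Q_bound[where A = K and B = 0 and D = 0]) (use bound_W in \<open>auto simp: norm_mult\<close>)
    have 2: "integrable Q (\<lambda>\<xi>. s *\<^sub>R (W \<xi> * (\<i> * complex_of_real (\<xi> \<bullet> v)) * iexp (\<xi> \<bullet> x)))"
      by (intro integrable_scaleR_right integrable_gradient_factor) auto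
    show ?thesis
      unfolding of_real_diff representation integral_scaleR_right[symmetric]
        Bochner_Integration.integral_diff[OF 1 1, symmetric]
        Bochner_Integration.integral_diff[OF Bochner_Integration.integrable_diff[OF 1 1] 2, symmetric]
      by (intro Bochner_Integration.integral_cong refl)
         (simp add: inner_add_right distrib_left exp_add scaleR_conv_of_real algebra_simps)
  qed
  define B where "B = (LINT \<xi>|Q. K * (norm v)\<^sup>2 * (norm \<xi>)\<^sup>2)"
  have le: "cmod (complex_of_real (g (x + s *\<^sub>R v) - g x) - s *\<^sub>R ?D) \<le> s\<^sup>2 * B" for s
  proof -
    have "cmod (complex_of_real (g (x + s *\<^sub>R v) - g x) - s *\<^sub>R ?D) \<le> (LINT \<xi>|Q. cmod (?f s \<xi>))"
      unfolding eq by (rule integral_norm_bound)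
    also have "\<dots> \<le> (LINT \<xi>|Q. s\<^sup>2 * (K * (norm v)\<^sup>2 * (norm \<xi>)\<^sup>2))"
    proof (rule integral_mono[OF integrable_norm])
      show "integrable Q (?f s)"
        by (rule integrable_Q_bound[where A = 0 and B = 0 and D = "s\<^sup>2 * (K * (norm v)\<^sup>2)"])
           (use b[of _ s] in \<open>auto simp: mult.assoc\<close>)
    qed (use moment_Q b in auto)
    finally show ?thesis by (simp add: B_def)
  qed
  have le2: "cmod (complex_of_real (g (x + s *\<^sub>R v) - g x) - s *\<^sub>R complex_of_real (G x \<bullet> v)) \<le> s\<^sup>2 * (C * (norm v)\<^sup>2)" for s
  proof -
    have "complex_of_real (g (x + s *\<^sub>R v) - g x) - s *\<^sub>R complex_of_real (G x \<bullet> v)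
        = complex_of_real (g (x + s *\<^sub>R v) - g x - G x \<bullet> (s *\<^sub>R v))"
      by (simp add: scaleR_conv_of_real)
    also have "cmod \<dots> \<le> C * (norm (s *\<^sub>R v))\<^sup>2"
      unfolding norm_of_real by (rule C11_pairD(5)[OF pair])
    finally show ?thesis by (simp add: power_mult_distrib mult_ac)
  qed
  have "cmod (complex_of_real (G x \<bullet> v) - ?D) \<le> 0 + s * (B + C * (norm v)\<^sup>2)" if s: "0 < s" for s
  proof -
    let ?g = "complex_of_real (g (x + s *\<^sub>R v) - g x)"
    have "s * cmod (complex_of_real (G x \<bullet> v) - ?D)
        = cmod ((?g - s *\<^sub>R ?D) - (?g - s *\<^sub>R complex_of_real (G x \<bullet> v)))"
      using s by (simp add: scaleR_diff_right[symmetric])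
    also have "\<dots> \<le> s\<^sup>2 * B + s\<^sup>2 * (C * (norm v)\<^sup>2)"
      using norm_triangle_ineq4[of "?g - s *\<^sub>R ?D" "?g - s *\<^sub>R complex_of_real (G x \<bullet> v)"] le[of s] le2[of s] by linarith
    also have "\<dots> = s * (s * (B + C * (norm v)\<^sup>2))" by (simp add: power2_eq_square algebra_simps)
    finally show ?thesis using s by simp
  qed
  moreover have "((\<lambda>s. 0 + s * (B + C * (norm v)\<^sup>2)) \<longlongrightarrow> 0 + 0 * (B + C * (norm v)\<^sup>2)) (at_right 0)"
    by (intro tendsto_intros)
  ultimately have "cmod (complex_of_real (G x \<bullet> v) - ?D) \<le> 0"
    by (intro tendsto_lowerbound[where F = "at_right 0" and f = "\<lambda>s. 0 + s * (B + C * (norm v)\<^sup>2)"])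
       (auto simp: eventually_at_right_field intro!: exI[of _ 1])
  then show ?thesis by simp
qed

lemma swap_R:
  assumes t: "0 \<le> t" and [measurable]: "f \<in> borel_measurable borel"
    and b: "\<And>\<xi>. cmod (f \<xi>) \<le> A + B * norm \<xi>"
  shows "(CLINT u|R t. CLINT \<xi>|Q. f \<xi> * iexp (\<xi> \<bullet> (u + exp (- t) *\<^sub>R x))) = (CLINT \<xi>|Q. f \<xi> * char_flow \<xi> x t)"
proof -
  interpret Rt: prob_space "R t" by (rule R(1)[OF t])
  note [measurable_cong] = R(2)[OF t]
  have "(CLINT u|R t. CLINT \<xi>|Q. f \<xi> * iexp (\<xi> \<bullet> (u + exp (- t) *\<^sub>R x)))
      = (CLINT \<xi>|Q. CLINT u|R t. f \<xi> * iexp (\<xi> \<bullet> (u + exp (- t) *\<^sub>R x)))"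
  proof (rule integral_swap_bound[where a = "\<lambda>_. 1" and b = "\<lambda>\<xi>. A + B * norm \<xi>"])
    show "sigma_finite_measure (R t)" "sigma_finite_measure Q" by unfold_locales
    show "integrable (R t) (\<lambda>_. 1::real)" by simp
    show "integrable Q (\<lambda>\<xi>. A + B * norm \<xi>)" using moment1_Q by simp
    show "AE \<xi> in Q. \<forall>u\<in>space (R t). cmod (f \<xi> * iexp (\<xi> \<bullet> (u + exp (- t) *\<^sub>R x))) \<le> 1 * (A + B * norm \<xi>)"
      using b by (intro AE_I2) (simp add: norm_mult)
  qed measurable
  also have "\<dots> = (CLINT \<xi>|Q. f \<xi> * char_flow \<xi> x t)"
    by (simp only: integral_mult_right_zero char_flow_eq_integral[OF t])
  finally show ?thesis .
qed

lemma flow_representation: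
  assumes t: "0 \<le> t"
  shows "complex_of_real (flow g t x) = (CLINT \<xi>|Q. W \<xi> * char_flow \<xi> x t)"
proof -
  have "complex_of_real (flow g t x) = (CLINT u|R t. CLINT \<xi>|Q. W \<xi> * iexp (\<xi> \<bullet> (u + exp (- t) *\<^sub>R x)))"
    using t by (simp only: flow_def if_True integral_complex_of_real[symmetric] representation)
  also have "\<dots> = (CLINT \<xi>|Q. W \<xi> * char_flow \<xi> x t)"
    by (rule swap_R[OF t, where A = K and B = 0]) (use bound_W in auto)
  finally show ?thesis .
qed

lemma flow_gradient_representation:
  assumes t: "0 \<le> t"
  shows "complex_of_real (flow G t x \<bullet> v) = (CLINT \<xi>|Q. W \<xi> * (\<i> * complex_of_real (\<xi> \<bullet> v)) * char_flow \<xi> x t)"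
proof -
  have "complex_of_real (flow G t x \<bullet> v) = (CLINT u|R t. complex_of_real (G (u + exp (- t) *\<^sub>R x) \<bullet> v))"
    using t by (simp only: flow_def if_True integral_complex_of_real integral_inner_left[OF
        integrable_R_bounded[OF t G_measurable G_bound]])
  also have "\<dots> = (CLINT u|R t. CLINT \<xi>|Q. W \<xi> * (\<i> * complex_of_real (\<xi> \<bullet> v)) * iexp (\<xi> \<bullet> (u + exp (- t) *\<^sub>R x)))"
    by (simp only: gradient_representation)
  also have "\<dots> = (CLINT \<xi>|Q. W \<xi> * (\<i> * complex_of_real (\<xi> \<bullet> v)) * char_flow \<xi> x t)"
    by (rule swap_R[OF t, where A = 0 and B = "K * norm v"])
       (use gradient_factor_bound[of 1] in auto)
  finally show ?thesis .
qed

text \<open>The family \<open>R\<close> gives no direct access to measurability in t; in the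
  representation by characters t occurs only in \<open>char_flow\<close>, which is explicit.\<close>

lemma measurable_flow_g[measurable]: "(\<lambda>t. flow g t x) \<in> borel_measurable borel"
proof -
  have "(\<lambda>t. CLINT \<xi>|Q. W \<xi> * char_flow \<xi> x t) \<in> borel_measurable borel"
    by (rule Q.borel_measurable_lebesgue_integral) measurable
  then have "(\<lambda>t. if 0 \<le> t then Re (CLINT \<xi>|Q. W \<xi> * char_flow \<xi> x t) else 0) \<in> borel_measurable borel"
    by measurable
  also have "(\<lambda>t. if 0 \<le> t then Re (CLINT \<xi>|Q. W \<xi> * char_flow \<xi> x t) else 0) = (\<lambda>t. flow g t x)"
    by (auto simp: fun_eq_iff flow_representation[symmetric]) (simp add: flow_def)
  finally show ?thesis .
qed

lemma measurable_flow_G[measurable]: "(\<lambda>t. flow G t x) \<in> borel_measurable borel"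
proof (subst borel_measurable_euclidean_space, intro ballI)
  fix v :: 'a
  have "(\<lambda>t. CLINT \<xi>|Q. W \<xi> * (\<i> * complex_of_real (\<xi> \<bullet> v)) * char_flow \<xi> x t) \<in> borel_measurable borel"
    by (rule Q.borel_measurable_lebesgue_integral) measurable
  then have "(\<lambda>t. if 0 \<le> t then Re (CLINT \<xi>|Q. W \<xi> * (\<i> * complex_of_real (\<xi> \<bullet> v)) * char_flow \<xi> x t) else 0) \<in> borel_measurable borel"
    by measurable
  also have "(\<lambda>t. if 0 \<le> t then Re (CLINT \<xi>|Q. W \<xi> * (\<i> * complex_of_real (\<xi> \<bullet> v)) * char_flow \<xi> x t) else 0) = (\<lambda>t. flow G t x \<bullet> v)"
    by (auto simp: fun_eq_iff flow_gradient_representation[symmetric]) (simp add: flow_def)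
  finally show "(\<lambda>t. flow G t x \<bullet> v) \<in> borel_measurable borel" .
qed

lemma flow_integral_representation:
  "complex_of_real (flow_integral G x \<bullet> v) = (CLINT \<xi>|Q. W \<xi> * (\<i> * complex_of_real (\<xi> \<bullet> v)) * char_resolvent \<xi> x)"
proof -
  interpret T: prob_space exp_law by (rule prob_space_exp_law)
  let ?f = "\<lambda>t \<xi>. W \<xi> * (\<i> * complex_of_real (\<xi> \<bullet> v)) * char_flow \<xi> x t"
  have [measurable]: "(\<lambda>t. CLINT \<xi>|Q. ?f t \<xi>) \<in> borel_measurable borel"
    by (rule Q.borel_measurable_lebesgue_integral) measurable
  have "complex_of_real (flow_integral G x \<bullet> v) = (CLINT t|exp_law. complex_of_real (flow G t x \<bullet> v))"
    unfolding flow_integral_def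
    by (simp only: integral_complex_of_real integral_inner_left[OF flow_integrable[OF G_measurable G_bound measurable_flow_G]])
  also have "\<dots> = (CLINT t|exp_law. CLINT \<xi>|Q. ?f t \<xi>)"
    by (rule integral_cong_AE) (use AE_exp_law flow_gradient_representation in auto)
  also have "\<dots> = (CLINT \<xi>|Q. CLINT t|exp_law. ?f t \<xi>)"
  proof (rule integral_swap_bound[symmetric, where b = "\<lambda>_. 1" and a = "\<lambda>\<xi>. K * norm v * norm \<xi>"])
    show "sigma_finite_measure exp_law" "sigma_finite_measure Q" by unfold_locales
    show "integrable exp_law (\<lambda>_. 1::real)" by simp
    show "integrable Q (\<lambda>\<xi>. K * norm v * norm \<xi>)" using moment1_Q by simp
    show "AE t in exp_law. \<forall>\<xi>\<in>space Q. cmod (?f t \<xi>) \<le> K * norm v * norm \<xi> * 1"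
      using AE_exp_law by (rule eventually_mono) (use norm_char_flow_le gradient_factor_bound in auto)
  qed measurable
  finally show ?thesis unfolding char_resolvent_def by (simp only: integral_mult_right_zero)
qed

lemma expectation_representation: "complex_of_real (LINT x|L. g x) = (CLINT \<xi>|Q. W \<xi> * char_fun L \<xi>)"
proof -
  have "complex_of_real (LINT x|L. g x) = (CLINT x|L. CLINT \<xi>|Q. W \<xi> * iexp (\<xi> \<bullet> x))"
    by (simp only: integral_complex_of_real[symmetric] representation)
  also have "\<dots> = (CLINT \<xi>|Q. CLINT x|L. W \<xi> * iexp (\<xi> \<bullet> x))"
  proof (rule integral_swap_bound[where a = "\<lambda>_. 1" and b = "\<lambda>_. K"])
    show "sigma_finite_measure L" "sigma_finite_measure Q" by unfold_locales
    show "AE \<xi> in Q. \<forall>x\<in>space L. cmod (W \<xi> * iexp (\<xi> \<bullet> x)) \<le> 1 * K"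
      using bound_W by (intro AE_I2) (simp add: norm_mult)
    show "integrable L (\<lambda>_. 1::real)" "integrable Q (\<lambda>_. K)" by simp_all
  qed measurable
  finally show ?thesis unfolding char_fun_def by (simp only: integral_mult_right_zero)
qed

text \<open>Invariance of \<open>L\<close> under the semigroup. Averaging a flowed character over
  \<open>L\<close> produces exactly the denominator of the quotient, which is an exponential and
  hence nonzero.\<close>

lemma expectation_flow:
  assumes t: "0 \<le> t"
  shows "(LINT y|L. flow g t y) = (LINT x|L. g x)"
proof -
  have "complex_of_real (LINT y|L. flow g t y) = (CLINT y|L. CLINT \<xi>|Q. W \<xi> * char_flow \<xi> y t)"
    by (simp only: integral_complex_of_real[symmetric] flow_representation[OF t])
  also have "\<dots> = (CLINT \<xi>|Q. CLINT y|L. W \<xi> * char_flow \<xi> y t)"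
  proof (rule integral_swap_bound[where a = "\<lambda>_. 1" and b = "\<lambda>_. K"])
    show "sigma_finite_measure L" "sigma_finite_measure Q" by unfold_locales
    show "AE \<xi> in Q. \<forall>y\<in>space L. cmod (W \<xi> * char_flow \<xi> y t) \<le> 1 * K"
    proof (intro AE_I2 ballI)
      fix \<xi> y
      have "cmod (W \<xi> * char_flow \<xi> y t) \<le> K * 1"
        unfolding norm_mult by (intro mult_mono bound_W norm_char_flow_le t K_nonneg) auto
      then show "cmod (W \<xi> * char_flow \<xi> y t) \<le> 1 * K" by simp
    qed
    show "integrable L (\<lambda>_. 1::real)" "integrable Q (\<lambda>_. K)" by simp_all
  qed measurable
  also have "\<dots> = (CLINT \<xi>|Q. W \<xi> * char_fun L \<xi>)"
  proof (intro Bochner_Integration.integral_cong refl)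
    fix \<xi>
    have "(CLINT y|L. char_flow \<xi> y t)
        = (CLINT y|L. (char_fun L \<xi> / char_fun L (exp (- t) *\<^sub>R \<xi>)) * iexp ((exp (- t) *\<^sub>R \<xi>) \<bullet> y))"
      by (intro Bochner_Integration.integral_cong refl) (simp add: char_flow_def mult_ac)
    also have "\<dots> = (char_fun L \<xi> / char_fun L (exp (- t) *\<^sub>R \<xi>)) * char_fun L (exp (- t) *\<^sub>R \<xi>)"
      unfolding char_fun_def[of L "exp (- t) *\<^sub>R \<xi>"] by (rule integral_mult_right_zero)
    also have "\<dots> = char_fun L \<xi>" by (simp add: char_fun_exponent)
    finally show "(CLINT y|L. W \<xi> * char_flow \<xi> y t) = W \<xi> * char_fun L \<xi>"
      by (simp only: integral_mult_right_zero)
  qed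
  also have "\<dots> = complex_of_real (LINT x|L. g x)" by (rule expectation_representation[symmetric])
  finally show ?thesis by (simp only: of_real_eq_iff)
qed

text \<open>The identity for characters, integrated against W dQ. The sign is opposite to that of
  the Stein equation because \<open>flow_integral G\<close> is minus the gradient of the
  solution.\<close>

lemma stein_identity:
  "(mean - x) \<bullet> flow_integral G x + (LINT u|\<nu>. (flow_integral G (x + u) - flow_integral G x) \<bullet> u)
     = (LINT y|L. g y) - g x"
proof -
  let ?n = "\<lambda>\<xi> u. \<i> * complex_of_real (\<xi> \<bullet> u) * (char_resolvent \<xi> (x + u) - char_resolvent \<xi> x)"
  let ?a = "\<lambda>\<xi>. W \<xi> * (\<i> * complex_of_real ((mean - x) \<bullet> \<xi>) * char_resolvent \<xi> x)"
  have res: "complex_of_real (flow_integral G y \<bullet> v) = (CLINT \<xi>|Q. W \<xi> * (\<i> * complex_of_real (\<xi> \<bullet> v)) * char_resolvent \<xi> y)" for y v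
    by (rule flow_integral_representation)
  have ires: "integrable Q (\<lambda>\<xi>. W \<xi> * (\<i> * complex_of_real (\<xi> \<bullet> v)) * char_resolvent \<xi> y)" for y v
    by (rule integrable_gradient_factor) (auto intro: norm_char_resolvent_le)
  have 1: "complex_of_real ((mean - x) \<bullet> flow_integral G x) = (CLINT \<xi>|Q. ?a \<xi>)"
    unfolding inner_commute[of "mean - x"] res by (simp add: mult.assoc)
  have ia: "integrable Q ?a"
    using ires[of "mean - x" x] by (simp add: mult.assoc inner_commute)
  have "complex_of_real (LINT u|\<nu>. (flow_integral G (x + u) - flow_integral G x) \<bullet> u)
      = (CLINT u|\<nu>. complex_of_real (flow_integral G (x + u) \<bullet> u) - complex_of_real (flow_integral G x \<bullet> u))"
    unfolding integral_complex_of_real[symmetric] inner_diff_left of_real_diff ..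
  also have "\<dots> = (CLINT u|\<nu>. CLINT \<xi>|Q. W \<xi> * ?n \<xi> u)"
    unfolding res Bochner_Integration.integral_diff[OF ires ires, symmetric]
    by (intro Bochner_Integration.integral_cong refl) (simp add: right_diff_distrib mult_ac)
  also have "\<dots> = (CLINT \<xi>|Q. CLINT u|\<nu>. W \<xi> * ?n \<xi> u)"
  proof (rule integral_swap_bound[where a = "\<lambda>u. min (norm u) ((norm u)\<^sup>2)" and b = "\<lambda>\<xi>. K * (2 * norm \<xi> + (norm \<xi>)\<^sup>2)"])
    show "sigma_finite_measure \<nu>" "sigma_finite_measure Q" by unfold_locales
    show "integrable Q (\<lambda>\<xi>. K * (2 * norm \<xi> + (norm \<xi>)\<^sup>2))" using moment_Q moment1_Q by simp
    show "AE \<xi> in Q. \<forall>u\<in>space \<nu>. cmod (W \<xi> * ?n \<xi> u) \<le> min (norm u) ((norm u)\<^sup>2) * (K * (2 * norm \<xi> + (norm \<xi>)\<^sup>2))"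
    proof (intro AE_I2 ballI)
      fix \<xi> u
      have "cmod (W \<xi> * ?n \<xi> u) \<le> K * ((2 * norm \<xi> + (norm \<xi>)\<^sup>2) * min (norm u) ((norm u)\<^sup>2))"
        unfolding norm_mult[of "W \<xi>"] by (intro mult_mono bound_W nonlocal_bound K_nonneg) auto
      then show "cmod (W \<xi> * ?n \<xi> u) \<le> min (norm u) ((norm u)\<^sup>2) * (K * (2 * norm \<xi> + (norm \<xi>)\<^sup>2))"
        by (simp only: mult_ac)
    qed
  qed (measurable, rule first_moment)
  also have "\<dots> = (CLINT \<xi>|Q. W \<xi> * char_fun L \<xi> - W \<xi> * iexp (\<xi> \<bullet> x) - ?a \<xi>)"
  proof (intro Bochner_Integration.integral_cong refl)
    fix \<xi>
    have "(CLINT u|\<nu>. ?n \<xi> u) = char_fun L \<xi> - iexp (\<xi> \<bullet> x) - \<i> * complex_of_real ((mean - x) \<bullet> \<xi>) * char_resolvent \<xi> x"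
      unfolding stein_identity_char[of x \<xi>, symmetric] by simp
    then have "(CLINT u|\<nu>. W \<xi> * ?n \<xi> u)
        = W \<xi> * (char_fun L \<xi> - iexp (\<xi> \<bullet> x) - \<i> * complex_of_real ((mean - x) \<bullet> \<xi>) * char_resolvent \<xi> x)"
      by (simp only: integral_mult_right_zero)
    then show "(CLINT u|\<nu>. W \<xi> * ?n \<xi> u) = W \<xi> * char_fun L \<xi> - W \<xi> * iexp (\<xi> \<bullet> x) - ?a \<xi>"
      by (simp only: right_diff_distrib)
  qed
  also have "\<dots> = complex_of_real (LINT y|L. g y) - complex_of_real (g x) - complex_of_real ((mean - x) \<bullet> flow_integral G x)"
  proof -
    have i1: "integrable Q (\<lambda>\<xi>. W \<xi> * iexp (\<xi> \<bullet> x))"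
      by (rule integrable_Q_bound[where A = K and B = 0 and D = 0]) (use bound_W in \<open>auto simp: norm_mult\<close>)
    have i2: "integrable Q (\<lambda>\<xi>. W \<xi> * char_fun L \<xi>)"
    proof (rule integrable_Q_bound[where A = K and B = 0 and D = 0])
      fix \<xi>
      have "cmod (char_fun L \<xi>) \<le> (LINT x|L. cmod (iexp (\<xi> \<bullet> x)))"
        unfolding char_fun_def by (rule integral_norm_bound)
      then have "cmod (char_fun L \<xi>) \<le> 1" using L.prob_space by simp
      from mult_mono[OF bound_W this K_nonneg]
      show "cmod (W \<xi> * char_fun L \<xi>) \<le> K + 0 * norm \<xi> + 0 * (norm \<xi>)\<^sup>2" by (simp add: norm_mult)
    qed measurable
    show ?thesis
      unfolding expectation_representation representation 1
      by (simp only: Bochner_Integration.integral_diff[OF Bochner_Integration.integrable_diff[OF i2 i1] ia]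
          Bochner_Integration.integral_diff[OF i2 i1])
  qed
  finally have "complex_of_real (LINT u|\<nu>. (flow_integral G (x + u) - flow_integral G x) \<bullet> u)
    = complex_of_real ((LINT y|L. g y) - g x - (mean - x) \<bullet> flow_integral G x)"
    by (simp only: of_real_diff)
  then show ?thesis by (simp only: of_real_eq_iff)
qed

end

subsection \<open>Removing the smoothing\<close>

lemma GDERIV_quadratic:
  fixes f :: "'a::euclidean_space \<Rightarrow> real"
  assumes "\<And>v. \<bar>f (x + v) - f x - D \<bullet> v\<bar> \<le> C * (norm v)\<^sup>2"
  shows "GDERIV f x :> D"
  unfolding gderiv_def has_derivative_at
proof (intro conjI)
  show "bounded_linear (\<lambda>h. h \<bullet> D)" by (rule bounded_linear_inner_left)
  show "(\<lambda>h. norm (f (x + h) - f x - h \<bullet> D) / norm h) \<midarrow>0\<rightarrow> 0"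
  proof (rule Lim_null_comparison)
    show "\<forall>\<^sub>F h in at 0. norm (norm (f (x + h) - f x - h \<bullet> D) / norm h) \<le> C * norm h"
    proof (intro always_eventually allI)
      fix h
      show "norm (norm (f (x + h) - f x - h \<bullet> D) / norm h) \<le> C * norm h"
      proof (cases "h = 0")
        case False
        then show ?thesis
          using assms[of h] by (simp add: inner_commute divide_le_eq power2_eq_square mult.assoc)
      qed simp
    qed
    show "(\<lambda>h::'a. C * norm h) \<midarrow>0\<rightarrow> 0" by (rule tendsto_mult_right_zero) (rule tendsto_norm_zero, rule tendsto_ident_at)
  qed
qed

lemma gradient_eqI:
  assumes "GDERIV f x :> D"
  shows "gradient f x = D"
  unfolding gradient_def
proof (rule the_equality[where P = "\<lambda>D. GDERIV f x :> D", OF assms])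
  fix D' assume "GDERIV f x :> D'"
  then have "(\<lambda>h. h \<bullet> D') = (\<lambda>h. h \<bullet> D)"
    using assms unfolding gderiv_def by (rule has_derivative_unique)
  then have "(D' - D) \<bullet> D' = (D' - D) \<bullet> D" by meson
  then have "(D' - D) \<bullet> (D' - D) = 0" by (simp add: inner_diff_right)
  then show "D' = D" by simp
qed

lemma exp_mult_exp_minus_cancel: "exp t * (c * exp (- t) * y) = c * y" for t c y :: real
  by (simp add: exp_minus field_simps)

locale OU_function = OU_setting +
  fixes h :: "'a \<Rightarrow> real" and H :: "'a \<Rightarrow> 'a" and C :: real
  assumes pair: "C11_pair h H C" and integrable_h: "integrable lborel h"
begin

definition hn :: "nat \<Rightarrow> 'a \<Rightarrow> real" where "hn n = gauss_conv (1 / real (Suc n)) h"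
definition Hn :: "nat \<Rightarrow> 'a \<Rightarrow> 'a" where "Hn n = gauss_conv (1 / real (Suc n)) H"

lemmas h_measurable[measurable] = C11_pair_measurable(1)[OF pair]
  and H_measurable[measurable] = C11_pair_measurable(2)[OF pair]

lemma h_bound: "norm (h x) \<le> C" and H_bound: "norm (H x) \<le> C"
  and h_lipschitz: "norm (h x - h y) \<le> C * norm (x - y)"
  and H_lipschitz: "norm (H x - H y) \<le> C * norm (x - y)"
  using C11_pairD[OF pair] by auto

lemma pair_n: "C11_pair (hn n) (Hn n) C"
  unfolding hn_def Hn_def by (rule C11_pair_gauss_conv[OF pair])

lemmas hn_measurable[measurable] = C11_pair_measurable(1)[OF pair_n]
  and Hn_measurable[measurable] = C11_pair_measurable(2)[OF pair_n]

lemma hn_bound: "norm (hn n x) \<le> C" and Hn_bound: "norm (Hn n x) \<le> C"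
  and hn_lipschitz: "norm (hn n x - hn n y) \<le> C * norm (x - y)"
  and Hn_lipschitz: "norm (Hn n x - Hn n y) \<le> C * norm (x - y)"
  using C11_pairD[OF pair_n] by auto

text \<open>Q, W and K vary with n without uniform control; the limits below rely only on the
  constant C, which is the same for all n.\<close>

lemma superposition_n: "\<exists>Q W K. superposition L \<nu> b R (hn n) (Hn n) C Q W K"
proof -
  have e: "0 < 1 / real (Suc n)" by simp
  show ?thesis
  proof (rule gauss_conv_fourier[OF integrable_h e])
    fix Q :: "'a measure" and W :: "'a \<Rightarrow> complex" and K :: real
    assume Q: "finite_measure Q" "sets Q = sets borel" "integrable Q (\<lambda>\<xi>. (norm \<xi>)\<^sup>2)"
      "W \<in> borel_measurable borel" "\<And>\<xi>. cmod (W \<xi>) \<le> K"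
      "\<And>x. complex_of_real (gauss_conv (1 / real (Suc n)) h x) = (CLINT \<xi>|Q. W \<xi> * iexp (\<xi> \<bullet> x))"
    have "superposition L \<nu> b R (hn n) (Hn n) C Q W K"
      by (intro superposition.intro superposition_axioms.intro OU_setting_axioms pair_n Q)
         (simp only: hn_def Q(6))
    then show ?thesis by blast
  qed
qed

lemma tendsto_inverse_Suc: "(\<lambda>n. 1 / real (Suc n)) \<longlonglongrightarrow> 0"
  using LIMSEQ_inverse_real_of_nat by (simp add: inverse_eq_divide)

lemma hn_tendsto: "(\<lambda>n. hn n x) \<longlonglongrightarrow> h x"
  unfolding hn_def by (rule gauss_conv_tendsto[OF C11_pair_continuous(1)[OF pair] h_bound tendsto_inverse_Suc])

lemma Hn_tendsto: "(\<lambda>n. Hn n x) \<longlonglongrightarrow> H x"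
  unfolding Hn_def by (rule gauss_conv_tendsto[OF C11_pair_continuous(2)[OF pair] H_bound tendsto_inverse_Suc])

lemma flow_tendsto:
  fixes g :: "'a \<Rightarrow> 'b::{banach, second_countable_topology}"
  assumes [measurable]: "\<And>n. gn n \<in> borel_measurable borel" "g \<in> borel_measurable borel"
    and "\<And>n x. norm (gn n x) \<le> C" and lim: "\<And>x. (\<lambda>n. gn n x) \<longlonglongrightarrow> g x"
  shows "(\<lambda>n. flow (gn n) t x) \<longlonglongrightarrow> flow g t x"
proof (cases "0 \<le> t")
  case True
  interpret Rt: prob_space "R t" by (rule R(1)[OF True])
  note [measurable_cong] = R(2)[OF True]
  have "(\<lambda>n. LINT u|R t. gn n (u + exp (- t) *\<^sub>R x)) \<longlonglongrightarrow> (LINT u|R t. g (u + exp (- t) *\<^sub>R x))"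
    by (rule integral_dominated_convergence[where w = "\<lambda>_. C"]) (use assms in auto)
  then show ?thesis using True by (simp add: flow_def)
qed (simp add: flow_def)

lemma flow_h_tendsto: "(\<lambda>n. flow (hn n) t x) \<longlonglongrightarrow> flow h t x"
  by (rule flow_tendsto[OF hn_measurable h_measurable hn_bound hn_tendsto])

lemma flow_H_tendsto: "(\<lambda>n. flow (Hn n) t x) \<longlonglongrightarrow> flow H t x"
  by (rule flow_tendsto[OF Hn_measurable H_measurable Hn_bound Hn_tendsto])

lemma measurable_flow_n[measurable]:
  "(\<lambda>t. flow (hn n) t x) \<in> borel_measurable borel" "(\<lambda>t. flow (Hn n) t x) \<in> borel_measurable borel"
  using superposition_n[of n] by (auto intro: superposition.measurable_flow_g superposition.measurable_flow_G)

lemma measurable_flow_h[measurable]: "(\<lambda>t. flow h t x) \<in> borel_measurable borel"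
  by (rule borel_measurable_LIMSEQ_metric[OF measurable_flow_n(1) flow_h_tendsto])

lemma measurable_flow_H[measurable]: "(\<lambda>t. flow H t x) \<in> borel_measurable borel"
  by (rule borel_measurable_LIMSEQ_metric[OF measurable_flow_n(2) flow_H_tendsto])

lemma measurable_flow_space:
  fixes g :: "'a \<Rightarrow> 'b::euclidean_space"
  assumes "g \<in> borel_measurable borel" "\<And>x. norm (g x) \<le> C"
    and "\<And>x y. norm (g x - g y) \<le> C * norm (x - y)"
  shows "flow g t \<in> borel_measurable borel"
proof (cases "0 \<le> t")
  case True
  show ?thesis
    using flow_lipschitz[OF assms True]
    by (intro borel_measurable_continuous_onI continuous_on_lipschitz_bound[where C = "C * exp (- t)"])
qed (simp add: flow_def[abs_def])

lemma flow_space_measurable[measurable]: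
  "flow h t \<in> borel_measurable borel" "flow (hn n) t \<in> borel_measurable borel"
  by (auto intro!: measurable_flow_space h_bound hn_bound h_lipschitz hn_lipschitz)

lemma expectation_tendsto: "(\<lambda>n. LINT y|L. hn n y) \<longlonglongrightarrow> (LINT y|L. h y)"
  by (rule integral_dominated_convergence[where w = "\<lambda>_. C"]) (use hn_tendsto hn_bound in auto)

lemma expectation_flow_h:
  assumes t: "0 \<le> t"
  shows "(LINT y|L. flow h t y) = (LINT y|L. h y)"
proof (rule LIMSEQ_unique)
  have "(LINT y|L. flow (hn n) t y) = (LINT y|L. hn n y)" for n
    using superposition_n[of n] t by (auto intro: superposition.expectation_flow)
  then show "(\<lambda>n. LINT y|L. flow (hn n) t y) \<longlonglongrightarrow> (LINT y|L. h y)"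
    using expectation_tendsto by simp
  show "(\<lambda>n. LINT y|L. flow (hn n) t y) \<longlonglongrightarrow> (LINT y|L. flow h t y)"
    by (rule integral_dominated_convergence[where w = "\<lambda>_. C"])
      (use flow_h_tendsto norm_flow_le[OF hn_measurable hn_bound] in auto)
qed

lemma flow_integral_tendsto: "(\<lambda>n. flow_integral (Hn n) x) \<longlonglongrightarrow> flow_integral H x"
proof -
  interpret T: prob_space exp_law by (rule prob_space_exp_law)
  show ?thesis
    unfolding flow_integral_def
    by (rule integral_dominated_convergence[where w = "\<lambda>_. C"])
      (use flow_H_tendsto norm_flow_le[OF Hn_measurable Hn_bound] in auto)
qed

lemmas flow_integral_H = flow_integral_lipschitz[OF H_measurable H_bound H_lipschitz measurable_flow_H]
  and flow_integral_Hn = flow_integral_lipschitz[OF Hn_measurable Hn_bound Hn_lipschitz measurable_flow_n(2)]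

lemma flow_integral_measurable[measurable]:
  "flow_integral H \<in> borel_measurable borel" "flow_integral (Hn n) \<in> borel_measurable borel"
  using flow_integral_H(2) flow_integral_Hn(2)
  by (auto intro!: borel_measurable_continuous_onI continuous_on_lipschitz_bound[where C = C])

lemma generator_integrable: "integrable \<nu> (\<lambda>u. (flow_integral H (x + u) - flow_integral H x) \<bullet> u)"
  by (rule integrable_bound_first_moment[where C = "2 * C"])
     (use generator_bound[of "flow_integral H", OF flow_integral_H] in auto)

lemma stein_identity_h:
  "(mean - x) \<bullet> flow_integral H x + (LINT u|\<nu>. (flow_integral H (x + u) - flow_integral H x) \<bullet> u)
     = (LINT y|L. h y) - h x"
proof (rule LIMSEQ_unique)
  let ?I = "\<lambda>G. LINT u|\<nu>. (flow_integral G (x + u) - flow_integral G x) \<bullet> u"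
  have "(mean - x) \<bullet> flow_integral (Hn n) x + ?I (Hn n) = (LINT y|L. hn n y) - hn n x" for n
    using superposition_n[of n] by (auto intro: superposition.stein_identity)
  then show "(\<lambda>n. (mean - x) \<bullet> flow_integral (Hn n) x + ?I (Hn n)) \<longlonglongrightarrow> (LINT y|L. h y) - h x"
    by (simp only:) (intro tendsto_intros expectation_tendsto hn_tendsto)
  have "(\<lambda>n. ?I (Hn n)) \<longlonglongrightarrow> ?I H"
  proof (rule integral_dominated_convergence[where w = "\<lambda>u. 2 * C * min (norm u) ((norm u)\<^sup>2)"])
    show "integrable \<nu> (\<lambda>u. 2 * C * min (norm u) ((norm u)\<^sup>2))" using first_moment by simp
    show "AE u in \<nu>. norm ((flow_integral (Hn n) (x + u) - flow_integral (Hn n) x) \<bullet> u)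
        \<le> 2 * C * min (norm u) ((norm u)\<^sup>2)" for n
      unfolding real_norm_def
      by (intro AE_I2 generator_bound flow_integral_Hn)
    show "AE u in \<nu>. (\<lambda>n. (flow_integral (Hn n) (x + u) - flow_integral (Hn n) x) \<bullet> u)
        \<longlonglongrightarrow> (flow_integral H (x + u) - flow_integral H x) \<bullet> u"
      by (intro AE_I2 tendsto_intros flow_integral_tendsto)
  qed measurable
  then show "(\<lambda>n. (mean - x) \<bullet> flow_integral (Hn n) x + ?I (Hn n)) \<longlonglongrightarrow> (mean - x) \<bullet> flow_integral H x + ?I H"
    by (intro tendsto_intros flow_integral_tendsto)
qed

section \<open>Convergence of the Stein integral and its gradient\<close>

text \<open>By invariance the expectation of h is the average of \<open>flow h t\<close> over
  \<open>L\<close>, so the difference is an average of Lipschitz differences of the flow. Each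
  carries exp (-t), and the mean of |x - y| is finite by the first moment.\<close>

lemma flow_h_decay:
  assumes t: "0 \<le> t"
  shows "exp t * \<bar>flow h t x - (LINT y|L. h y)\<bar> \<le> C * (LINT y|L. norm (x - y))"
proof -
  have i1: "integrable L (flow h t)"
    by (rule L.integrable_const_bound[of _ C]) (use norm_flow_le[OF h_measurable h_bound] in auto)
  have i2: "integrable L (\<lambda>y. norm (x - y))"
    using integrable_id by (intro integrable_norm Bochner_Integration.integrable_diff) auto
  have "flow h t x - (LINT y|L. h y) = (LINT y|L. flow h t x - flow h t y)"
    using i1 L.prob_space by (simp add: expectation_flow_h[OF t])
  also have "\<bar>\<dots>\<bar> \<le> (LINT y|L. \<bar>flow h t x - flow h t y\<bar>)" by (rule integral_abs_bound)
  also have "\<dots> \<le> (LINT y|L. C * exp (- t) * norm (x - y))"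
  proof (rule integral_mono)
    show "integrable L (\<lambda>y. \<bar>flow h t x - flow h t y\<bar>)"
      using i1 by (intro integrable_abs Bochner_Integration.integrable_diff) auto
    show "\<bar>flow h t x - flow h t y\<bar> \<le> C * exp (- t) * norm (x - y)" for y
      using flow_lipschitz[OF h_measurable h_bound h_lipschitz t, of x y] by simp
  qed (use i2 in simp)
  also have "\<dots> = C * exp (- t) * (LINT y|L. norm (x - y))" by simp
  finally have "exp t * \<bar>flow h t x - (LINT y|L. h y)\<bar> \<le> exp t * (C * exp (- t) * (LINT y|L. norm (x - y)))"
    by (intro mult_left_mono) auto
  then show ?thesis by (simp only: exp_mult_exp_minus_cancel)
qed

text \<open>The weight exp t cancels the exponential density, so this is the original time integral;
  in this form the integrand is bounded.\<close>

definition stein_function :: "'a \<Rightarrow> real" where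
  "stein_function x = - (LINT t|exp_law. exp t * (flow h t x - (LINT y|L. h y)))"

lemma integrable_scaled_flow: "integrable exp_law (\<lambda>t. exp t * (flow h t x - (LINT y|L. h y)))"
  by (rule integrable_exp_law_bounded[where B = "C * (LINT y|L. norm (x - y))"])
     (use flow_h_decay in \<open>auto simp: abs_mult\<close>)

lemma set_integrable_flow: "set_integrable lborel {0..} (\<lambda>t. flow h t x - (LINT y|L. h y))"
  using integrable_scaled_flow[of x]
  by (subst (asm) integrable_exp_law_iff) (simp_all add: mult.assoc[symmetric] flip: exp_add)

lemma stein_function_eq: "stein_function x = - (LBINT t:{0..}. flow h t x - (LINT y|L. h y))"
  unfolding stein_function_def
  by (subst integral_exp_law) (simp_all add: mult.assoc[symmetric] flip: exp_add)

lemma stein_function_GDERIV: "GDERIV stein_function x :> - flow_integral H x"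
proof (rule GDERIV_quadratic)
  fix v
  have iH: "integrable exp_law (\<lambda>t. flow H t x)"
    by (rule flow_integrable[OF H_measurable H_bound measurable_flow_H])
  \<comment> \<open>Equal to exp t times the Taylor remainder of the flow, hence bounded by C |v|^2
    uniformly in t.\<close>
  define q where "q t = exp t * (flow h t (x + v) - flow h t x) - flow H t x \<bullet> v" for t
  have qm: "q \<in> borel_measurable borel" unfolding q_def[abs_def] by measurable
  have "(LINT t|exp_law. exp t * (flow h t (x + v) - (LINT y|L. h y)))
      - (LINT t|exp_law. exp t * (flow h t x - (LINT y|L. h y))) - flow_integral H x \<bullet> v = (LINT t|exp_law. q t)"
    unfolding flow_integral_def
      integral_inner_left[OF iH, symmetric]
      Bochner_Integration.integral_diff[OF integrable_scaled_flow integrable_scaled_flow, symmetric]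
      Bochner_Integration.integral_diff[OF Bochner_Integration.integrable_diff[OF integrable_scaled_flow integrable_scaled_flow]
        integrable_inner_left[OF iH], symmetric]
    by (intro Bochner_Integration.integral_cong refl) (simp add: q_def algebra_simps)
  then have "stein_function (x + v) - stein_function x - (- flow_integral H x) \<bullet> v = - (LINT t|exp_law. q t)"
    by (simp add: stein_function_def)
  moreover have "norm (LINT t|exp_law. q t) \<le> C * (norm v)\<^sup>2"
  proof (rule norm_integral_exp_law_le[OF qm])
    fix t :: real assume t: "0 \<le> t"
    have "q t = exp t * (flow h t (x + v) - flow h t x - exp (- t) * (flow H t x \<bullet> v))"
      by (simp add: q_def right_diff_distrib mult.assoc[symmetric] flip: exp_add)
    then have "norm (q t) = exp t * \<bar>flow h t (x + v) - flow h t x - exp (- t) * (flow H t x \<bullet> v)\<bar>"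
      by (simp add: abs_mult)
    also have "\<dots> \<le> exp t * (C * exp (- t) * (norm v)\<^sup>2)"
      by (intro mult_left_mono flow_quadratic[OF pair t]) simp
    finally show "norm (q t) \<le> C * (norm v)\<^sup>2" by (simp only: exp_mult_exp_minus_cancel)
  qed
  ultimately show "\<bar>stein_function (x + v) - stein_function x - (- flow_integral H x) \<bullet> v\<bar> \<le> C * (norm v)\<^sup>2"
    by simp
qed

end

subsection \<open>Regularity of test functions\<close>

lemma H_class_higher_deriv_bound:
  assumes "h \<in> H_class r" "length vs \<le> r" "\<And>v. v \<in> set vs \<Longrightarrow> norm v = 1"
  shows "\<bar>higher_deriv h vs x\<bar> \<le> 1"
proof -
  have "ereal \<bar>higher_deriv h vs x\<bar> \<le> deriv_op_norm (length vs) h x"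
    unfolding deriv_op_norm_def using assms(3) by (intro SUP_upper) auto
  also have "\<dots> \<le> M_sup (length vs) h"
    unfolding M_sup_def by (intro SUP_upper) auto
  also have "\<dots> \<le> 1" using assms(1,2) by (simp add: H_class_def)
  finally show ?thesis by simp
qed

lemma bounded_on_unit_imp_bound:
  fixes f :: "'a::real_normed_vector \<Rightarrow> real"
  assumes "linear f" "\<And>v. norm v = 1 \<Longrightarrow> \<bar>f v\<bar> \<le> B"
  shows "\<bar>f v\<bar> \<le> B * norm v"
proof (cases "v = 0")
  case True
  then show ?thesis using linear_0[OF assms(1)] by simp
next
  case False
  have "\<bar>f ((1 / norm v) *\<^sub>R v)\<bar> \<le> B" using False by (intro assms(2)) simp
  then have "\<bar>f v\<bar> / norm v \<le> B" by (simp add: linear_cmul[OF assms(1)] abs_mult)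
  then show ?thesis using False by (simp add: divide_le_eq)
qed

text \<open>The bounds on first and second derivatives give the Lipschitz bounds by the mean value
  inequality, and the Taylor bound follows from the Lipschitz gradient.\<close>

lemma H_class_2_C11_pair:
  fixes h :: "'a::euclidean_space \<Rightarrow> real"
  assumes h: "h \<in> H_class 2"
  obtains H where "C11_pair h H 1"
proof
  have diff: "higher_deriv h vs differentiable (at x)" if "length vs < 2" for vs x
    using h that by (auto simp: H_class_def times_cont_diff_def)
  define D where "D x = frechet_derivative h (at x)" for x
  have hd: "(h has_derivative D x) (at x)" for x
    using diff[of "[]" x] by (simp add: D_def frechet_derivative_works)
  have lin: "linear (D x)" for x using hd[of x] by (rule has_derivative_linear)
  have Db: "\<bar>D x v\<bar> \<le> 1 * norm v" for x v
    by (rule bounded_on_unit_imp_bound[OF lin])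
       (use H_class_higher_deriv_bound[OF h, of "[w]" x for w] in \<open>auto simp: D_def\<close>)
  have Dlip1: "\<bar>D x v - D y v\<bar> \<le> 1 * norm (x - y)" if v: "norm v = 1" for x y v
  proof -
    \<comment> \<open>The bound on \<open>higher_deriv h [w, v]\<close> concerns unit vectors, so v
      stays a fixed unit vector here and homogeneity extends the estimate to all v in
      \<open>Dlip\<close>.\<close>
    define E where "E z = frechet_derivative (\<lambda>x. D x v) (at z)" for z
    have E: "((\<lambda>x. D x v) has_derivative E z) (at z)" for z
      using diff[of "[v]" z] by (simp add: D_def E_def frechet_derivative_works[symmetric])
    have Eb: "\<bar>E z w\<bar> \<le> 1 * norm w" for z w
      by (rule bounded_on_unit_imp_bound[OF has_derivative_linear[OF E]])
         (use H_class_higher_deriv_bound[OF h, of "[w', v]" z for w'] v in \<open>auto simp: D_def E_def\<close>)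
    have "norm (D x v - D y v) \<le> 1 * norm (x - y)"
      by (rule differentiable_bound[OF convex_UNIV, where f' = E])
         (use E Eb in \<open>auto intro!: onorm_le\<close>)
    then show ?thesis by simp
  qed
  have Dlip: "\<bar>D x v - D y v\<bar> \<le> norm (x - y) * norm v" for x y v
    using bounded_on_unit_imp_bound[of "\<lambda>v. D x v - D y v" "norm (x - y)" v] lin Dlip1
    by (simp add: linear_compose_sub)
  \<comment> \<open>The Riesz representative of the linear form \<open>D x\<close>.\<close>
  define H where "H x = (\<Sum>b\<in>Basis. D x b *\<^sub>R b)" for x
  have H: "H x \<bullet> v = D x v" for x v
  proof -
    have "D x v = D x (\<Sum>b\<in>Basis. (v \<bullet> b) *\<^sub>R b)" by (simp add: euclidean_representation)
    also have "\<dots> = (\<Sum>b\<in>Basis. (v \<bullet> b) * D x b)"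
      by (simp only: linear_sum[OF lin] linear_cmul[OF lin] real_scaleR_def)
    also have "\<dots> = (\<Sum>b\<in>Basis. D x b * (b \<bullet> v))"
      by (intro sum.cong refl) (simp add: inner_commute mult.commute)
    finally show ?thesis by (simp add: H_def inner_sum_left)
  qed
  show "C11_pair h H 1"
    unfolding C11_pair_def
  proof (intro conjI allI)
    show "\<bar>h x\<bar> \<le> 1" for x using H_class_higher_deriv_bound[OF h, of "[]" x] by simp
    show "norm (H x) \<le> 1" for x
    proof -
      \<comment> \<open>The bound on \<open>D x\<close> is tested at the vector \<open>H x\<close>
        itself, where its value is the squared norm; the Lipschitz bound below is obtained the same
        way.\<close>
      have "norm (H x) * norm (H x) \<le> norm (H x)"
        using Db[of x "H x"] unfolding H[symmetric] by (simp add: norm_eq_sqrt_inner abs_of_nonneg)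
      then show ?thesis by (cases "H x = 0") (auto simp: mult_le_cancel_right1)
    qed
    show "\<bar>h x - h y\<bar> \<le> 1 * norm (x - y)" for x y
    proof -
      have "norm (h x - h y) \<le> 1 * norm (x - y)"
        by (rule differentiable_bound[OF convex_UNIV, where f' = D])
           (use hd Db in \<open>auto intro!: onorm_le\<close>)
      then show ?thesis by simp
    qed
    show lipH: "norm (H x - H y) \<le> 1 * norm (x - y)" for x y
    proof -
      have "norm (H x - H y) * norm (H x - H y) \<le> norm (x - y) * norm (H x - H y)"
        using Dlip[of x "H x - H y" y] unfolding H[symmetric] inner_diff_left[symmetric]
        by (simp add: norm_eq_sqrt_inner[of "H x - H y"] abs_of_nonneg)
      then show ?thesis by (cases "H x - H y = 0") (auto simp: mult_le_cancel_right)
    qed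
    show "\<bar>h (x + v) - h x - H x \<bullet> v\<bar> \<le> 1 * (norm v)\<^sup>2" for x v
    proof -
      \<comment> \<open>With the linear part at x removed, the derivative on the ball of radius |v|
        is at most |v|, so the mean value inequality yields |v|^2.\<close>
      let ?f = "\<lambda>y. h y - H x \<bullet> y"
      have "norm (?f (x + v) - ?f x) \<le> norm v * norm (x + v - x)"
      proof (rule differentiable_bound[OF convex_cball, where f' = "\<lambda>y w. D y w - H x \<bullet> w"])
        fix y assume y: "y \<in> cball x (norm v)"
        show "(?f has_derivative (\<lambda>w. D y w - H x \<bullet> w)) (at y within cball x (norm v))"
          by (intro derivative_intros has_derivative_at_withinI[OF hd])
        show "onorm (\<lambda>w. D y w - H x \<bullet> w) \<le> norm v"
        proof (rule onorm_le)
          fix w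
          have "norm (D y w - H x \<bullet> w) \<le> norm (y - x) * norm w"
            using Dlip[of y w x] by (simp add: H)
          also have "\<dots> \<le> norm v * norm w"
            using y by (intro mult_right_mono) (auto simp: dist_norm norm_minus_commute)
          finally show "norm (D y w - H x \<bullet> w) \<le> norm v * norm w" .
        qed
      qed (auto simp: dist_norm)
      then show ?thesis by (simp add: inner_add_right power2_eq_square algebra_simps)
    qed
  qed
qed

lemma Cc_infinity_integrable:
  assumes "h \<in> Cc_infinity"
  shows "integrable lborel h"
proof -
  let ?S = "closure {x. h x \<noteq> 0}"
  have "continuous_on UNIV (higher_deriv h [])"
    using assms unfolding Cc_infinity_def times_cont_diff_def by blast
  then have "integrable lborel (\<lambda>x. indicator ?S x *\<^sub>R h x)"
    using assms by (intro borel_integrable_compact) (auto simp: Cc_infinity_def intro: continuous_on_subset)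
  also have "(\<lambda>x. indicator ?S x *\<^sub>R h x) = h"
    using closure_subset[of "{x. h x \<noteq> 0}"] by (auto simp: fun_eq_iff indicator_def)
  finally show ?thesis .
qed

theorem proposition3p3:
  fixes M :: "'w measure"
    and X :: "'w \<Rightarrow> 'a::euclidean_space"
    and b :: 'a
    and \<nu> lam :: "'a measure"
    and k :: "'a \<Rightarrow> real \<Rightarrow> real"
    and \<mu> :: "real \<Rightarrow> 'a measure"
    and h :: "'a \<Rightarrow> real"
  assumes "prob_space M"
    and "X \<in> borel_measurable M"
    and "nondegenerate (distr M borel X)"
    and "self_decomposable (distr M borel X)"
    and "ID_law (distr M borel X) b (\<lambda>_. 0) \<nu>"
    and "integrable M (\<lambda>\<omega>. norm (X \<omega>))"
    and "emeasure \<nu> UNIV \<noteq> 0"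
    and "polar_decomposition \<nu> lam k"
    and "\<And>a c. 0 < a \<Longrightarrow> a < c \<Longrightarrow> esssup lam (\<lambda>x. SUP r\<in>{a<..<c}. ereal (k x r)) < \<infinity>"
    and "\<And>t. t \<ge> 0 \<Longrightarrow> quotient_law (distr M borel X) (exp (- t)) (\<mu> t)"
    and "h \<in> H_class 2 \<inter> Cc_infinity"
  defines "f \<equiv> stein_solution M X \<mu> h"
  shows "\<forall>x.
      set_integrable lborel {0..} (\<lambda>t. P_semigroup \<mu> t h x - (LINT \<omega>|M. h (X \<omega>))) \<and>
      f differentiable (at x) \<and>
      integrable \<nu> (\<lambda>u. (gradient f (x + u) - gradient f x) \<bullet> u) \<and>
      ((LINT \<omega>|M. X \<omega>) - x) \<bullet> gradient f x
        + (LINT u|\<nu>. (gradient f (x + u) - gradient f x) \<bullet> u)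
      = h x - (LINT \<omega>|M. h (X \<omega>))"
proof -
  interpret M: prob_space M by fact
  note [measurable] = assms(2)
  have h: "h \<in> H_class 2" "h \<in> Cc_infinity" using assms(11) by auto
  obtain H where H: "C11_pair h H 1" by (rule H_class_2_C11_pair[OF h(1)])
  have [measurable]: "h \<in> borel_measurable borel" by (rule C11_pair_measurable[OF H])
  interpret OU_function "distr M borel X" \<nu> b \<mu> h H 1
  proof (intro OU_function.intro OU_setting.intro OU_function_axioms.intro)
    show "prob_space (distr M borel X)" by (rule M.prob_space_distr) measurable
    show "integrable (distr M borel X) norm"
      using assms(6) by (subst integrable_distr_eq) auto
  qed (use assms(5,10) H Cc_infinity_integrable[OF h(2)] in auto)
  have mean: "(LINT \<omega>|M. X \<omega>) = mean"
    unfolding mean_def by (rule integral_distr[symmetric]) measurable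
  have Eh: "(LINT \<omega>|M. h (X \<omega>)) = (LINT y|distr M borel X. h y)"
    by (rule integral_distr[symmetric]) measurable
  have P: "flow h t x = P_semigroup \<mu> t h x" if "0 \<le> t" for t x
    using that by (simp add: flow_def P_semigroup_def)
  \<comment> \<open>\<open>flow\<close> and \<open>P_semigroup\<close> are known to agree for t
    \<ge> 0, and the Stein integral only runs over such t.\<close>
  have f: "f = stein_function"
  proof
    fix x
    show "f x = stein_function x"
      unfolding f_def stein_solution_def stein_function_eq Eh
      by (intro arg_cong[where f = uminus] set_lebesgue_integral_cong) (auto simp: P)
  qed
  have grad: "gradient f x = - flow_integral H x" for x
    unfolding f by (rule gradient_eqI[OF stein_function_GDERIV])
  \<comment> \<open>The gradient is minus \<open>flow_integral H\<close>, so negating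
    \<open>stein_identity_h\<close> gives the required orientation h(x) - E h(X).\<close>
  have neg: "(- flow_integral H (x + u) - - flow_integral H x) \<bullet> u
      = - ((flow_integral H (x + u) - flow_integral H x) \<bullet> u)" for x u
    by (simp add: inner_diff_left)
  show ?thesis
  proof (intro allI conjI)
    fix x
    have "set_integrable lborel {0..} (\<lambda>t. P_semigroup \<mu> t h x - (LINT \<omega>|M. h (X \<omega>)))
      \<longleftrightarrow> set_integrable lborel {0..} (\<lambda>t. flow h t x - (LINT y|distr M borel X. h y))"
      unfolding Eh by (intro set_integrable_cong) (auto simp: P)
    then show "set_integrable lborel {0..} (\<lambda>t. P_semigroup \<mu> t h x - (LINT \<omega>|M. h (X \<omega>)))"
      using set_integrable_flow by blast
    show "f differentiable (at x)"
      using stein_function_GDERIV[of x] unfolding f gderiv_def by (rule differentiableI)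
    show "integrable \<nu> (\<lambda>u. (gradient f (x + u) - gradient f x) \<bullet> u)"
      unfolding grad neg by (intro integrable_minus generator_integrable)
    show "((LINT \<omega>|M. X \<omega>) - x) \<bullet> gradient f x
        + (LINT u|\<nu>. (gradient f (x + u) - gradient f x) \<bullet> u) = h x - (LINT \<omega>|M. h (X \<omega>))"
      using stein_identity_h[of x] unfolding grad neg mean Eh by simp
  qed
qed

end
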